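(* Let $(\kappa,G)$ be a chain digraph of the family $\mathcal F_2$, that is, $G=(V,E)$ is a unicyclic graph directed centripetally and $\kappa_{i,j}$ is even for every directed edge $(v_i,v_j)\in E$. Then the Lie algebra $\mathfrak g(\kappa,G)$ is symplectic. Moreover, the 2-form $$\sigma_G=\sum_{(v_i,v_j)\in E}\sigma_{i,j},\qquad \sigma_{i,j}=\sum_{l=1}^{\kappa_{i,j}/2}(-1)^{l+1}\,(w_{i,j}^{l})^*\wedge (w_{i,j}^{\kappa_{i,j}+1-l})^*,$$ is a symplectic form on $\mathfrak g(\kappa,G)$.
   Context: All Lie algebras are finite-dimensional over a field $\mathbb{K}$ of characteristic zero. For a Lie algebra $\mathfrak g$, $d:\mathfrak g^*\to\Lambda^2\mathfrak g^*$ is the dual of the bracket $\Lambda^2\mathfrak g\to\mathfrak g$, extended by $d(\alpha\wedge\beta)=d\alpha\wedge\beta-\alpha\wedge d\beta$ for $\alpha,\beta\in\mathfrak g^*$. A symplectic form on a Lie algebra of dimension $2n$ is $\omega\in\Lambda^2\mathfrak g^*$ with $d\omega=0$ and $\omega^n\neq0$; $\mathfrak g$ is symplectic if it admits one. A digraph is a pair $G=(V,E)$ with $V=\{v_1,\dots,v_m\}$ finite, $E\subseteq V\times V$, such that $(u,v)\in E$ implies $(v,u)\notin E$ (in particular no loops). A unicyclic graph is a connected simple graph with exactly one cycle; it is a cycle with a (possibly trivial) tree attached at each vertex of the cycle. It is directed centripetally if each attached tree is directed from the leaves to its root, the root being its vertex on the cycle (i.e. every other vertex of the tree has a directed path to the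 root), and the cycle is given one of its two cyclic orientations. A chain digraph is a pair $(\kappa,G)$ with $G=(V,E)$ a digraph and $\kappa:E\to\mathbb{N}_{\ge2}$ a function; $\kappa_{i,j}=\kappa((v_i,v_j))$ and $k$ is the maximum value of $\kappa$. Let $L_{(k)}(m)$ be the free $k$-step nilpotent Lie algebra on $v_1,\dots,v_m$ and $\mathfrak g(k,G)=L_{(k)}(m)/I$, where $I$ is the ideal generated by all $[v_i,v_j]$ such that neither $(v_i,v_j)$ nor $(v_j,v_i)$ is in $E$. It is graded by $\mathbb{Z}_{\ge0}^m$ with $v_i$ in multidegree $e_i$; $V_d$ denotes the sum of the components of total degree $d$. For $(v_i,v_j)\in E$ and $1\le c\le k$, let $I_{i,j}^{c}$ be the sum of all multihomogeneous components of $\mathfrak g(k,G)$ whose multidegree is not in $\{e_j\}\cup\{e_i+(l-1)e_j:1\le l\le c\}$; it is an ideal. Put $I_\kappa=\big(\bigcap_{(v_i,v_j)\in E}I_{i,j}^{\kappa_{i,j}}\big)\cap(V_3\oplus\dots\oplus V_k)$ and $\mathfrak g(\kappa,G)=\mathfrak g(k,G)/I_\kappa$. For $(v_i,v_j)\in E$ define $w_{i,j}^1=v_i$, $w_{i,j}^2=[v_i,v_j]$, $w_{i,j}^l=[w_{i,j}^{l-1},v_j]$ for $l\ge3$; the same symbols denote images in $\mathfrak g(\kappa,G)$. The standard basis of $\mathfrak g(\kappa,G)$ is $\{v_1,\dots,v_m\}\cup\{w_{i,j}^l:(v_i,v_j)\in E,\ 2\le l\le\kappa_{i,j}\}$, and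 the only nonzero brackets of basis elements, up to skew-symmetry, are $[w_{i,j}^l,v_j]=w_{i,j}^{l+1}$ for $(v_i,v_j)\in E$, $1\le l\le\kappa_{i,j}-1$. A superscript ${}^*$ denotes the element of the dual of the standard basis. *)

theory Defs
  imports
    "HOL-Library.Multiset"
    "HOL-Combinatorics.Permutations"
    "Graph_Theory.Graph_Theory"
begin

section \<open>Algebras with explicit carrier\<close>

record ('k, 'a) alg =
  carrier :: "'a set"
  add :: "'a \<Rightarrow> 'a \<Rightarrow> 'a" (infixl "\<boxplus>\<index>" 65)
  zero :: "'a" ("\<zero>\<index>")
  smult :: "'k \<Rightarrow> 'a \<Rightarrow> 'a" (infixr "\<odot>\<index>" 70)
  bracket :: "'a \<Rightarrow> 'a \<Rightarrow> 'a"

locale vec_space =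
  fixes L :: "('k::field, 'a) alg" (structure)
  assumes add_closed: "\<lbrakk>x \<in> carrier L; y \<in> carrier L\<rbrakk> \<Longrightarrow> x \<boxplus> y \<in> carrier L"
    and zero_closed: "\<zero> \<in> carrier L"
    and smult_closed: "x \<in> carrier L \<Longrightarrow> c \<odot> x \<in> carrier L"
    and add_assoc: "\<lbrakk>x \<in> carrier L; y \<in> carrier L; z \<in> carrier L\<rbrakk>
          \<Longrightarrow> (x \<boxplus> y) \<boxplus> z = x \<boxplus> (y \<boxplus> z)"
    and add_commute: "\<lbrakk>x \<in> carrier L; y \<in> carrier L\<rbrakk> \<Longrightarrow> x \<boxplus> y = y \<boxplus> x"
    and add_zero: "x \<in> carrier L \<Longrightarrow> x \<boxplus> \<zero> = x"
    and add_inverse: "x \<in> carrier L \<Longrightarrow> \<exists>y\<in>carrier L. x \<boxplus> y = \<zero>"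
    and smult_add_right: "\<lbrakk>x \<in> carrier L; y \<in> carrier L\<rbrakk> \<Longrightarrow> c \<odot> (x \<boxplus> y) = c \<odot> x \<boxplus> c \<odot> y"
    and smult_add_left: "x \<in> carrier L \<Longrightarrow> (c + c') \<odot> x = c \<odot> x \<boxplus> c' \<odot> x"
    and smult_smult: "x \<in> carrier L \<Longrightarrow> c \<odot> (c' \<odot> x) = (c * c') \<odot> x"
    and smult_one: "x \<in> carrier L \<Longrightarrow> 1 \<odot> x = x"

locale lie_algebra = vec_space +
  assumes bracket_closed: "\<lbrakk>x \<in> carrier L; y \<in> carrier L\<rbrakk> \<Longrightarrow> bracket L x y \<in> carrier L"
    and bracket_add_left: "\<lbrakk>x \<in> carrier L; y \<in> carrier L; z \<in> carrier L\<rbrakk>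
          \<Longrightarrow> bracket L (x \<boxplus> y) z = bracket L x z \<boxplus> bracket L y z"
    and bracket_add_right: "\<lbrakk>x \<in> carrier L; y \<in> carrier L; z \<in> carrier L\<rbrakk>
          \<Longrightarrow> bracket L x (y \<boxplus> z) = bracket L x y \<boxplus> bracket L x z"
    and bracket_smult_left: "\<lbrakk>x \<in> carrier L; y \<in> carrier L\<rbrakk>
          \<Longrightarrow> bracket L (c \<odot> x) y = c \<odot> bracket L x y"
    and bracket_smult_right: "\<lbrakk>x \<in> carrier L; y \<in> carrier L\<rbrakk>
          \<Longrightarrow> bracket L x (c \<odot> y) = c \<odot> bracket L x y"
    and bracket_self: "x \<in> carrier L \<Longrightarrow> bracket L x x = \<zero>"
    and jacobi: "\<lbrakk>x \<in> carrier L; y \<in> carrier L; z \<in> carrier L\<rbrakk>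
          \<Longrightarrow> bracket L x (bracket L y z) \<boxplus> bracket L y (bracket L z x)
              \<boxplus> bracket L z (bracket L x y) = \<zero>"

definition lin_subspace :: "('k, 'a) alg \<Rightarrow> 'a set \<Rightarrow> bool" where
  "lin_subspace L W \<longleftrightarrow> W \<subseteq> carrier L \<and> zero L \<in> W
     \<and> (\<forall>x\<in>W. \<forall>y\<in>W. add L x y \<in> W) \<and> (\<forall>c. \<forall>x\<in>W. smult L c x \<in> W)"

definition lin_span :: "('k, 'a) alg \<Rightarrow> 'a set \<Rightarrow> 'a set" where
  "lin_span L S = \<Inter>{W. lin_subspace L W \<and> S \<subseteq> W}"

definition is_basis :: "('k, 'a) alg \<Rightarrow> 'a set \<Rightarrow> bool" where
  "is_basis L B \<longleftrightarrow> B \<subseteq> carrier L \<and> lin_span L B = carrier L \<and> (\<forall>b\<in>B. b \<notin> lin_span L (B - {b}))"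

definition has_dim :: "('k, 'a) alg \<Rightarrow> nat \<Rightarrow> bool" where
  "has_dim L n \<longleftrightarrow> (\<exists>B. finite B \<and> card B = n \<and> is_basis L B)"

definition is_ideal :: "('k, 'a) alg \<Rightarrow> 'a set \<Rightarrow> bool" where
  "is_ideal L J \<longleftrightarrow> lin_subspace L J
     \<and> (\<forall>x\<in>carrier L. \<forall>y\<in>J. bracket L x y \<in> J \<and> bracket L y x \<in> J)"

definition ideal_gen :: "('k, 'a) alg \<Rightarrow> 'a set \<Rightarrow> 'a set" where
  "ideal_gen L S = \<Inter>{J. is_ideal L J \<and> S \<subseteq> J}"

definition coset :: "('k, 'a) alg \<Rightarrow> 'a set \<Rightarrow> 'a \<Rightarrow> 'a set" where
  "coset L J x = {add L x j | j. j \<in> J}"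

definition quot :: "('k, 'a) alg \<Rightarrow> 'a set \<Rightarrow> ('k, 'a set) alg" where
  "quot L J = \<lparr>
     carrier = coset L J ` carrier L,
     add = (\<lambda>A B. \<Union>a\<in>A. \<Union>b\<in>B. coset L J (add L a b)),
     zero = coset L J (zero L),
     smult = (\<lambda>c A. \<Union>a\<in>A. coset L J (smult L c a)),
     bracket = (\<lambda>A B. \<Union>a\<in>A. \<Union>b\<in>B. coset L J (bracket L a b)) \<rparr>"

text \<open>\<open>lower_central L r\<close> is spanned by the brackets of \<open>r + 1\<close> elements, so that \<open>L\<close> is
  at most \<open>r\<close>-step nilpotent iff \<open>lower_central L r\<close> vanishes.\<close>

primrec lower_central :: "('k, 'a) alg \<Rightarrow> nat \<Rightarrow> 'a set" where
  "lower_central L 0 = carrier L"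
| "lower_central L (Suc r) =
     lin_span L {bracket L x y | x y. x \<in> carrier L \<and> y \<in> lower_central L r}"


section \<open>Exterior forms and symplectic Lie algebras\<close>

text \<open>A \<open>p\<close>-form, i.e. an element of the \<open>p\<close>-th exterior power of the dual of a
  finite-dimensional \<open>L\<close>, is an alternating multilinear function of \<open>p\<close> arguments, given as a
  list. It is required to be \<open>0\<close> on every other list, so that equality of forms is equality of
  functions.\<close>

definition forms :: "('k::field, 'a) alg \<Rightarrow> nat \<Rightarrow> ('a list \<Rightarrow> 'k) set" where
  "forms L p = {\<phi>.
     (\<forall>xs. \<not> (length xs = p \<and> set xs \<subseteq> carrier L) \<longrightarrow> \<phi> xs = 0) \<and>
     (\<forall>xs i x y. length xs = p \<and> set xs \<subseteq> carrier L \<and> i < p \<and> x \<in> carrier L \<and> y \<in> carrier L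
        \<longrightarrow> \<phi> (xs[i := add L x y]) = \<phi> (xs[i := x]) + \<phi> (xs[i := y])) \<and>
     (\<forall>xs i x c. length xs = p \<and> set xs \<subseteq> carrier L \<and> i < p \<and> x \<in> carrier L
        \<longrightarrow> \<phi> (xs[i := smult L c x]) = c * \<phi> (xs[i := x])) \<and>
     (\<forall>xs. \<not> distinct xs \<longrightarrow> \<phi> xs = 0)}"

text \<open>Normalised so that the wedge of two covectors is
  \<open>\<alpha> x * \<beta> y - \<alpha> y * \<beta> x\<close>; see \<open>wedge_1_1\<close> below.\<close>

definition wedge :: "nat \<Rightarrow> nat \<Rightarrow> ('a list \<Rightarrow> 'k::field_char_0) \<Rightarrow> ('a list \<Rightarrow> 'k) \<Rightarrow> 'a list \<Rightarrow> 'k"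
  where
  "wedge p q \<alpha> \<beta> xs =
     (if length xs = p + q then
        (\<Sum>\<pi> | \<pi> permutes {..<p + q}. of_int (sign \<pi>)
            * \<alpha> (map (\<lambda>i. xs ! \<pi> i) [0..<p]) * \<beta> (map (\<lambda>i. xs ! \<pi> i) [p..<p + q]))
        / (fact p * fact q)
      else 0)"

primrec wedge_power2 :: "('a list \<Rightarrow> 'k::field_char_0) \<Rightarrow> nat \<Rightarrow> 'a list \<Rightarrow> 'k" where
  "wedge_power2 \<omega> 0 = (\<lambda>xs. if xs = [] then 1 else 0)"
| "wedge_power2 \<omega> (Suc n) = wedge 2 (2 * n) \<omega> (wedge_power2 \<omega> n)"

definition d1 :: "('k::field, 'a) alg \<Rightarrow> ('a list \<Rightarrow> 'k) \<Rightarrow> 'a list \<Rightarrow> 'k" where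
  "d1 L \<alpha> xs = (if length xs = 2 \<and> set xs \<subseteq> carrier L then \<alpha> [bracket L (xs ! 0) (xs ! 1)] else 0)"

text \<open>The extension of \<open>d1\<close> to 2-forms by
  \<open>d (\<alpha> \<and> \<beta>) = d \<alpha> \<and> \<beta> - \<alpha> \<and> d \<beta>\<close>, in closed form; see \<open>d2_wedge\<close> below.\<close>

definition d2 :: "('k::field, 'a) alg \<Rightarrow> ('a list \<Rightarrow> 'k) \<Rightarrow> 'a list \<Rightarrow> 'k" where
  "d2 L \<omega> xs = (if length xs = 3 \<and> set xs \<subseteq> carrier L then
     \<omega> [bracket L (xs ! 0) (xs ! 1), xs ! 2]
     + \<omega> [bracket L (xs ! 1) (xs ! 2), xs ! 0]
     + \<omega> [bracket L (xs ! 2) (xs ! 0), xs ! 1] else 0)"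

definition symplectic_form :: "('k::field_char_0, 'a) alg \<Rightarrow> ('a list \<Rightarrow> 'k) \<Rightarrow> bool" where
  "symplectic_form L \<omega> \<longleftrightarrow> lie_algebra L \<and> \<omega> \<in> forms L 2 \<and> d2 L \<omega> = (\<lambda>_. 0)
     \<and> (\<exists>n. has_dim L (2 * n) \<and> wedge_power2 \<omega> n \<noteq> (\<lambda>_. 0))"

definition symplectic :: "('k::field_char_0, 'a) alg \<Rightarrow> bool" where
  "symplectic L \<longleftrightarrow> (\<exists>\<omega>. symplectic_form L \<omega>)"

definition dual_elem :: "('k::field, 'a) alg \<Rightarrow> 'a set \<Rightarrow> 'a \<Rightarrow> 'a list \<Rightarrow> 'k" where
  "dual_elem L B b = (THE \<phi>. \<phi> \<in> forms L 1 \<and> (\<forall>b'\<in>B. \<phi> [b'] = (if b' = b then 1 else 0)))"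


lemma wedge_1_1: "wedge 1 1 \<alpha> \<beta> [x, y] = \<alpha> [x] * \<beta> [y] - \<alpha> [y] * \<beta> [x]"
proof -
  have "{..<2::nat} = insert 0 {1}" by auto
  then show ?thesis
    by (simp add: wedge_def sum_over_permutations_insert sign_swap_id transpose_def numeral_2_eq_2)
qed

lemma sum_permutes_3:
  fixes f :: "(nat \<Rightarrow> nat) \<Rightarrow> 'k::comm_monoid_add"
  shows "(\<Sum>\<pi> | \<pi> permutes {..<3}. f \<pi>) =
    f id + f (transpose 1 2) + (f (transpose 0 1) + f (transpose 0 1 \<circ> transpose 1 2))
     + (f (transpose 0 2) + f (transpose 0 2 \<circ> transpose 1 2))"
proof -
  have *: "{..<3::nat} = insert 0 (insert 1 {2})" by auto
  show ?thesis
    unfolding * by (subst sum_over_permutations_insert, simp, simp)+ (simp add: add_ac)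
qed

lemma sign_3_cycles:
  "sign (transpose 0 1 \<circ> transpose 1 (2::nat)) = 1"
  "sign (transpose 0 2 \<circ> transpose 1 (2::nat)) = 1"
  by (simp_all add: sign_compose permutation_swap_id sign_swap_id)

lemma wedge_2_1: "wedge 2 1 \<gamma> \<beta> [x, y, z] =
    ((\<gamma> [x, y] - \<gamma> [y, x]) * \<beta> [z] + (\<gamma> [y, z] - \<gamma> [z, y]) * \<beta> [x]
      + (\<gamma> [z, x] - \<gamma> [x, z]) * \<beta> [y]) / 2"
  by (simp add: wedge_def sum_permutes_3 sum_permutes_3[unfolded numeral_3_eq_3] upt_rec
      sign_3_cycles sign_3_cycles[unfolded One_nat_def] sign_swap_id transpose_def field_simps)

lemma wedge_1_2: "wedge 1 2 \<beta> \<gamma> [x, y, z] =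
    (\<beta> [x] * (\<gamma> [y, z] - \<gamma> [z, y]) + \<beta> [y] * (\<gamma> [z, x] - \<gamma> [x, z])
      + \<beta> [z] * (\<gamma> [x, y] - \<gamma> [y, x])) / 2"
  by (simp add: wedge_def sum_permutes_3 sum_permutes_3[unfolded numeral_3_eq_3] upt_rec
      sign_3_cycles sign_3_cycles[unfolded One_nat_def] sign_swap_id transpose_def field_simps)

lemma (in lie_algebra) form_bracket_swap:
  assumes \<phi>: "\<phi> \<in> forms L 1" and x: "x \<in> carrier L" and y: "y \<in> carrier L"
  shows "\<phi> [bracket L y x] = - \<phi> [bracket L x y]"
proof -
  have add: "\<phi> [u \<boxplus> v] = \<phi> [u] + \<phi> [v]" if "u \<in> carrier L" "v \<in> carrier L" for u v
  proof -
    have "\<forall>xs i x y. length xs = 1 \<and> set xs \<subseteq> carrier L \<and> i < 1 \<and> x \<in> carrier L \<and> y \<in> carrier L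
        \<longrightarrow> \<phi> (xs[i := add L x y]) = \<phi> (xs[i := x]) + \<phi> (xs[i := y])"
      using \<phi> unfolding forms_def by blast
    from this[rule_format, of "[u]" 0 u v] that show ?thesis by simp
  qed
  have zero: "\<phi> [\<zero>] = 0"
    using add[OF zero_closed zero_closed] add_zero[OF zero_closed] by (metis add_cancel_left_left)
  have "\<phi> [bracket L (x \<boxplus> y) (x \<boxplus> y)] =
      \<phi> [bracket L x x] + \<phi> [bracket L x y] + (\<phi> [bracket L y x] + \<phi> [bracket L y y])"
    using x y by (simp add: bracket_add_left bracket_add_right add bracket_closed add_closed)
  then have "\<phi> [bracket L x y] + \<phi> [bracket L y x] = 0"
    using x y by (simp add: bracket_self add_closed zero)
  then show ?thesis
    by (simp add: eq_neg_iff_add_eq_0 add.commute)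
qed

lemma d2_wedge:
  fixes L :: "('k::field_char_0, 'a) alg"
  assumes L: "lie_algebra L" and \<alpha>: "\<alpha> \<in> forms L 1" and \<beta>: "\<beta> \<in> forms L 1"
  shows "d2 L (wedge 1 1 \<alpha> \<beta>) = (\<lambda>xs. wedge 2 1 (d1 L \<alpha>) \<beta> xs - wedge 1 2 \<alpha> (d1 L \<beta>) xs)"
proof
  fix xs
  interpret lie_algebra L by (rule L)
  have out: "\<gamma> [u] = 0" if "u \<notin> carrier L" "\<gamma> \<in> forms L 1" for u \<gamma>
    using that unfolding forms_def by auto
  show "d2 L (wedge 1 1 \<alpha> \<beta>) xs = wedge 2 1 (d1 L \<alpha>) \<beta> xs - wedge 1 2 \<alpha> (d1 L \<beta>) xs"
  proof (cases "length xs = 3")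
    case False
    then show ?thesis by (simp add: d2_def wedge_def)
  next
    case True
    then obtain x y z where xs: "xs = [x, y, z]"
      by (auto simp: numeral_3_eq_3 length_Suc_conv)
    show ?thesis
    proof (cases "x \<in> carrier L \<and> y \<in> carrier L \<and> z \<in> carrier L")
      case True
      then have c: "x \<in> carrier L" "y \<in> carrier L" "z \<in> carrier L" by auto
      note sw = form_bracket_swap[OF \<alpha> c(1,2)] form_bracket_swap[OF \<alpha> c(2,3)]
        form_bracket_swap[OF \<alpha> c(3,1)] form_bracket_swap[OF \<beta> c(1,2)]
        form_bracket_swap[OF \<beta> c(2,3)] form_bracket_swap[OF \<beta> c(3,1)]
      show ?thesis
        unfolding xs wedge_2_1 wedge_1_2 using c
        by (simp add: d1_def d2_def sw wedge_1_1[simplified] algebra_simps)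
    next
      case False
      then consider "x \<notin> carrier L" | "y \<notin> carrier L" | "z \<notin> carrier L" by blast
      then show ?thesis
        unfolding xs wedge_2_1 wedge_1_2
        by cases (simp_all add: d1_def d2_def out[OF _ \<alpha>] out[OF _ \<beta>])
    qed
  qed
qed


section \<open>Free nilpotent Lie algebras\<close>

datatype (letters: 'v) monomial = Gen 'v | Br "'v monomial" "'v monomial"

text \<open>Multidegrees, i.e. vectors of nonnegative integers indexed by the vertices, are written as
  multisets of vertices; the total degree is the size.\<close>

primrec multidegree :: "'v monomial \<Rightarrow> 'v multiset" where
  "multidegree (Gen v) = {#v#}"
| "multidegree (Br s t) = multidegree s + multidegree t"

text \<open>The free nonassociative algebra: finite linear combinations of the monomials in \<open>V\<close>,
  given by their coefficient functions.\<close>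

definition free_nonassoc :: "'v set \<Rightarrow> ('k::field, 'v monomial \<Rightarrow> 'k) alg" where
  "free_nonassoc V = \<lparr>
     carrier = {f. finite {t. f t \<noteq> 0} \<and> (\<forall>t. f t \<noteq> 0 \<longrightarrow> letters t \<subseteq> V)},
     add = (\<lambda>f g t. f t + g t),
     zero = (\<lambda>_. 0),
     smult = (\<lambda>c f t. c * f t),
     bracket = (\<lambda>f g t. case t of Gen _ \<Rightarrow> 0 | Br s u \<Rightarrow> f s * g u) \<rparr>"

definition lie_relations :: "'v set \<Rightarrow> ('v monomial \<Rightarrow> 'k::field) set" where
  "lie_relations V = (let F = free_nonassoc V in
     {bracket F x x | x. x \<in> carrier F}
     \<union> {add F (add F (bracket F x (bracket F y z)) (bracket F y (bracket F z x)))
          (bracket F z (bracket F x y))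
        | x y z. x \<in> carrier F \<and> y \<in> carrier F \<and> z \<in> carrier F})"

definition free_lie_ideal :: "'v set \<Rightarrow> ('v monomial \<Rightarrow> 'k::field) set" where
  "free_lie_ideal V = ideal_gen (free_nonassoc V) (lie_relations V)"

definition free_lie :: "'v set \<Rightarrow> ('k::field, ('v monomial \<Rightarrow> 'k) set) alg" where
  "free_lie V = quot (free_nonassoc V) (free_lie_ideal V)"

definition free_nilpotent :: "'v set \<Rightarrow> nat \<Rightarrow> ('k::field, ('v monomial \<Rightarrow> 'k) set set) alg" where
  "free_nilpotent V k = quot (free_lie V) (lower_central (free_lie V) k)"

definition free_nilpotent_proj ::
    "'v set \<Rightarrow> nat \<Rightarrow> ('v monomial \<Rightarrow> 'k::field) \<Rightarrow> ('v monomial \<Rightarrow> 'k) set set" where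
  "free_nilpotent_proj V k f =
     coset (free_lie V) (lower_central (free_lie V) k) (coset (free_nonassoc V) (free_lie_ideal V) f)"

definition gen :: "'v \<Rightarrow> 'v monomial \<Rightarrow> 'k::field" where
  "gen v = (\<lambda>t. if t = Gen v then 1 else 0)"


section \<open>The Lie algebra of a digraph\<close>

definition graph_ideal :: "'v pair_pre_digraph \<Rightarrow> nat \<Rightarrow> ('v monomial \<Rightarrow> 'k::field) set set set" where
  "graph_ideal G k = (let V = pverts G; N = free_nilpotent V k in
     ideal_gen N {bracket N (free_nilpotent_proj V k (gen i)) (free_nilpotent_proj V k (gen j))
       | i j. i \<in> V \<and> j \<in> V \<and> (i, j) \<notin> parcs G \<and> (j, i) \<notin> parcs G})"

definition graph_lie ::
    "'v pair_pre_digraph \<Rightarrow> nat \<Rightarrow> ('k::field, ('v monomial \<Rightarrow> 'k) set set set) alg" where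
  "graph_lie G k = quot (free_nilpotent (pverts G) k) (graph_ideal G k)"

definition graph_lie_proj ::
    "'v pair_pre_digraph \<Rightarrow> nat \<Rightarrow> ('v monomial \<Rightarrow> 'k::field) \<Rightarrow> ('v monomial \<Rightarrow> 'k) set set set" where
  "graph_lie_proj G k f =
     coset (free_nilpotent (pverts G) k) (graph_ideal G k) (free_nilpotent_proj (pverts G) k f)"

definition component ::
    "'v pair_pre_digraph \<Rightarrow> nat \<Rightarrow> 'v multiset \<Rightarrow> ('v monomial \<Rightarrow> 'k::field) set set set set" where
  "component G k d = graph_lie_proj G k `
     {f \<in> carrier (free_nonassoc (pverts G)). \<forall>t. f t \<noteq> 0 \<longrightarrow> multidegree t = d}"


section \<open>The Lie algebra of a chain digraph\<close>

definition chain_digraph :: "'v pair_pre_digraph \<Rightarrow> ('v \<times> 'v \<Rightarrow> nat) \<Rightarrow> bool" where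
  "chain_digraph G \<kappa> \<longleftrightarrow> pair_fin_digraph G
     \<and> (\<forall>u v. (u, v) \<in> parcs G \<longrightarrow> (v, u) \<notin> parcs G) \<and> (\<forall>e\<in>parcs G. 2 \<le> \<kappa> e)"

definition max_chain :: "'v pair_pre_digraph \<Rightarrow> ('v \<times> 'v \<Rightarrow> nat) \<Rightarrow> nat" where
  "max_chain G \<kappa> = Max (\<kappa> ` parcs G)"

text \<open>For an arc \<open>(i, j)\<close>, the multiset \<open>add_mset i (replicate_mset (l - 1) j)\<close> is the multidegree
  \<open>e\<^sub>i + (l - 1) e\<^sub>j\<close>.\<close>

definition arc_ideal ::
    "'v pair_pre_digraph \<Rightarrow> nat \<Rightarrow> nat \<Rightarrow> 'v \<times> 'v \<Rightarrow> ('v monomial \<Rightarrow> 'k::field) set set set set" where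
  "arc_ideal G k c = (\<lambda>(i, j). lin_span (graph_lie G k)
     (\<Union>d \<in> - ({{#j#}} \<union> {add_mset i (replicate_mset (l - 1) j) | l. 1 \<le> l \<and> l \<le> c}).
        component G k d))"

definition chain_ideal ::
    "'v pair_pre_digraph \<Rightarrow> ('v \<times> 'v \<Rightarrow> nat) \<Rightarrow> ('v monomial \<Rightarrow> 'k::field) set set set set" where
  "chain_ideal G \<kappa> = (let k = max_chain G \<kappa> in
     (\<Inter>e\<in>parcs G. arc_ideal G k (\<kappa> e) e)
     \<inter> lin_span (graph_lie G k) (\<Union>d \<in> {d. 3 \<le> size d \<and> size d \<le> k}. component G k d))"

type_synonym ('v, 'k) chain_elem = "('v monomial \<Rightarrow> 'k) set set set set"

definition chain_lie ::
    "'v pair_pre_digraph \<Rightarrow> ('v \<times> 'v \<Rightarrow> nat) \<Rightarrow> ('k::field, ('v, 'k) chain_elem) alg" where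
  "chain_lie G \<kappa> = quot (graph_lie G (max_chain G \<kappa>)) (chain_ideal G \<kappa>)"

definition vertex_elem ::
    "'v pair_pre_digraph \<Rightarrow> ('v \<times> 'v \<Rightarrow> nat) \<Rightarrow> 'v \<Rightarrow> ('v, 'k::field) chain_elem" where
  "vertex_elem G \<kappa> v = coset (graph_lie G (max_chain G \<kappa>)) (chain_ideal G \<kappa>)
     (graph_lie_proj G (max_chain G \<kappa>) (gen v))"

text \<open>\<open>chain_vec G \<kappa> (i, j) l\<close> is \<open>[\<dots>[[v\<^sub>i, v\<^sub>j], v\<^sub>j], \<dots>, v\<^sub>j]\<close> with \<open>l - 1\<close> brackets; only
  \<open>l \<ge> 1\<close> is used.\<close>

definition chain_vec ::
    "'v pair_pre_digraph \<Rightarrow> ('v \<times> 'v \<Rightarrow> nat) \<Rightarrow> 'v \<times> 'v \<Rightarrow> nat \<Rightarrow> ('v, 'k::field) chain_elem" where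
  "chain_vec G \<kappa> = (\<lambda>(i, j) l.
     ((\<lambda>x. bracket (chain_lie G \<kappa>) x (vertex_elem G \<kappa> j)) ^^ (l - 1)) (vertex_elem G \<kappa> i))"

definition standard_basis ::
    "'v pair_pre_digraph \<Rightarrow> ('v \<times> 'v \<Rightarrow> nat) \<Rightarrow> ('v, 'k::field) chain_elem set" where
  "standard_basis G \<kappa> = vertex_elem G \<kappa> ` pverts G
     \<union> {chain_vec G \<kappa> e l | e l. e \<in> parcs G \<and> 2 \<le> l \<and> l \<le> \<kappa> e}"

definition chain_dual ::
    "'v pair_pre_digraph \<Rightarrow> ('v \<times> 'v \<Rightarrow> nat) \<Rightarrow> 'v \<times> 'v \<Rightarrow> nat \<Rightarrow> ('v, 'k::field) chain_elem list \<Rightarrow> 'k"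
  where
  "chain_dual G \<kappa> e l = dual_elem (chain_lie G \<kappa>) (standard_basis G \<kappa>) (chain_vec G \<kappa> e l)"

definition sigma_arc ::
    "'v pair_pre_digraph \<Rightarrow> ('v \<times> 'v \<Rightarrow> nat) \<Rightarrow> 'v \<times> 'v \<Rightarrow> ('v, 'k::field_char_0) chain_elem list \<Rightarrow> 'k"
  where
  "sigma_arc G \<kappa> e xs = (\<Sum>l = 1..\<kappa> e div 2.
     (-1) ^ (l + 1) * wedge 1 1 (chain_dual G \<kappa> e l) (chain_dual G \<kappa> e (\<kappa> e + 1 - l)) xs)"

definition sigma ::
    "'v pair_pre_digraph \<Rightarrow> ('v \<times> 'v \<Rightarrow> nat) \<Rightarrow> ('v, 'k::field_char_0) chain_elem list \<Rightarrow> 'k" where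
  "sigma G \<kappa> xs = (\<Sum>e\<in>parcs G. sigma_arc G \<kappa> e xs)"


section \<open>Unicyclic graphs directed centripetally\<close>

text \<open>Cycles of the underlying simple graph. It is represented by the symmetric digraph
  \<open>mk_symmetric\<close>, in which \<open>u, v, u\<close> also counts as a cycle; hence the bound on the length.\<close>

definition undirected_cycle :: "'v pair_pre_digraph \<Rightarrow> ('v \<times> 'v) list \<Rightarrow> bool" where
  "undirected_cycle G p \<longleftrightarrow>
     pre_digraph.cycle (with_proj (mk_symmetric (with_proj G))) p \<and> 3 \<le> length p"

text \<open>Cycles are identified with their sets of undirected edges, so that neither the starting
  point nor the direction of traversal matters.\<close>

definition unicyclic :: "'v pair_pre_digraph \<Rightarrow> bool" where
  "unicyclic G \<longleftrightarrow> connected (with_proj G)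
     \<and> (\<exists>!C. \<exists>p. undirected_cycle G p \<and> C = (\<lambda>(u, v). {u, v}) ` set p)"

text \<open>If \<open>G\<close> is unicyclic and has no 2-cycles, then a directed cycle \<open>p\<close> is its unique cycle with one
  of the two cyclic orientations. \<open>H\<close> is \<open>G\<close> without the arcs of \<open>p\<close>, and the tree attached at \<open>r\<close>
  is the component of \<open>r\<close> in \<open>H\<close>.\<close>

definition centripetal :: "'v pair_pre_digraph \<Rightarrow> bool" where
  "centripetal G \<longleftrightarrow> (\<exists>p. pre_digraph.cycle (with_proj G) p
     \<and> (let H = with_proj (G\<lparr>parcs := parcs G - set p\<rparr>) in
          \<forall>r\<in>fst ` set p. \<forall>u. u \<rightarrow>\<^sup>*\<^bsub>with_proj (mk_symmetric H)\<^esub> r \<longrightarrow> u \<rightarrow>\<^sup>*\<^bsub>H\<^esub> r))"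

definition family_F2 :: "'v pair_pre_digraph \<Rightarrow> ('v \<times> 'v \<Rightarrow> nat) \<Rightarrow> bool" where
  "family_F2 G \<kappa> \<longleftrightarrow> chain_digraph G \<kappa> \<and> unicyclic G \<and> centripetal G \<and> (\<forall>e\<in>parcs G. even (\<kappa> e))"

end

theory Submission
  imports Defs
begin

text \<open>
The graph enters only through one fact (\<open>unique_out_arc\<close>): in a centripetal unicyclic graph every
vertex \<open>v\<close> has exactly one out-arc \<open>(v, succ v)\<close>. A vertex with no out-arc could not flow to the
cycle, and a second out-arc would close a second cycle. Hence every vertex starts exactly one chain
\<open>w(1) = v, w(2) = [v, succ v], \<dots>\<close>, the standard basis is the disjoint union of these chains, each of
even length \<open>\<kappa>\<close>, and \<open>\<sigma>\<close> pairs \<open>w(l)\<close> with \<open>w(\<kappa> + 1 - l)\<close> inside every chain, with alternating signs.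

The Lie algebra is given as a fourfold quotient of the free nonassociative algebra. It is compared
with an explicit Lie algebra \<open>model\<close> of coordinate vectors indexed by pairs \<open>(v, l)\<close>, whose only
brackets of basis vectors are \<open>[(v, l), (succ v, 1)] = (v, l + 1)\<close>. Evaluation of monomials in
\<open>model\<close> respects the Lie relations, the nilpotency and the missing edges, so it factors through
\<open>graph_lie\<close> (\<open>graph_lie_lift\<close>); it also preserves multidegrees. The chain ideal is exactly the kernel
of the factored map (\<open>chain_ideal_kernel\<close>): a component whose multidegree belongs to a chain is
spanned by one left-normed monomial (\<open>chain_monomial_mod_free_lie_ideal\<close>), which has a nonzero
value, and every other component is zero or lies in the chain ideal. So \<open>chain_lie\<close> is isomorphic to
\<open>model\<close> (\<open>chain_lie_coordinates\<close>), and the chains form a basis.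

In coordinates \<open>\<sigma>(X, Y)\<close> is the sum of \<open>(-1)^(l + 1) X(l) Y(\<kappa> + 1 - l)\<close> over all chains and
all \<open>l\<close>. On one chain,
\<open>\<sigma>([X, Y], Z)\<close> is \<open>y T(X, Z) - x T(Y, Z)\<close>, where \<open>x\<close> and \<open>y\<close> are the coordinates at \<open>succ v\<close> and
\<open>T(P, Q)\<close> is the sum of \<open>(-1)^l P(l) Q(\<kappa> - l)\<close>. As \<open>\<kappa>\<close> is even, \<open>T\<close> is symmetric,
and the cyclic sum cancels
(\<open>pairing_closed\<close>). For nondegeneracy the basis is listed pair by pair; then the Gram matrix of
\<open>\<sigma>\<close> consists of \<open>2 \<times> 2\<close> blocks, and the top power of \<open>\<sigma>\<close> on this list is \<open>n!\<close> times the
product of the signs of the blocks (\<open>wedge_power2_pfaffian_sum\<close> and \<open>pfaffian_sum_paired_matrix\<close>).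
\<close>

section \<open>Homomorphisms and quotients\<close>

text \<open>The free nonassociative algebra and its quotients are handled before skew-symmetry and the
  Jacobi identity are available, so ideals and quotients are developed for bilinear products.\<close>

locale nonassoc_algebra = vec_space +
  assumes product_closed: "\<lbrakk>x \<in> carrier L; y \<in> carrier L\<rbrakk> \<Longrightarrow> bracket L x y \<in> carrier L"
    and product_add_left: "\<lbrakk>x \<in> carrier L; y \<in> carrier L; z \<in> carrier L\<rbrakk>
          \<Longrightarrow> bracket L (x \<boxplus> y) z = bracket L x z \<boxplus> bracket L y z"
    and product_add_right: "\<lbrakk>x \<in> carrier L; y \<in> carrier L; z \<in> carrier L\<rbrakk>
          \<Longrightarrow> bracket L x (y \<boxplus> z) = bracket L x y \<boxplus> bracket L x z"
    and product_smult_left: "\<lbrakk>x \<in> carrier L; y \<in> carrier L\<rbrakk>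
          \<Longrightarrow> bracket L (c \<odot> x) y = c \<odot> bracket L x y"
    and product_smult_right: "\<lbrakk>x \<in> carrier L; y \<in> carrier L\<rbrakk>
          \<Longrightarrow> bracket L x (c \<odot> y) = c \<odot> bracket L x y"

sublocale lie_algebra \<subseteq> nonassoc_algebra
  by unfold_locales
    (simp_all add: bracket_closed bracket_add_left bracket_add_right bracket_smult_left
      bracket_smult_right)

context vec_space
begin

lemma add_left_commute:
  "\<lbrakk>x \<in> carrier L; y \<in> carrier L; z \<in> carrier L\<rbrakk> \<Longrightarrow> x \<boxplus> (y \<boxplus> z) = y \<boxplus> (x \<boxplus> z)"
  by (metis add_assoc add_commute)

lemma zero_add: "x \<in> carrier L \<Longrightarrow> \<zero> \<boxplus> x = x"
  by (metis add_commute add_zero zero_closed)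

lemma idempotent_zero:
  assumes "y \<in> carrier L" "y \<boxplus> y = y"
  shows "y = \<zero>"
proof -
  obtain y' where "y' \<in> carrier L" "y \<boxplus> y' = \<zero>"
    using add_inverse assms(1) by blast
  then show ?thesis
    using assms by (metis add_assoc add_zero)
qed

lemma smult_zero_left: "x \<in> carrier L \<Longrightarrow> 0 \<odot> x = \<zero>"
  by (rule idempotent_zero) (simp_all add: smult_closed flip: smult_add_left)

lemma smult_zero_right: "c \<odot> \<zero> = \<zero>"
  by (rule idempotent_zero) (simp_all add: smult_closed zero_closed add_zero flip: smult_add_right)

lemma add_minus: "x \<in> carrier L \<Longrightarrow> x \<boxplus> (-1) \<odot> x = \<zero>"
  using smult_add_left[of x 1 "-1"] by (simp add: smult_one smult_zero_left)

lemma minus_add: "x \<in> carrier L \<Longrightarrow> (-1) \<odot> x \<boxplus> x = \<zero>"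
  by (metis add_minus add_commute smult_closed)

lemma diff_zero_iff:
  assumes "x \<in> carrier L" "y \<in> carrier L"
  shows "x \<boxplus> (-1) \<odot> y = \<zero> \<longleftrightarrow> x = y"
proof
  assume *: "x \<boxplus> (-1) \<odot> y = \<zero>"
  have "x = x \<boxplus> ((-1) \<odot> y \<boxplus> y)"
    using assms by (simp add: minus_add add_zero)
  also have "\<dots> = (x \<boxplus> (-1) \<odot> y) \<boxplus> y"
    using assms by (simp add: add_assoc smult_closed)
  finally show "x = y"
    using * assms by (simp add: zero_add)
qed (use assms in \<open>simp add: add_minus\<close>)

lemma lin_subspace_carrier: "lin_subspace L (carrier L)"
  by (auto simp: lin_subspace_def add_closed zero_closed smult_closed)

lemma lin_subspace_lin_span: "S \<subseteq> carrier L \<Longrightarrow> lin_subspace L (lin_span L S)"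
  using lin_subspace_carrier unfolding lin_span_def lin_subspace_def[of L "\<Inter>_"]
  by (auto simp: lin_subspace_def)

lemma coset_shift:
  assumes "lin_subspace L J" "x \<in> carrier L" "j \<in> J"
  shows "coset L J (x \<boxplus> j) = coset L J x"
proof -
  have J: "i \<in> carrier L" if "i \<in> J" for i
    using that assms by (auto simp: lin_subspace_def)
  have 1: "x \<boxplus> j \<boxplus> i = x \<boxplus> (j \<boxplus> i)" if "i \<in> J" for i
    using that assms by (simp add: add_assoc J)
  have 2: "x \<boxplus> i = x \<boxplus> j \<boxplus> ((-1) \<odot> j \<boxplus> i)" if i: "i \<in> J" for i
  proof -
    have "x \<boxplus> j \<boxplus> ((-1) \<odot> j \<boxplus> i) = x \<boxplus> ((j \<boxplus> (-1) \<odot> j) \<boxplus> i)"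
      using i assms by (simp add: add_assoc J smult_closed add_closed)
    then show ?thesis
      using i assms by (simp add: add_minus zero_add J)
  qed
  show ?thesis
    using assms(1,3) unfolding coset_def lin_subspace_def
    by (auto intro: 1 2)
qed

lemma self_in_coset: "\<lbrakk>lin_subspace L J; x \<in> carrier L\<rbrakk> \<Longrightarrow> x \<in> coset L J x"
  unfolding coset_def lin_subspace_def using add_zero[of x] by force

lemma coset_eq_iff:
  assumes "lin_subspace L J" "x \<in> carrier L" "y \<in> carrier L"
  shows "coset L J x = coset L J y \<longleftrightarrow> x \<boxplus> (-1) \<odot> y \<in> J"
proof
  assume "coset L J x = coset L J y"
  then obtain j where j: "j \<in> J" "x = y \<boxplus> j"
    using self_in_coset[OF assms(1,2)] by (auto simp: coset_def)
  then have "j \<in> carrier L"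
    using assms(1) by (auto simp: lin_subspace_def)
  then have "x \<boxplus> (-1) \<odot> y = j"
    using j(2) assms(3)
    by (metis add_assoc add_commute add_minus add_zero smult_closed)
  then show "x \<boxplus> (-1) \<odot> y \<in> J"
    using j by simp
next
  assume *: "x \<boxplus> (-1) \<odot> y \<in> J"
  have "y \<boxplus> (x \<boxplus> (-1) \<odot> y) = x"
    using assms by (metis add_left_commute add_minus add_zero smult_closed)
  then show "coset L J x = coset L J y"
    using coset_shift[OF assms(1,3) *] by simp
qed

lemma coset_eq_zero_iff:
  assumes "lin_subspace L J" "x \<in> carrier L"
  shows "coset L J x = coset L J \<zero> \<longleftrightarrow> x \<in> J"
  using assms by (simp add: coset_eq_iff zero_closed smult_zero_right add_zero)

end

definition alg_hom :: "('k, 'a) alg \<Rightarrow> ('k, 'b) alg \<Rightarrow> ('a \<Rightarrow> 'b) \<Rightarrow> bool" where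
  "alg_hom L M h \<longleftrightarrow> (\<forall>x\<in>carrier L. h x \<in> carrier M) \<and> h (zero L) = zero M
     \<and> (\<forall>x\<in>carrier L. \<forall>y\<in>carrier L. h (add L x y) = add M (h x) (h y))
     \<and> (\<forall>c. \<forall>x\<in>carrier L. h (smult L c x) = smult M c (h x))
     \<and> (\<forall>x\<in>carrier L. \<forall>y\<in>carrier L. h (bracket L x y) = bracket M (h x) (h y))"

lemma alg_homD:
  assumes "alg_hom L M h"
  shows "x \<in> carrier L \<Longrightarrow> h x \<in> carrier M"
    and "h (zero L) = zero M"
    and "\<lbrakk>x \<in> carrier L; y \<in> carrier L\<rbrakk> \<Longrightarrow> h (add L x y) = add M (h x) (h y)"
    and "x \<in> carrier L \<Longrightarrow> h (smult L c x) = smult M c (h x)"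
    and "\<lbrakk>x \<in> carrier L; y \<in> carrier L\<rbrakk> \<Longrightarrow> h (bracket L x y) = bracket M (h x) (h y)"
  using assms unfolding alg_hom_def by blast+

lemma alg_hom_comp: "\<lbrakk>alg_hom L M h; alg_hom M N g\<rbrakk> \<Longrightarrow> alg_hom L N (g \<circ> h)"
  by (simp add: alg_hom_def)

text \<open>The axioms are equations in the operations, or (for negatives) the solvability of one; both pass
  to homomorphic images.\<close>

lemma nonassoc_algebra_image:
  assumes L: "nonassoc_algebra L" and h: "alg_hom L M h" and surj: "h ` carrier L = carrier M"
  shows "nonassoc_algebra M"
proof -
  interpret nonassoc_algebra L by (rule L)
  note hom = alg_homD[OF h]
  note pull = hom(2-5)[symmetric]
  show ?thesis
  proof (unfold_locales, unfold surj[symmetric], goal_cases)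
    case (7 x)
    then obtain x' where "x' \<in> carrier L" "x = h x'" by blast
    moreover obtain y' where "y' \<in> carrier L" "add L x' y' = zero L"
      using add_inverse \<open>x' \<in> carrier L\<close> by blast
    ultimately show ?case
      by (intro bexI[of _ "h y'"]) (simp_all add: hom(2) flip: hom(3))
  next
    case (4 x y z) then show ?case
      by (auto simp: add_closed add_assoc simp flip: hom(3))
  next
    case (5 x y) then show ?case
      by (auto simp: add_closed add_commute simp flip: hom(3))
  qed (auto simp: pull add_closed zero_closed smult_closed add_zero
      smult_add_right smult_add_left smult_smult smult_one product_closed
      product_add_left product_add_right product_smult_left product_smult_right)
qed

lemma lie_algebraI:
  assumes "nonassoc_algebra L"
    and "\<And>x. x \<in> carrier L \<Longrightarrow> bracket L x x = zero L"
    and "\<And>x y z. \<lbrakk>x \<in> carrier L; y \<in> carrier L; z \<in> carrier L\<rbrakk>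
          \<Longrightarrow> add L (add L (bracket L x (bracket L y z)) (bracket L y (bracket L z x)))
                (bracket L z (bracket L x y)) = zero L"
  shows "lie_algebra L"
proof -
  interpret nonassoc_algebra L by fact
  show ?thesis
    by unfold_locales (simp_all add: assms(2,3) product_closed product_add_left product_add_right
        product_smult_left product_smult_right)
qed

lemma lie_algebra_image:
  assumes L: "lie_algebra L" and h: "alg_hom L M h" and surj: "h ` carrier L = carrier M"
  shows "lie_algebra M"
proof -
  interpret lie_algebra L by (rule L)
  note hom = alg_homD[OF h]
  note pull = hom(2-5)[symmetric]
  show ?thesis
  proof (rule lie_algebraI)
    show "nonassoc_algebra M"
      using nonassoc_algebra_image[OF _ h surj] nonassoc_algebra_axioms by blast
  qed (auto simp: surj[symmetric] pull bracket_closed add_closed bracket_self jacobi)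
qed

lemma ideal_lin_subspace: "is_ideal L J \<Longrightarrow> lin_subspace L J"
  by (simp add: is_ideal_def)

lemma ideal_carrier: "is_ideal L J \<Longrightarrow> J \<subseteq> carrier L"
  by (simp add: is_ideal_def lin_subspace_def)

context nonassoc_algebra
begin

lemma product_zero_left: "x \<in> carrier L \<Longrightarrow> bracket L \<zero> x = \<zero>"
  by (metis product_smult_left product_closed smult_zero_left zero_closed)

lemma product_zero_right: "x \<in> carrier L \<Longrightarrow> bracket L x \<zero> = \<zero>"
  by (metis product_smult_right product_closed smult_zero_left zero_closed)

lemma coset_hom:
  assumes J: "is_ideal L J"
  shows "alg_hom L (quot L J) (coset L J)"
proof -
  note sub = ideal_lin_subspace[OF J]
  have C: "j \<in> carrier L" if "j \<in> J" for j
    using that ideal_carrier[OF J] by blast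
  \<comment> \<open>Each operation of the quotient is a union of cosets indexed by representatives; all of them
    are equal, and there is at least one.\<close>
  have U1: "(\<Union>a\<in>coset L J x. f a) = A"
    if "x \<in> carrier L" "\<And>j. j \<in> J \<Longrightarrow> f (x \<boxplus> j) = A" for x A and f :: "'b \<Rightarrow> 'b set"
    using that self_in_coset[OF sub, of x] by (force simp: coset_def)
  have U2: "(\<Union>a\<in>coset L J x. \<Union>b\<in>coset L J y. f a b) = A"
    if "x \<in> carrier L" "y \<in> carrier L" "\<And>i j. \<lbrakk>i \<in> J; j \<in> J\<rbrakk> \<Longrightarrow> f (x \<boxplus> i) (y \<boxplus> j) = A"
    for x y A and f :: "'b \<Rightarrow> 'b \<Rightarrow> 'b set"
    using that by (intro U1) auto
  have J': "add L i j \<in> J" "smult L c i \<in> J" if "i \<in> J" "j \<in> J" for i j c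
    using sub that by (auto simp: lin_subspace_def)
  have JB: "bracket L i x \<in> J" "bracket L x i \<in> J" if "i \<in> J" "x \<in> carrier L" for i x
    using J that by (auto simp: is_ideal_def)
  have add: "coset L J ((x \<boxplus> i) \<boxplus> (y \<boxplus> j)) = coset L J (x \<boxplus> y)"
    if "x \<in> carrier L" "y \<in> carrier L" "i \<in> J" "j \<in> J" for x y i j
  proof -
    have "(x \<boxplus> i) \<boxplus> (y \<boxplus> j) = (x \<boxplus> y) \<boxplus> (i \<boxplus> j)"
      using that by (simp add: add_assoc add_left_commute add_closed C)
    then show ?thesis
      using that by (simp add: coset_shift[OF sub] J' add_closed)
  qed
  have smult: "coset L J (c \<odot> (x \<boxplus> i)) = coset L J (c \<odot> x)" if "x \<in> carrier L" "i \<in> J" for c x i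
    using that by (simp add: smult_add_right C coset_shift[OF sub] J' smult_closed)
  have bracket: "coset L J (bracket L (x \<boxplus> i) (y \<boxplus> j)) = coset L J (bracket L x y)"
    if "x \<in> carrier L" "y \<in> carrier L" "i \<in> J" "j \<in> J" for x y i j
  proof -
    have "bracket L (x \<boxplus> i) (y \<boxplus> j) =
        bracket L x y \<boxplus> (bracket L i y \<boxplus> bracket L (x \<boxplus> i) j)"
      using that by (simp add: product_add_left product_add_right product_closed C add_closed
          add_assoc add_left_commute)
    then show ?thesis
      using that by (simp add: coset_shift[OF sub] J' JB C add_closed product_closed)
  qed
  have "alg.add (quot L J) (coset L J x) (coset L J y) = coset L J (x \<boxplus> y)"
    if "x \<in> carrier L" "y \<in> carrier L" for x y
    unfolding quot_def alg.simps by (rule U2) (simp_all add: that add)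
  moreover have "alg.bracket (quot L J) (coset L J x) (coset L J y) = coset L J (bracket L x y)"
    if "x \<in> carrier L" "y \<in> carrier L" for x y
    unfolding quot_def alg.simps by (rule U2) (simp_all add: that bracket)
  moreover have "alg.smult (quot L J) c (coset L J x) = coset L J (c \<odot> x)"
    if "x \<in> carrier L" for c x
    unfolding quot_def alg.simps by (rule U1) (simp_all add: that smult)
  ultimately show ?thesis
    unfolding alg_hom_def by (simp add: quot_def[of L J, THEN arg_cong[of _ _ carrier], simplified]
      quot_def[of L J, THEN arg_cong[of _ _ zero], simplified])
qed

lemma quot_nonassoc_algebra: "is_ideal L J \<Longrightarrow> nonassoc_algebra (quot L J)"
  by (rule nonassoc_algebra_image[OF nonassoc_algebra_axioms coset_hom]) (simp_all add: quot_def)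

text \<open>The hypothesis keeps the family of ideals that is intersected nonempty: it contains the whole
  algebra.\<close>

lemma ideal_gen_ideal:
  assumes "S \<subseteq> carrier L"
  shows "is_ideal L (ideal_gen L S)"
proof -
  have "is_ideal L (carrier L)"
    by (simp add: is_ideal_def lin_subspace_carrier product_closed)
  then show ?thesis
    using assms unfolding ideal_gen_def is_ideal_def[of L "\<Inter>_"] lin_subspace_def
    by (auto simp: is_ideal_def lin_subspace_def)
qed

end

lemma ideal_gen_superset: "S \<subseteq> ideal_gen L S"
  by (auto simp: ideal_gen_def)

lemma ideal_gen_least: "\<lbrakk>is_ideal L J; S \<subseteq> J\<rbrakk> \<Longrightarrow> ideal_gen L S \<subseteq> J"
  by (auto simp: ideal_gen_def)

lemma lin_span_superset: "S \<subseteq> lin_span L S"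
  by (auto simp: lin_span_def)

lemma lin_span_least: "\<lbrakk>lin_subspace L W; S \<subseteq> W\<rbrakk> \<Longrightarrow> lin_span L S \<subseteq> W"
  by (auto simp: lin_span_def)

lemma lin_subspace_INT_Int:
  assumes "\<And>e. lin_subspace L (A e)" "lin_subspace L B"
  shows "lin_subspace L ((\<Inter>e\<in>E. A e) \<inter> B)"
  using assms unfolding lin_subspace_def by (intro conjI ballI allI) auto

lemma kernel_ideal:
  assumes "nonassoc_algebra L" "nonassoc_algebra M" "alg_hom L M h"
  shows "is_ideal L {x \<in> carrier L. h x = zero M}"
proof -
  interpret L: nonassoc_algebra L by fact
  interpret M: nonassoc_algebra M by fact
  note hom = alg_homD[OF assms(3)]
  show ?thesis
    unfolding is_ideal_def lin_subspace_def
    by (auto simp: hom L.add_closed L.zero_closed L.smult_closed L.product_closed M.zero_closed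
        M.add_zero M.smult_zero_right M.product_zero_left M.product_zero_right)
qed

lemma preimage_lin_subspace:
  assumes "nonassoc_algebra L" "alg_hom L M h" "lin_subspace M W"
  shows "lin_subspace L {x \<in> carrier L. h x \<in> W}"
proof -
  interpret L: nonassoc_algebra L by fact
  note hom = alg_homD[OF assms(2)]
  show ?thesis
    using assms(3) unfolding lin_subspace_def
    by (auto simp: hom L.add_closed L.zero_closed L.smult_closed)
qed

lemma quot_lift:
  assumes L: "nonassoc_algebra L" and M: "nonassoc_algebra M" and h: "alg_hom L M h"
    and J: "is_ideal L J" and ker: "\<And>x. x \<in> J \<Longrightarrow> h x = zero M"
  obtains h' where "alg_hom (quot L J) M h'"
    and "\<And>x. x \<in> carrier L \<Longrightarrow> h' (coset L J x) = h x"
proof -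
  interpret L: nonassoc_algebra L by fact
  interpret M: nonassoc_algebra M by fact
  note hom = alg_homD[OF h] and q = alg_homD[OF L.coset_hom[OF J]]
  define h' where "h' A = h (SOME x. x \<in> carrier L \<and> coset L J x = A)" for A
  have eq: "h' (coset L J x) = h x" if x: "x \<in> carrier L" for x
  proof -
    define y where "y = (SOME y. y \<in> carrier L \<and> coset L J y = coset L J x)"
    have y: "y \<in> carrier L" "coset L J y = coset L J x"
      using someI[of "\<lambda>y. y \<in> carrier L \<and> coset L J y = coset L J x" x] x
      by (auto simp: y_def)
    then have "h (add L y (smult L (-1) x)) = zero M"
      using x L.coset_eq_iff[OF ideal_lin_subspace[OF J]] ker by blast
    then have "h y = h x"
      using x y by (simp add: hom L.smult_closed M.diff_zero_iff)
    then show ?thesis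
      by (simp add: h'_def y_def)
  qed
  have "alg_hom (quot L J) M h'"
    unfolding alg_hom_def
    using q(2-5)[symmetric]
    by (auto simp: quot_def[of L J, THEN arg_cong[of _ _ carrier], simplified] eq hom
        L.add_closed L.zero_closed L.smult_closed L.product_closed)
  then show thesis
    using eq by (rule that)
qed

section \<open>The lower central series\<close>

context lie_algebra
begin

lemma bracket_skew:
  assumes "x \<in> carrier L" "y \<in> carrier L"
  shows "bracket L y x = (-1) \<odot> bracket L x y"
proof -
  have "bracket L (x \<boxplus> y) (x \<boxplus> y) = bracket L x y \<boxplus> bracket L y x"
    using assms by (simp add: bracket_add_left bracket_add_right bracket_self[OF assms(1)]
        bracket_self[OF assms(2)] add_closed zero_add bracket_closed add_zero add_commute)
  then have "bracket L y x \<boxplus> bracket L x y = \<zero>"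
    using assms bracket_self[of "x \<boxplus> y"] by (metis add_closed add_commute bracket_closed)
  moreover have "bracket L x y = (-1) \<odot> ((-1) \<odot> bracket L x y)"
    using assms by (simp add: smult_smult bracket_closed smult_one)
  ultimately have "bracket L y x \<boxplus> (-1) \<odot> ((-1) \<odot> bracket L x y) = \<zero>"
    by simp
  then show ?thesis
    using assms by (simp add: diff_zero_iff bracket_closed smult_closed)
qed

lemma bracket_bracket_left:
  assumes "x \<in> carrier L" "y \<in> carrier L" "z \<in> carrier L"
  shows "bracket L (bracket L x y) z = bracket L x (bracket L y z) \<boxplus> (-1) \<odot> bracket L y (bracket L x z)"
proof -
  have "bracket L x (bracket L y z) \<boxplus> bracket L y (bracket L z x) \<boxplus> bracket L z (bracket L x y) = \<zero>"
    using assms by (rule jacobi)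
  then have "(bracket L x (bracket L y z) \<boxplus> (-1) \<odot> bracket L y (bracket L x z))
     \<boxplus> (-1) \<odot> bracket L (bracket L x y) z = \<zero>"
    using assms by (simp add: bracket_skew[of "bracket L x y" z] bracket_skew[of x z]
        bracket_smult_right bracket_closed)
  then show ?thesis
    using assms by (simp add: diff_zero_iff bracket_closed smult_closed add_closed)
qed

lemma lower_central_subspace: "lin_subspace L (lower_central L r)"
proof (induction r)
  case (Suc r)
  then have "{bracket L x y |x y. x \<in> carrier L \<and> y \<in> lower_central L r} \<subseteq> carrier L"
    by (auto simp: lin_subspace_def bracket_closed)
  then show ?case
    by (simp add: lin_subspace_lin_span)
qed (simp add: lin_subspace_carrier)

lemma lower_central_carrier: "x \<in> lower_central L r \<Longrightarrow> x \<in> carrier L"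
  using lower_central_subspace[of r] by (auto simp: lin_subspace_def)

lemma bracket_lower_central:
  "\<lbrakk>x \<in> carrier L; y \<in> lower_central L r\<rbrakk> \<Longrightarrow> bracket L x y \<in> lower_central L (Suc r)"
  using lin_span_superset by fastforce

lemma lower_central_decreasing: "lower_central L (Suc r) \<subseteq> lower_central L r"
proof (induction r)
  case 0
  then show ?case
    by (metis lower_central.simps(1) lower_central_carrier subsetI)
next
  case (Suc r)
  then have "{bracket L x y |x y. x \<in> carrier L \<and> y \<in> lower_central L (Suc r)} \<subseteq> lower_central L (Suc r)"
    using bracket_lower_central by blast
  then show ?case
    using lin_span_least[OF lower_central_subspace] by (simp only: lower_central.simps(2)[of L "Suc r"])
qed

lemma lower_central_ideal: "is_ideal L (lower_central L r)"
proof -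
  have *: "bracket L x y \<in> lower_central L r" if "x \<in> carrier L" "y \<in> lower_central L r" for x y
    using that bracket_lower_central lower_central_decreasing by blast
  have "bracket L y x \<in> lower_central L r" if "x \<in> carrier L" "y \<in> lower_central L r" for x y
    using *[OF that] that lower_central_subspace[of r] bracket_skew[of x y] lower_central_carrier
    by (auto simp: lin_subspace_def)
  then show ?thesis
    using * lower_central_subspace by (auto simp: is_ideal_def)
qed

text \<open>Induction on \<open>r\<close>: by the Jacobi identity \<open>[[a, b], y] = [a, [b, y]] - [b, [a, y]]\<close>, where both
  terms are covered by the induction hypothesis for \<open>b\<close> and one further bracket with \<open>a\<close>.\<close>

lemma lower_central_bracket:
  assumes "x \<in> lower_central L r" "y \<in> lower_central L s"
  shows "bracket L x y \<in> lower_central L (r + s + 1)"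
  using assms
proof (induction r arbitrary: s x y)
  case 0
  then show ?case
    using bracket_lower_central by simp
next
  case (Suc r)
  define W where "W = {x \<in> carrier L. \<forall>s. \<forall>y\<in>lower_central L s.
      bracket L x y \<in> lower_central L (Suc r + s + 1)}"
  have closed: "\<zero> \<in> lower_central L n"
      "\<lbrakk>u \<in> lower_central L n; v \<in> lower_central L n\<rbrakk> \<Longrightarrow> u \<boxplus> v \<in> lower_central L n"
      "u \<in> lower_central L n \<Longrightarrow> c \<odot> u \<in> lower_central L n" for n u v c
    using lower_central_subspace[of n] by (auto simp: lin_subspace_def)
  have sub: "lin_subspace L W"
    unfolding lin_subspace_def
  proof (intro conjI ballI allI)
    show "W \<subseteq> carrier L"
      by (auto simp: W_def)
    show "\<zero> \<in> W"
      using closed(1) lower_central_carrier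
      by (simp add: W_def zero_closed product_zero_left del: add_Suc lower_central.simps)
    show "u \<boxplus> v \<in> W" if "u \<in> W" "v \<in> W" for u v
      using that closed(2) lower_central_carrier
      by (simp add: W_def add_closed bracket_add_left del: add_Suc lower_central.simps)
    show "c \<odot> u \<in> W" if "u \<in> W" for c u
      using that closed(3) lower_central_carrier
      by (simp add: W_def smult_closed bracket_smult_left del: add_Suc lower_central.simps)
  qed
  have "bracket L a b \<in> W" if a: "a \<in> carrier L" and b: "b \<in> lower_central L r" for a b
  proof -
    have "bracket L (bracket L a b) y \<in> lower_central L (Suc r + s + 1)"
      if y: "y \<in> lower_central L s" for s y
    proof -
      have "bracket L a (bracket L b y) \<in> lower_central L (Suc (r + s + 1))"
        using a b y Suc.IH bracket_lower_central by blast
      moreover have "bracket L b (bracket L a y) \<in> lower_central L (r + Suc s + 1)"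
        using a b y Suc.IH bracket_lower_central by blast
      ultimately have "bracket L a (bracket L b y) \<boxplus> (-1) \<odot> bracket L b (bracket L a y)
          \<in> lower_central L (Suc r + s + 1)"
        using lower_central_subspace[of "Suc r + s + 1"]
            by (simp add: lin_subspace_def del: lower_central.simps)
      then show ?thesis
        using a b y bracket_bracket_left[of a b y] lower_central_carrier by simp
    qed
    then show ?thesis
      using a b lower_central_carrier bracket_closed by (auto simp: W_def)
  qed
  then have "lower_central L (Suc r) \<subseteq> W"
    unfolding lower_central.simps by (intro lin_span_least[OF sub]) auto
  then show ?case
    using Suc.prems by (auto simp: W_def)
qed

end

section \<open>Monomials in the free Lie algebra\<close>

lemma free_nonassoc_carrier:
  "f \<in> carrier (free_nonassoc V) \<longleftrightarrow> finite {t. f t \<noteq> 0} \<and> (\<forall>t. f t \<noteq> 0 \<longrightarrow> letters t \<subseteq> V)"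
  by (simp add: free_nonassoc_def)

lemma free_nonassoc_simps [simp]:
  "add (free_nonassoc V) f g = (\<lambda>t. f t + g t)"
  "zero (free_nonassoc V) = (\<lambda>_. 0)"
  "smult (free_nonassoc V) c f = (\<lambda>t. c * f t)"
  "bracket (free_nonassoc V) f g (Gen v) = 0"
  "bracket (free_nonassoc V) f g (Br s u) = f s * g u"
  by (simp_all add: free_nonassoc_def)

lemma bracket_supp:
  "{t. bracket (free_nonassoc V) f g t \<noteq> (0::'k::field)}
      = (\<lambda>(s, u). Br s u) ` ({t. f t \<noteq> 0} \<times> {t. g t \<noteq> 0})"
proof (intro set_eqI)
  fix t
  show "t \<in> {t. bracket (free_nonassoc V) f g t \<noteq> 0}
      \<longleftrightarrow> t \<in> (\<lambda>(s, u). Br s u) ` ({t. f t \<noteq> 0} \<times> {t. g t \<noteq> 0})"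
    by (cases t) auto
qed

lemma free_nonassoc_algebra: "nonassoc_algebra (free_nonassoc V :: ('k::field, 'v monomial \<Rightarrow> 'k) alg)"
proof -
  let ?F = "free_nonassoc V :: ('k, 'v monomial \<Rightarrow> 'k) alg"
  have sum: "finite {t. f t + g t \<noteq> 0}" if "finite {t. f t \<noteq> 0}" "finite {t. g t \<noteq> 0}"
    for f g :: "'v monomial \<Rightarrow> 'k"
    by (rule finite_subset[of _ "{t. f t \<noteq> 0} \<union> {t. g t \<noteq> 0}"]) (use that in auto)
  have eqI: "F = H" if "\<And>v. F (Gen v) = H (Gen v)" "\<And>s u. F (Br s u) = H (Br s u)"
    for F H :: "'v monomial \<Rightarrow> 'k"
    using that by (metis monomial.exhaust ext)
  note free_nonassoc_carrier [simp]
  show ?thesis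
  proof
    fix x y assume *: "x \<in> carrier ?F" "y \<in> carrier ?F"
    then have "finite {t. bracket ?F x y t \<noteq> 0}"
      unfolding bracket_supp by simp
    moreover have "letters t \<subseteq> V" if "bracket ?F x y t \<noteq> 0" for t
      using that * by (cases t) auto
    ultimately show "bracket ?F x y \<in> carrier ?F"
      by simp
    show "add ?F x y \<in> carrier ?F"
      using * sum by simp (metis add.right_neutral)
    show "\<exists>y\<in>carrier ?F. add ?F x y = zero ?F"
      using * by (intro bexI[of _ "\<lambda>t. - x t"]) auto
  qed (auto intro!: eqI simp: algebra_simps)
qed

definition monomial_elem :: "'v monomial \<Rightarrow> 'v monomial \<Rightarrow> 'k::field" where
  "monomial_elem t = (\<lambda>u. if u = t then 1 else 0)"

lemma gen_eq_monomial_elem: "gen v = monomial_elem (Gen v)"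
  by (auto simp: gen_def monomial_elem_def)

lemma monomial_elem_carrier [simp]: "monomial_elem t \<in> carrier (free_nonassoc V) \<longleftrightarrow> letters t \<subseteq> V"
  by (auto simp: monomial_elem_def free_nonassoc_carrier)

lemma bracket_monomial_elem: "bracket (free_nonassoc V) (monomial_elem s) (monomial_elem u)
    = monomial_elem (Br s u)"
proof
  fix t show "bracket (free_nonassoc V) (monomial_elem s) (monomial_elem u) t = monomial_elem (Br s u) t"
    by (cases t) (auto simp: monomial_elem_def)
qed

lemma letters_multidegree: "letters t = set_mset (multidegree t)"
  by (induction t) auto

lemma size_multidegree_pos: "0 < size (multidegree t)"
  by (induction t) auto

lemma size_multidegree_1: "size (multidegree t) = 1 \<Longrightarrow> \<exists>v. t = Gen v"
proof (cases t)
  case (Br a b)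
  then show "size (multidegree t) = 1 \<Longrightarrow> \<exists>v. t = Gen v"
    using size_multidegree_pos[of a] size_multidegree_pos[of b] by simp
qed simp

text \<open>Linear extension from monomials: peel the monomials off one at a time, by induction on the
  support.\<close>

lemma free_nonassoc_subset:
  fixes W :: "('v monomial \<Rightarrow> 'k::field) set"
  assumes W: "lin_subspace (free_nonassoc V) W"
    and monomials: "\<And>t. letters t \<subseteq> V \<Longrightarrow> monomial_elem t \<in> W"
  shows "carrier (free_nonassoc V) \<subseteq> W"
proof -
  note free_nonassoc_carrier [simp]
  have "f \<in> W" if "finite T" "{t. f t \<noteq> 0} \<subseteq> T" "f \<in> carrier (free_nonassoc V)" for T f
    using that
  proof (induction T arbitrary: f rule: finite_induct)
    case empty
    then have "f = (\<lambda>_. 0)" by auto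
    then show ?case using W by (simp add: lin_subspace_def)
  next
    case (insert t T)
    define g where "g = (\<lambda>u. if u = t then 0 else f u)"
    have sub: "{u. g u \<noteq> 0} \<subseteq> T" "{u. g u \<noteq> 0} \<subseteq> {u. f u \<noteq> 0}"
      using insert.prems by (auto simp: g_def)
    then have "g \<in> carrier (free_nonassoc V)"
      using insert.prems(2) finite_subset[OF sub(2)] by auto
    then have g: "g \<in> W"
      using insert.IH sub by blast
    show ?case
    proof (cases "f t = 0")
      case True
      then have "f = g" by (auto simp: g_def)
      then show ?thesis using g by simp
    next
      case False
      then have "monomial_elem t \<in> W"
        using insert.prems(2) by (intro monomials) auto
      then have "add (free_nonassoc V) g (smult (free_nonassoc V) (f t) (monomial_elem t)) \<in> W"
        using W g unfolding lin_subspace_def by blast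
      also have "add (free_nonassoc V) g (smult (free_nonassoc V) (f t) (monomial_elem t)) = f"
        by (auto simp: g_def monomial_elem_def)
      finally show ?thesis .
    qed
  qed
  then show ?thesis by (auto simp: free_nonassoc_carrier)
qed

lemma free_lie_ideal_ideal:
  "is_ideal (free_nonassoc V) (free_lie_ideal V :: ('v monomial \<Rightarrow> 'k::field) set)"
proof -
  interpret nonassoc_algebra "free_nonassoc V :: ('k, 'v monomial \<Rightarrow> 'k) alg"
    by (rule free_nonassoc_algebra)
  have "lie_relations V \<subseteq> carrier (free_nonassoc V :: ('k, 'v monomial \<Rightarrow> 'k) alg)"
    unfolding lie_relations_def Let_def by (auto simp del: free_nonassoc_simps intro!: add_closed
        product_closed)
  then show ?thesis
    unfolding free_lie_ideal_def by (rule ideal_gen_ideal)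
qed

lemma free_lie_algebra: "lie_algebra (free_lie V :: ('k::field, ('v monomial \<Rightarrow> 'k) set) alg)"
proof -
  let ?F = "free_nonassoc V :: ('k, 'v monomial \<Rightarrow> 'k) alg"
  let ?I = "free_lie_ideal V :: ('v monomial \<Rightarrow> 'k) set"
  interpret F: nonassoc_algebra ?F
    by (rule free_nonassoc_algebra)
  note I = free_lie_ideal_ideal[of V, where 'k = 'k]
  note hom = alg_homD[OF F.coset_hom[OF I]]
  have rel: "coset ?F ?I r = zero (quot ?F ?I)" if "r \<in> lie_relations V" for r
  proof -
    have "r \<in> ?I"
      unfolding free_lie_ideal_def by (rule subsetD[OF ideal_gen_superset that])
    then show ?thesis
      using F.coset_eq_zero_iff[OF ideal_lin_subspace[OF I]] ideal_carrier[OF I]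
      by (auto simp: quot_def simp del: free_nonassoc_simps)
  qed
  have carrier: "carrier (quot ?F ?I) = coset ?F ?I ` carrier ?F"
    by (simp add: quot_def)
  show ?thesis
    unfolding free_lie_def
  proof (rule lie_algebraI)
    show "nonassoc_algebra (quot ?F ?I)"
      by (rule F.quot_nonassoc_algebra[OF I])
    show "bracket (quot ?F ?I) x x = zero (quot ?F ?I)" if xq: "x \<in> carrier (quot ?F ?I)" for x
    proof -
      obtain x' where x: "x' \<in> carrier ?F" "x = coset ?F ?I x'"
        using xq unfolding carrier by blast
      then have "bracket ?F x' x' \<in> lie_relations V"
        unfolding lie_relations_def Let_def by blast
      then show ?thesis
        using rel x hom(5)[OF x(1) x(1)] by simp
    qed
    show "add (quot ?F ?I) (add (quot ?F ?I) (bracket (quot ?F ?I) x (bracket (quot ?F ?I) y z))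
        (bracket (quot ?F ?I) y (bracket (quot ?F ?I) z x)))
        (bracket (quot ?F ?I) z (bracket (quot ?F ?I) x y))
        = zero (quot ?F ?I)"
      if xq: "x \<in> carrier (quot ?F ?I)" "y \<in> carrier (quot ?F ?I)" "z \<in> carrier (quot ?F ?I)" for x y z
    proof -
      obtain x' y' z' where x: "x' \<in> carrier ?F" "x = coset ?F ?I x'" "y' \<in> carrier ?F" "y = coset ?F ?I y'"
          "z' \<in> carrier ?F" "z = coset ?F ?I z'"
        using xq unfolding carrier by blast
      then have "add ?F (add ?F (bracket ?F x' (bracket ?F y' z')) (bracket ?F y' (bracket ?F z' x')))
          (bracket ?F z' (bracket ?F x' y')) \<in> lie_relations V"
        unfolding lie_relations_def Let_def by blast
      from rel[OF this] show ?thesis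
        using x by (simp add: hom F.add_closed F.product_closed del: free_nonassoc_simps)
    qed
  qed
qed

text \<open>Membership in the ideal of Lie relations is the free analogue of being zero in a Lie algebra;
  these are its closure properties, written with pointwise operations.\<close>

lemma free_lie_ideal_closed:
  fixes f g :: "'v monomial \<Rightarrow> 'k::field" and V :: "'v set"
  defines "I \<equiv> free_lie_ideal V"
  shows "(\<lambda>_. 0) \<in> I"
    and "f \<in> I \<Longrightarrow> g \<in> I \<Longrightarrow> (\<lambda>t. f t + g t) \<in> I"
    and "f \<in> I \<Longrightarrow> g \<in> I \<Longrightarrow> (\<lambda>t. f t - g t) \<in> I"
    and "f \<in> I \<Longrightarrow> (\<lambda>t. c * f t) \<in> I"
    and "f \<in> I \<Longrightarrow> g \<in> carrier (free_nonassoc V) \<Longrightarrow> bracket (free_nonassoc V) f g \<in> I"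
    and "f \<in> I \<Longrightarrow> g \<in> carrier (free_nonassoc V) \<Longrightarrow> bracket (free_nonassoc V) g f \<in> I"
proof -
  have I: "is_ideal (free_nonassoc V) I"
    unfolding I_def by (rule free_lie_ideal_ideal)
  have add: "(\<lambda>t. f t + g t) \<in> I" if "f \<in> I" "g \<in> I" for f g
    using I that by (auto simp: is_ideal_def lin_subspace_def)
  have smult: "(\<lambda>t. c * f t) \<in> I" if "f \<in> I" for f c
    using I that by (auto simp: is_ideal_def lin_subspace_def)
  show "(\<lambda>_. 0) \<in> I"
    using I by (auto simp: is_ideal_def lin_subspace_def)
  show "f \<in> I \<Longrightarrow> g \<in> I \<Longrightarrow> (\<lambda>t. f t + g t) \<in> I" "f \<in> I \<Longrightarrow> (\<lambda>t. c * f t) \<in> I"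
    by (fact add smult)+
  show "f \<in> I \<Longrightarrow> g \<in> I \<Longrightarrow> (\<lambda>t. f t - g t) \<in> I"
    using add[of f "\<lambda>t. - 1 * g t"] smult[of g "-1"] by simp
  show "f \<in> I \<Longrightarrow> g \<in> carrier (free_nonassoc V) \<Longrightarrow> bracket (free_nonassoc V) f g \<in> I"
    and "f \<in> I \<Longrightarrow> g \<in> carrier (free_nonassoc V) \<Longrightarrow> bracket (free_nonassoc V) g f \<in> I"
    using I unfolding is_ideal_def by blast+
qed

lemma square_in_free_lie_ideal:
  assumes "f \<in> carrier (free_nonassoc V)"
  shows "bracket (free_nonassoc V) f f \<in> free_lie_ideal V"
proof -
  have "bracket (free_nonassoc V) f f \<in> lie_relations V"
    using assms unfolding lie_relations_def Let_def by blast
  then show ?thesis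
    unfolding free_lie_ideal_def by (rule subsetD[OF ideal_gen_superset])
qed

text \<open>Polarisation of the relation \<open>[f, f] = 0\<close> at \<open>f = s + u\<close>.\<close>

lemma swap_in_free_lie_ideal:
  assumes "letters s \<subseteq> V" "letters u \<subseteq> V"
  shows "(\<lambda>t. monomial_elem (Br s u) t + monomial_elem (Br u s) t :: 'k::field) \<in> free_lie_ideal V"
proof -
  interpret F: nonassoc_algebra "free_nonassoc V :: ('k, 'a monomial \<Rightarrow> 'k) alg"
    by (rule free_nonassoc_algebra)
  let ?B = "bracket (free_nonassoc V) :: _ \<Rightarrow> _ \<Rightarrow> 'a monomial \<Rightarrow> 'k"
  let ?x = "monomial_elem s :: _ \<Rightarrow> 'k" and ?y = "monomial_elem u :: _ \<Rightarrow> 'k"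
  have C: "?x \<in> carrier (free_nonassoc V)" "?y \<in> carrier (free_nonassoc V)"
    using assms by simp_all
  let ?z = "add (free_nonassoc V) ?x ?y"
  have "(\<lambda>t. (?B ?z ?z t - ?B ?x ?x t) - ?B ?y ?y t) \<in> free_lie_ideal V"
    using C by (intro free_lie_ideal_closed(3) square_in_free_lie_ideal F.add_closed)
  also have "(\<lambda>t. (?B ?z ?z t - ?B ?x ?x t) - ?B ?y ?y t) = (\<lambda>t. monomial_elem (Br s u) t
      + monomial_elem (Br u s) t)"
  proof
    fix t show "?B ?z ?z t - ?B ?x ?x t - ?B ?y ?y t = monomial_elem (Br s u) t + monomial_elem (Br u s) t"
      unfolding bracket_monomial_elem[symmetric, of s u V] bracket_monomial_elem[symmetric, of u s V]
      by (cases t) (simp_all add: algebra_simps)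
  qed
  finally show ?thesis .
qed

text \<open>A product of at least two copies of a single generator \<open>j\<close> has the square \<open>[j, j]\<close> as a
  subproduct.\<close>

lemma replicate_in_free_lie_ideal:
  "\<lbrakk>multidegree t = replicate_mset r j; 2 \<le> r; j \<in> V\<rbrakk> \<Longrightarrow> (monomial_elem t :: _ \<Rightarrow> 'k::field)
      \<in> free_lie_ideal V"
proof (induction t arbitrary: r)
  case (Gen v)
  then have "size {#v#} = r" by simp
  then show ?case using Gen by simp
next
  case (Br a b)
  have "set_mset (multidegree (Br a b)) \<subseteq> {j}"
    unfolding Br.prems by auto
  then have ab: "set_mset (multidegree a) \<subseteq> {j}" "set_mset (multidegree b) \<subseteq> {j}"
    by auto
  then have deg: "multidegree a = replicate_mset (size (multidegree a)) j"
      "multidegree b = replicate_mset (size (multidegree b)) j"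
    by (simp_all add: set_mset_subset_singletonD)
  have C: "(monomial_elem a :: _ \<Rightarrow> 'k) \<in> carrier (free_nonassoc V)" "(monomial_elem b :: _ \<Rightarrow> 'k)
      \<in> carrier (free_nonassoc V)"
    using ab Br.prems(3) unfolding monomial_elem_carrier letters_multidegree by auto
  consider "2 \<le> size (multidegree a)" | "2 \<le> size (multidegree b)"
    | "size (multidegree a) = 1" "size (multidegree b) = 1"
    using size_multidegree_pos[of a] size_multidegree_pos[of b] by linarith
  then show ?case
  proof cases
    case 1
    then show ?thesis
      using Br.IH(1)[OF deg(1) _ Br.prems(3)] free_lie_ideal_closed(5) C
          unfolding bracket_monomial_elem[symmetric, of a b V] by blast
  next
    case 2
    then show ?thesis
      using Br.IH(2)[OF deg(2) _ Br.prems(3)] free_lie_ideal_closed(6) C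
          unfolding bracket_monomial_elem[symmetric, of a b V] by blast
  next
    case 3
    then obtain v w where "a = Gen v" "b = Gen w"
      using size_multidegree_1 by metis
    then have "a = Gen j" "b = Gen j"
      using ab by auto
    then show ?thesis
      using square_in_free_lie_ideal[OF C(1)] unfolding bracket_monomial_elem[symmetric, of a b V] by simp
  qed
qed

definition chain_monomial :: "'v \<Rightarrow> 'v \<Rightarrow> nat \<Rightarrow> 'v monomial" where
  "chain_monomial i j m = ((\<lambda>x. Br x (Gen j)) ^^ m) (Gen i)"

lemma chain_monomial_simps [simp]:
  "chain_monomial i j 0 = Gen i"
  "chain_monomial i j (Suc m) = Br (chain_monomial i j m) (Gen j)"
  by (simp_all add: chain_monomial_def)

lemma letters_chain_monomial: "letters (chain_monomial i j m) \<subseteq> {i, j}"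
  by (induction m) auto

lemma multidegree_split:
  assumes "A + B = add_mset i (replicate_mset m j)" "i \<in># A"
  shows "B = replicate_mset (size B) j" "A = add_mset i (replicate_mset (m - size B) j)" "size B \<le> m"
proof -
  obtain A' where A': "A = add_mset i A'"
    using assms(2) by (metis insert_DiffM)
  then have eq: "A' + B = replicate_mset m j"
    using assms(1) by simp
  then have "set_mset (A' + B) \<subseteq> {j}"
    by auto
  then have "set_mset A' \<subseteq> {j}" "set_mset B \<subseteq> {j}"
    by auto
  then have 1: "A' = replicate_mset (size A') j" "B = replicate_mset (size B) j"
    by (simp_all add: set_mset_subset_singletonD)
  have "size A' + size B = m"
    using eq by (metis size_replicate_mset size_union)
  then have "size A' = m - size B" "size B \<le> m" by auto
  then show "B = replicate_mset (size B) j" "A = add_mset i (replicate_mset (m - size B) j)" "size B \<le> m"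
    using 1 A' by auto
qed

text \<open>In a Lie algebra generated by \<open>i\<close> and \<open>j\<close>, a product with a single factor \<open>i\<close> is a multiple of
  the left-normed one: a proper subproduct without \<open>i\<close> vanishes unless it is \<open>j\<close> itself.\<close>

lemma chain_monomial_mod_free_lie_ideal:
  assumes "multidegree t = add_mset i (replicate_mset m j)" "i \<in> V" "j \<in> V"
  shows "\<exists>c. (\<lambda>u. monomial_elem t u - c * monomial_elem (chain_monomial i j m) u :: 'k::field)
      \<in> free_lie_ideal V"
  using assms(1)
proof (induction t arbitrary: m)
  case (Gen v)
  then have "m = 0" "v = i"
    by (auto simp: replicate_mset_eq_empty_iff[symmetric] dest: arg_cong[of _ _ size])
  then show ?case
    by (intro exI[of _ 1]) (simp add: free_lie_ideal_closed(1))
next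
  case (Br a b)
  let ?F = "free_nonassoc V :: ('k, _) alg"
  \<comment> \<open>\<open>x\<close> is the factor that contains \<open>i\<close>.\<close>
  have step: "\<exists>c. (\<lambda>u. monomial_elem (Br x y) u - c * monomial_elem (chain_monomial i j m) u :: 'k)
      \<in> free_lie_ideal V"
    if xy: "multidegree x + multidegree y = add_mset i (replicate_mset m j)" "i \<in># multidegree x"
      and IH: "\<And>m. multidegree x = add_mset i (replicate_mset m j)
        \<Longrightarrow> \<exists>c. (\<lambda>u. monomial_elem x u - c * monomial_elem (chain_monomial i j m) u :: 'k)
            \<in> free_lie_ideal V" for x y
  proof -
    note split = multidegree_split[OF xy]
    have "set_mset (multidegree x + multidegree y) \<subseteq> V"
      unfolding xy using assms by (auto simp: in_replicate_mset)
    then have C: "(monomial_elem x :: _ \<Rightarrow> 'k) \<in> carrier ?F" "(monomial_elem y :: _ \<Rightarrow> 'k) \<in> carrier ?F"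
      unfolding monomial_elem_carrier letters_multidegree by auto
    show ?thesis
    proof (cases "2 \<le> size (multidegree y)")
      case True
      then have "(monomial_elem y :: _ \<Rightarrow> 'k) \<in> free_lie_ideal V"
        by (rule replicate_in_free_lie_ideal[OF split(1) _ assms(3)])
      then have "(monomial_elem (Br x y) :: _ \<Rightarrow> 'k) \<in> free_lie_ideal V"
        using free_lie_ideal_closed(6) C unfolding bracket_monomial_elem[symmetric, of x y V] by blast
      then show ?thesis
        by (intro exI[of _ 0]) simp
    next
      case False
      then have size: "size (multidegree y) = 1"
        using size_multidegree_pos[of y] by linarith
      then obtain w where "y = Gen w"
        using size_multidegree_1 by blast
      then have y: "y = Gen j"
        using split(1) by simp
      obtain m' where m: "m = Suc m'"
        using split(3) size by (cases m) auto
      obtain c where "(\<lambda>u. monomial_elem x u - c * monomial_elem (chain_monomial i j m') u :: 'k)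
          \<in> free_lie_ideal V"
        using IH split(2) size m by auto
      then have "bracket ?F (\<lambda>u. monomial_elem x u - c
          * monomial_elem (chain_monomial i j m') u) (monomial_elem y) \<in> free_lie_ideal V"
        using C by (intro free_lie_ideal_closed(5))
      also have "bracket ?F (\<lambda>u. monomial_elem x u - c
          * monomial_elem (chain_monomial i j m') u) (monomial_elem y)
          = (\<lambda>u. monomial_elem (Br x y) u - c * monomial_elem (chain_monomial i j m) u)"
      proof
        fix u show "bracket ?F (\<lambda>u. monomial_elem x u - c
            * monomial_elem (chain_monomial i j m') u) (monomial_elem y) u
          = monomial_elem (Br x y) u - c * monomial_elem (chain_monomial i j m) u"
          by (cases u) (auto simp: monomial_elem_def y m)
      qed
      finally show ?thesis by blast
    qed
  qed
  have "i \<in># multidegree (Br a b)"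
    unfolding Br.prems by simp
  then consider "i \<in># multidegree a" | "i \<in># multidegree b"
    by auto
  then show ?case
  proof cases
    case 1
    then show ?thesis
      using step[of a b] Br by simp
  next
    case 2
    then obtain c where c: "(\<lambda>u. monomial_elem (Br b a) u - c
        * monomial_elem (chain_monomial i j m) u :: 'k) \<in> free_lie_ideal V"
      using step[of b a] Br by (auto simp: add.commute)
    have "set_mset (multidegree (Br a b)) \<subseteq> V"
      unfolding Br.prems using assms by (auto simp: in_replicate_mset)
    then have "(\<lambda>t. monomial_elem (Br a b) t + monomial_elem (Br b a) t :: 'k) \<in> free_lie_ideal V"
      by (intro swap_in_free_lie_ideal) (auto simp: letters_multidegree)
    from free_lie_ideal_closed(3)[OF this c]
    show ?thesis
      by (intro exI[of _ "- c"]) (simp add: algebra_simps)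
  qed
qed

section \<open>The Lie algebra of a digraph as a quotient of the free algebra\<close>

lemma quot_carrier: "carrier (quot L J) = coset L J ` carrier L"
  by (simp add: quot_def)

lemma quot_zero: "zero (quot L J) = coset L J (zero L)"
  by (simp add: quot_def)

context nonassoc_algebra
begin

lemma coset_eq_quot_zero_iff:
  "\<lbrakk>is_ideal L J; x \<in> carrier L\<rbrakk> \<Longrightarrow> coset L J x = zero (quot L J) \<longleftrightarrow> x \<in> J"
  by (simp add: quot_zero coset_eq_zero_iff ideal_lin_subspace)

end

lemma free_lie_proj_hom:
  "alg_hom (free_nonassoc V) (free_lie V) (coset (free_nonassoc V) (free_lie_ideal V))"
  unfolding free_lie_def
  by (rule nonassoc_algebra.coset_hom[OF free_nonassoc_algebra free_lie_ideal_ideal])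

lemma free_nilpotent_hom:
  "alg_hom (free_lie V) (free_nilpotent V k) (coset (free_lie V) (lower_central (free_lie V) k))"
proof -
  interpret lie_algebra "free_lie V" by (rule free_lie_algebra)
  show ?thesis
    unfolding free_nilpotent_def by (rule coset_hom[OF lower_central_ideal])
qed

lemma free_nilpotent_proj_comp: "free_nilpotent_proj V k =
    coset (free_lie V) (lower_central (free_lie V) k) \<circ> coset (free_nonassoc V) (free_lie_ideal V)"
  by (auto simp: free_nilpotent_proj_def)

lemma free_nilpotent_proj_hom: "alg_hom (free_nonassoc V) (free_nilpotent V k) (free_nilpotent_proj V k)"
  unfolding free_nilpotent_proj_comp by (rule alg_hom_comp[OF free_lie_proj_hom free_nilpotent_hom])

lemma free_nilpotent_algebra: "lie_algebra (free_nilpotent V k)"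
  by (rule lie_algebra_image[OF free_lie_algebra free_nilpotent_hom])
    (simp add: free_nilpotent_def quot_carrier)

lemma graph_ideal_ideal: "is_ideal (free_nilpotent (pverts G) k) (graph_ideal G k)"
proof -
  interpret lie_algebra "free_nilpotent (pverts G) k" by (rule free_nilpotent_algebra)
  show ?thesis
    unfolding graph_ideal_def Let_def
    by (rule ideal_gen_ideal)
      (auto simp: gen_eq_monomial_elem intro!: bracket_closed alg_homD(1)[OF free_nilpotent_proj_hom])
qed

lemma graph_lie_hom: "alg_hom (free_nilpotent (pverts G) k) (graph_lie G k)
    (coset (free_nilpotent (pverts G) k) (graph_ideal G k))"
proof -
  interpret lie_algebra "free_nilpotent (pverts G) k" by (rule free_nilpotent_algebra)
  show ?thesis
    unfolding graph_lie_def by (rule coset_hom[OF graph_ideal_ideal])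
qed

lemma graph_lie_algebra: "lie_algebra (graph_lie G k)"
  by (rule lie_algebra_image[OF free_nilpotent_algebra graph_lie_hom])
    (simp add: graph_lie_def quot_carrier)

lemma graph_lie_proj_comp: "graph_lie_proj G k =
    coset (free_nilpotent (pverts G) k) (graph_ideal G k) \<circ> free_nilpotent_proj (pverts G) k"
  by (auto simp: graph_lie_proj_def)

lemma graph_lie_proj_hom: "alg_hom (free_nonassoc (pverts G)) (graph_lie G k) (graph_lie_proj G k)"
  unfolding graph_lie_proj_comp by (rule alg_hom_comp[OF free_nilpotent_proj_hom graph_lie_hom])

lemma graph_lie_proj_surj:
  "carrier (graph_lie G k) = graph_lie_proj G k ` carrier (free_nonassoc (pverts G))"
  unfolding graph_lie_def quot_carrier graph_lie_proj_comp free_nilpotent_proj_comp image_comp[symmetric]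
    free_nilpotent_def free_lie_def ..

lemma free_nilpotent_proj_relation:
  assumes "f \<in> free_lie_ideal V"
  shows "free_nilpotent_proj V k f = zero (free_nilpotent V k)"
proof -
  have "f \<in> carrier (free_nonassoc V)"
    using assms ideal_carrier[OF free_lie_ideal_ideal] by blast
  then have "coset (free_nonassoc V) (free_lie_ideal V) f = zero (free_lie V)"
    using assms nonassoc_algebra.coset_eq_quot_zero_iff[OF free_nonassoc_algebra free_lie_ideal_ideal]
    unfolding free_lie_def by blast
  then show ?thesis
    unfolding free_nilpotent_proj_comp by (simp add: alg_homD(2)[OF free_nilpotent_hom])
qed

text \<open>A product of \<open>n\<close> generators in any arrangement lies in the term of the series that is spanned by
  nested brackets of \<open>n\<close> elements.\<close>

lemma monomial_lower_central:
  "letters t \<subseteq> V \<Longrightarrow> coset (free_nonassoc V) (free_lie_ideal V) (monomial_elem t :: _ \<Rightarrow> 'k::field)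
    \<in> lower_central (free_lie V) (size (multidegree t) - 1)"
proof (induction t)
  case (Gen v)
  then have C: "(monomial_elem (Gen v) :: _ \<Rightarrow> 'k) \<in> carrier (free_nonassoc V)"
    by simp
  show ?case
    using alg_homD(1)[OF free_lie_proj_hom C] by simp
next
  case (Br a b)
  interpret lie_algebra "free_lie V :: ('k, _) alg" by (rule free_lie_algebra)
  have C: "(monomial_elem a :: _ \<Rightarrow> 'k) \<in> carrier (free_nonassoc V)" "(monomial_elem b :: _ \<Rightarrow> 'k)
      \<in> carrier (free_nonassoc V)"
    using Br.prems by simp_all
  have size: "size (multidegree (Br a b)) - 1 = (size (multidegree a) - 1) + (size (multidegree b) - 1) + 1"
    using size_multidegree_pos[of a] size_multidegree_pos[of b] by simp
  have "letters a \<subseteq> V" "letters b \<subseteq> V"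
    using Br.prems by simp_all
  then show ?case
    unfolding size bracket_monomial_elem[symmetric, of a b V] alg_homD(5)[OF free_lie_proj_hom C]
    by (intro lower_central_bracket Br.IH)
qed

lemma free_nilpotent_proj_long_monomial:
  assumes "letters t \<subseteq> V" "k < size (multidegree t)"
  shows "free_nilpotent_proj V k (monomial_elem t :: _ \<Rightarrow> 'k::field) = zero (free_nilpotent V k)"
proof -
  interpret lie_algebra "free_lie V :: ('k, _) alg" by (rule free_lie_algebra)
  have "lower_central (free_lie V :: ('k, _) alg) (size (multidegree t) - 1) \<subseteq> lower_central (free_lie V) k"
    by (rule lift_Suc_antimono_le[of "lower_central (free_lie V)"]) (use assms lower_central_decreasing
        in auto)
  then have in_lc: "coset (free_nonassoc V) (free_lie_ideal V) (monomial_elem t :: _ \<Rightarrow> 'k)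
      \<in> lower_central (free_lie V) k"
    using monomial_lower_central[OF assms(1)] by blast
  then show ?thesis
    using coset_eq_quot_zero_iff[OF lower_central_ideal lower_central_carrier[OF in_lc]]
    unfolding free_nilpotent_proj_comp free_nilpotent_def by simp
qed

lemma graph_lie_proj_zero:
  assumes "free_nilpotent_proj (pverts G) k f = zero (free_nilpotent (pverts G) k)"
  shows "graph_lie_proj G k f = zero (graph_lie G k)"
  unfolding graph_lie_proj_comp by (simp add: assms alg_homD(2)[OF graph_lie_hom])

lemma graph_lie_proj_non_arc:
  assumes "i \<in> pverts G" "j \<in> pverts G" "(i, j) \<notin> parcs G" "(j, i) \<notin> parcs G"
  shows "graph_lie_proj G k (monomial_elem (Br (Gen i) (Gen j)) :: _ \<Rightarrow> 'k::field) = zero (graph_lie G k)"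
proof -
  let ?N = "free_nilpotent (pverts G) k :: ('k, _) alg"
  let ?p = "free_nilpotent_proj (pverts G) k :: (_ \<Rightarrow> 'k) \<Rightarrow> _"
  interpret lie_algebra ?N by (rule free_nilpotent_algebra)
  have C: "(monomial_elem (Gen i) :: _ \<Rightarrow> 'k) \<in> carrier (free_nonassoc (pverts G))"
      "(monomial_elem (Gen j) :: _ \<Rightarrow> 'k) \<in> carrier (free_nonassoc (pverts G))"
    using assms by simp_all
  have eq: "?p (monomial_elem (Br (Gen i) (Gen j))) = bracket ?N (?p (gen i)) (?p (gen j))"
    unfolding gen_eq_monomial_elem by (simp add: alg_homD(5)[OF free_nilpotent_proj_hom C, symmetric]
        bracket_monomial_elem)
  have "bracket ?N (?p (gen i)) (?p (gen j)) \<in> {bracket ?N (?p (gen i)) (?p (gen j))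
       | i j. i \<in> pverts G \<and> j \<in> pverts G \<and> (i, j) \<notin> parcs G \<and> (j, i) \<notin> parcs G}"
    using assms by blast
  then have in_ideal: "?p (monomial_elem (Br (Gen i) (Gen j))) \<in> graph_ideal G k"
    unfolding eq graph_ideal_def Let_def by (rule subsetD[OF ideal_gen_superset])
  then have "?p (monomial_elem (Br (Gen i) (Gen j))) \<in> carrier ?N"
    using ideal_carrier[OF graph_ideal_ideal] by blast
  then show ?thesis
    using coset_eq_quot_zero_iff[OF graph_ideal_ideal] in_ideal
    unfolding graph_lie_proj_comp graph_lie_def by simp
qed

lemma lower_central_hom:
  assumes "lie_algebra L" "lie_algebra M" "alg_hom L M h" "x \<in> lower_central L r"
  shows "h x \<in> lower_central M r"
  using assms(4)
proof (induction r arbitrary: x)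
  case 0
  then show ?case using alg_homD(1)[OF assms(3)] by simp
next
  case (Suc r)
  interpret L: lie_algebra L by fact
  interpret M: lie_algebra M by fact
  let ?W = "{x \<in> carrier L. h x \<in> lower_central M (Suc r)}"
  have sub: "lin_subspace L ?W"
    by (rule preimage_lin_subspace[OF L.nonassoc_algebra_axioms assms(3) M.lower_central_subspace])
  have "h (bracket L a b) \<in> lower_central M (Suc r)" if "a \<in> carrier L" "b \<in> lower_central L r" for a b
    using that Suc.IH M.bracket_lower_central alg_homD(1,5)[OF assms(3)] L.lower_central_carrier
    by (simp del: lower_central.simps)
  then have "lin_span L {bracket L x y |x y. x \<in> carrier L \<and> y \<in> lower_central L r} \<subseteq> ?W"
    using L.bracket_closed L.lower_central_carrier by (intro lin_span_least[OF sub]) blast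
  then show ?case
    using Suc.prems by (auto simp only: lower_central.simps(2)[of L])
qed

text \<open>The universal property of \<open>graph_lie\<close>: homomorphisms into a Lie algebra that is at most
  \<open>k\<close>-step nilpotent are given by images of the vertices that commute whenever the
  vertices are not adjacent.\<close>

lemma graph_lie_lift:
  fixes M :: "('k::field, 'a) alg"
  assumes M: "lie_algebra M" and h: "alg_hom (free_nonassoc (pverts G)) M h"
    and nilpotent: "lower_central M k \<subseteq> {zero M}"
    and arcs: "\<And>i j. \<lbrakk>i \<in> pverts G; j \<in> pverts G; (i, j) \<notin> parcs G; (j, i) \<notin> parcs G\<rbrakk>
      \<Longrightarrow> bracket M (h (gen i)) (h (gen j)) = zero M"
  obtains h' where "alg_hom (graph_lie G k) M h'"
    and "\<And>f. f \<in> carrier (free_nonassoc (pverts G)) \<Longrightarrow> h' (graph_lie_proj G k f) = h f"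
proof -
  let ?V = "pverts G"
  let ?F = "free_nonassoc ?V :: ('k, _) alg" and ?L = "free_lie ?V :: ('k, _) alg"
    and ?N = "free_nilpotent ?V k :: ('k, _) alg"
  interpret M: lie_algebra M by (rule M)
  interpret F: nonassoc_algebra ?F by (rule free_nonassoc_algebra)
  interpret L: lie_algebra ?L by (rule free_lie_algebra)
  interpret N: lie_algebra ?N by (rule free_nilpotent_algebra)
  note hom = alg_homD[OF h]
  have "lie_relations ?V \<subseteq> {f \<in> carrier ?F. h f = zero M}"
    unfolding lie_relations_def Let_def
    by (auto simp: hom F.add_closed F.product_closed M.bracket_self M.jacobi simp del: free_nonassoc_simps)
  then have "h f = zero M" if "f \<in> free_lie_ideal ?V" for f
    using that ideal_gen_least[OF kernel_ideal[OF F.nonassoc_algebra_axioms M.nonassoc_algebra_axioms h]]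
    unfolding free_lie_ideal_def by blast
  then obtain h1 where h1: "alg_hom ?L M h1"
    and e1: "\<And>f. f \<in> carrier ?F \<Longrightarrow> h1 (coset ?F (free_lie_ideal ?V) f) = h f"
    using quot_lift[OF F.nonassoc_algebra_axioms M.nonassoc_algebra_axioms h free_lie_ideal_ideal]
    unfolding free_lie_def by blast
  have "h1 x = zero M" if "x \<in> lower_central ?L k" for x
    using lower_central_hom[OF L.lie_algebra_axioms M h1 that] nilpotent by blast
  then obtain h2 where h2: "alg_hom ?N M h2"
    and e2: "\<And>f. f \<in> carrier ?L \<Longrightarrow> h2 (coset ?L (lower_central ?L k) f) = h1 f"
    using quot_lift[OF L.nonassoc_algebra_axioms M.nonassoc_algebra_axioms h1 L.lower_central_ideal]
    unfolding free_nilpotent_def by blast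
  have e12: "h2 (free_nilpotent_proj ?V k f) = h f" if "f \<in> carrier ?F" for f
    using that unfolding free_nilpotent_proj_comp
    by (simp add: e1 e2 alg_homD(1)[OF free_lie_proj_hom])
  have "h2 (bracket ?N (free_nilpotent_proj ?V k (gen i)) (free_nilpotent_proj ?V k (gen j))) = zero M"
    if "i \<in> ?V" "j \<in> ?V" "(i, j) \<notin> parcs G" "(j, i) \<notin> parcs G" for i j
  proof -
    have C: "gen i \<in> carrier ?F" "gen j \<in> carrier ?F"
      using that unfolding gen_eq_monomial_elem by simp_all
    then show ?thesis
      using that arcs by (simp add: alg_homD(5)[OF h2] alg_homD(1)[OF free_nilpotent_proj_hom] e12
          del: free_nonassoc_simps)
  qed
  moreover have "bracket ?N (free_nilpotent_proj ?V k (gen i)) (free_nilpotent_proj ?V k (gen j))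
      \<in> carrier ?N"
    if "i \<in> ?V" "j \<in> ?V" for i j
    using that by (intro N.bracket_closed alg_homD(1)[OF free_nilpotent_proj_hom]) (simp_all add:
        gen_eq_monomial_elem del: free_nonassoc_simps)
  ultimately have "graph_ideal G k \<subseteq> {x \<in> carrier ?N. h2 x = zero M}"
    unfolding graph_ideal_def Let_def
    by (intro ideal_gen_least[OF kernel_ideal[OF N.nonassoc_algebra_axioms M.nonassoc_algebra_axioms
        h2]]) blast
  then have "h2 x = zero M" if "x \<in> graph_ideal G k" for x
    using that by blast
  then obtain h3 where h3: "alg_hom (graph_lie G k) M h3"
    and e3: "\<And>f. f \<in> carrier ?N \<Longrightarrow> h3 (coset ?N (graph_ideal G k) f) = h2 f"
    using quot_lift[OF N.nonassoc_algebra_axioms M.nonassoc_algebra_axioms h2 graph_ideal_ideal]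
    unfolding graph_lie_def by blast
  have "h3 (graph_lie_proj G k f) = h f" if "f \<in> carrier ?F" for f
    using that unfolding graph_lie_proj_comp
    by (simp add: e12 e3 alg_homD(1)[OF free_nilpotent_proj_hom])
  with h3 show thesis
    by (rule that)
qed

section \<open>A coordinate model for out-degree one\<close>

text \<open>With exactly one out-arc at each vertex, the chains of the standard basis can be indexed by their
  initial vertices, and no vertex is left without a chain.\<close>

locale functional_chain_digraph =
  fixes G :: "'v pair_pre_digraph" and \<kappa> :: "'v \<times> 'v \<Rightarrow> nat" and succ :: "'v \<Rightarrow> 'v"
  assumes chain: "chain_digraph G \<kappa>"
    and out_arc: "v \<in> pverts G \<Longrightarrow> (v, a) \<in> parcs G \<longleftrightarrow> a = succ v"
begin

abbreviation "V \<equiv> pverts G"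

abbreviation "k \<equiv> max_chain G \<kappa>"

definition len :: "'v \<Rightarrow> nat" where
  "len v = \<kappa> (v, succ v)"

definition indices :: "('v \<times> nat) set" where
  "indices = {(v, l). v \<in> V \<and> 1 \<le> l \<and> l \<le> len v}"

lemma parcs_iff: "(u, a) \<in> parcs G \<longleftrightarrow> u \<in> V \<and> a = succ u"
proof -
  interpret pair_fin_digraph G
    using chain by (simp add: chain_digraph_def)
  show ?thesis
    using out_arc wellformed' by blast
qed

lemma succ_in: "v \<in> V \<Longrightarrow> succ v \<in> V"
proof -
  interpret pair_fin_digraph G
    using chain by (simp add: chain_digraph_def)
  show "v \<in> V \<Longrightarrow> succ v \<in> V"
    using parcs_iff wellformed' by blast
qed

lemma finite_verts: "finite V"
  using chain by (simp add: chain_digraph_def pair_fin_digraph_def pair_fin_digraph_axioms_def)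

lemma succ_succ_neq: "v \<in> V \<Longrightarrow> succ (succ v) \<noteq> v"
  using chain parcs_iff succ_in unfolding chain_digraph_def by metis

lemma len_ge_2: "v \<in> V \<Longrightarrow> 2 \<le> len v"
  using chain parcs_iff unfolding chain_digraph_def len_def by blast

lemma len_le_k: "v \<in> V \<Longrightarrow> len v \<le> k"
proof -
  assume v: "v \<in> V"
  have "parcs G = (\<lambda>v. (v, succ v)) ` V"
    using parcs_iff by auto
  then have "finite (\<kappa> ` parcs G)"
    using finite_verts by simp
  then show ?thesis
    using v parcs_iff unfolding max_chain_def len_def by (intro Max_ge) auto
qed

lemma finite_indices: "finite indices"
proof (rule finite_subset)
  show "indices \<subseteq> V \<times> {..k}"
    using len_le_k order_trans unfolding indices_def by fastforce
qed (simp add: finite_verts)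

text \<open>Coordinate vectors on \<open>indices\<close>, with the basis vector at \<open>(v, l)\<close> in the role of
  \<open>[\<dots>[v, succ v], \<dots>, succ v]\<close> with \<open>l - 1\<close> brackets.\<close>

definition model :: "('k::field, 'v \<times> nat \<Rightarrow> 'k) alg" where
  "model = \<lparr>
     carrier = {f. \<forall>b. f b \<noteq> 0 \<longrightarrow> b \<in> indices},
     add = (\<lambda>f g b. f b + g b),
     zero = (\<lambda>_. 0),
     smult = (\<lambda>c f b. c * f b),
     bracket = (\<lambda>f g (v, l). if (v, l) \<in> indices \<and> 2 \<le> l
       then f (v, l - 1) * g (succ v, 1) - g (v, l - 1) * f (succ v, 1) else 0) \<rparr>"

lemma model_carrier: "f \<in> carrier model \<longleftrightarrow> (\<forall>b. f b \<noteq> 0 \<longrightarrow> b \<in> indices)"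
  by (simp add: model_def)

lemma model_simps [simp]:
  "add model f g = (\<lambda>b. f b + g b)"
  "zero model = (\<lambda>_. 0)"
  "smult model c f = (\<lambda>b. c * f b)"
  by (simp_all add: model_def)

lemma model_bracket: "bracket model f g (v, l) = (if (v, l) \<in> indices \<and> 2 \<le> l
    then f (v, l - 1) * g (succ v, 1) - g (v, l - 1) * f (succ v, 1) else 0)"
  by (simp add: model_def)

lemma model_lie_algebra: "lie_algebra (model :: ('k::field, 'v \<times> nat \<Rightarrow> 'k) alg)"
proof (rule lie_algebraI)
  show "nonassoc_algebra (model :: ('k::field, 'v \<times> nat \<Rightarrow> 'k) alg)"
  proof
    fix x :: "'v \<times> nat \<Rightarrow> 'k"
    assume x: "x \<in> carrier model"
    show "\<exists>y\<in>carrier model. alg.add model x y = zero model"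
      using x by (intro bexI[of _ "\<lambda>b. - x b"]) (auto simp: model_carrier)
  next
    fix x y :: "'v \<times> nat \<Rightarrow> 'k"
    assume *: "x \<in> carrier model" "y \<in> carrier model"
    then show "alg.add model x y \<in> carrier model"
      by (simp add: model_carrier) (metis add.right_neutral)
  qed (auto simp: model_carrier model_bracket algebra_simps fun_eq_iff split: if_splits)
next
  fix x :: "'v \<times> nat \<Rightarrow> 'k"
  show "bracket model x x = zero model"
    by (auto simp: fun_eq_iff model_bracket)
next
  fix x y z :: "'v \<times> nat \<Rightarrow> 'k"
  \<comment> \<open>A bracket vanishes at every \<open>(v, 1)\<close>, so that only one term of each outer bracket survives.\<close>
  have zero: "bracket model f g (v, Suc 0) = 0" for f g :: "'v \<times> nat \<Rightarrow> 'k" and v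
    by (simp add: model_bracket)
  have outer: "bracket model f (bracket model g h) (v, l) =
      (if (v, l) \<in> indices \<and> 2 \<le> l then - bracket model g h (v, l - 1) * f (succ v, 1) else 0)"
    for f g h :: "'v \<times> nat \<Rightarrow> 'k" and v l
    by (subst model_bracket) (simp add: zero)
  show "alg.add model (alg.add model (bracket model x (bracket model y z))
      (bracket model y (bracket model z x))) (bracket model z (bracket model x y)) = zero model"
    by (auto simp: fun_eq_iff outer) (auto simp: model_bracket algebra_simps)
qed

definition unit :: "'v \<times> nat \<Rightarrow> 'v \<times> nat \<Rightarrow> 'k::field" where
  "unit b = (\<lambda>c. if c = b then 1 else 0)"

lemma unit_carrier: "b \<in> indices \<Longrightarrow> unit b \<in> carrier model"
  by (auto simp: unit_def model_carrier)

primrec monomial_value :: "'v monomial \<Rightarrow> 'v \<times> nat \<Rightarrow> 'k::field" where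
  "monomial_value (Gen v) = unit (v, 1)"
| "monomial_value (Br s t) = bracket model (monomial_value s) (monomial_value t)"

definition eval_model :: "('v monomial \<Rightarrow> 'k::field) \<Rightarrow> 'v \<times> nat \<Rightarrow> 'k" where
  "eval_model f b = (\<Sum>t | f t \<noteq> 0. f t * monomial_value t b)"

lemma monomial_value_carrier: "letters t \<subseteq> V \<Longrightarrow> (monomial_value t :: _ \<Rightarrow> 'k::field) \<in> carrier model"
proof (induction t)
  case (Gen v)
  then show ?case
    using len_ge_2[of v] by (auto intro!: unit_carrier simp: indices_def)
next
  case (Br s t)
  interpret lie_algebra "model :: ('k, _) alg" by (rule model_lie_algebra)
  show ?case using Br by (simp add: bracket_closed)
qed

lemma eval_model_superset:
  assumes "finite T" "{t. f t \<noteq> 0} \<subseteq> T"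
  shows "eval_model f b = (\<Sum>t\<in>T. f t * monomial_value t b)"
  unfolding eval_model_def using assms by (intro sum.mono_neutral_left) auto

lemma eval_model_monomial: "eval_model (monomial_elem t) = monomial_value t"
proof
  fix b show "eval_model (monomial_elem t) b = monomial_value t b"
    by (subst eval_model_superset[of "{t}"]) (auto simp: monomial_elem_def)
qed

lemma eval_model_bracket:
  assumes f: "f \<in> carrier (free_nonassoc V)" and g: "g \<in> carrier (free_nonassoc V)"
  shows "eval_model (bracket (free_nonassoc V) f g)
      = bracket model (eval_model f) (eval_model g :: _ \<Rightarrow> 'k::field)"
proof
  fix b :: "'v \<times> nat"
  obtain v l where b: "b = (v, l)" by (cases b)
  let ?S = "{t. f t \<noteq> 0} \<times> {t. g t \<noteq> 0}"
  have inj: "inj_on (\<lambda>(s, u). Br s u) ?S"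
    by (auto simp: inj_on_def)
  have "eval_model (bracket (free_nonassoc V) f g) b = (\<Sum>(s, u)\<in>?S. f s * g u * monomial_value (Br s u) b)"
    unfolding eval_model_def bracket_supp sum.reindex[OF inj] by (simp add: case_prod_unfold)
  also have "\<dots> = bracket model (eval_model f) (eval_model g) b"
  proof (cases "(v, l) \<in> indices \<and> 2 \<le> l")
    case True
    have "(\<Sum>(s, u)\<in>?S. f s * g u * monomial_value (Br s u) b) =
        (\<Sum>(s, u)\<in>?S. (f s * monomial_value s (v, l - 1)) * (g u * monomial_value u (succ v, 1)))
        - (\<Sum>(s, u)\<in>?S. (f s * monomial_value s (succ v, 1)) * (g u * monomial_value u (v, l - 1)))"
      unfolding sum_subtractf[symmetric] case_prod_unfold
      by (intro sum.cong refl) (simp only: b monomial_value.simps model_bracket True if_True simp_thms,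
          simp add: algebra_simps)
    moreover have "eval_model f b1 * eval_model g b2 =
        (\<Sum>(s, u)\<in>?S. (f s * monomial_value s b1) * (g u * monomial_value u b2))" for b1 b2
      by (simp add: eval_model_def sum_product sum.cartesian_product)
    ultimately show ?thesis
      using True unfolding b model_bracket by (simp add: mult.commute[of "eval_model g _"])
  qed (auto simp: b model_bracket)
  finally show "eval_model (bracket (free_nonassoc V) f g) b
      = bracket model (eval_model f) (eval_model g) b" .
qed

lemma eval_model_hom: "alg_hom (free_nonassoc V) model (eval_model :: (_ \<Rightarrow> 'k::field) \<Rightarrow> _)"
  unfolding alg_hom_def
proof (intro conjI ballI allI)
  fix f :: "'v monomial \<Rightarrow> 'k" and c
  assume f: "f \<in> carrier (free_nonassoc V)"
  show "eval_model f \<in> carrier model"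
    unfolding model_carrier
  proof (intro allI impI)
    fix b assume "eval_model f b \<noteq> 0"
    then obtain t where "f t * monomial_value t b \<noteq> 0"
      unfolding eval_model_def by (rule sum.not_neutral_contains_not_neutral)
    then show "b \<in> indices"
      using f monomial_value_carrier[of t, where 'k = 'k]
      by (cases b) (auto simp: free_nonassoc_carrier model_carrier)
  qed
  show "eval_model (alg.smult (free_nonassoc V) c f) = alg.smult model c (eval_model f)"
  proof
    fix b
    have "eval_model (\<lambda>t. c * f t) b = (\<Sum>t | f t \<noteq> 0. c * f t * monomial_value t b)"
      using f by (intro eval_model_superset) (auto simp: free_nonassoc_carrier)
    then show "eval_model (alg.smult (free_nonassoc V) c f) b = alg.smult model c (eval_model f) b"
      by (simp add: eval_model_def sum_distrib_left mult.assoc)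
  qed
  fix g :: "'v monomial \<Rightarrow> 'k"
  assume g: "g \<in> carrier (free_nonassoc V)"
  show "eval_model (bracket (free_nonassoc V) f g) = bracket model (eval_model f) (eval_model g)"
    using f g by (rule eval_model_bracket)
  show "eval_model (alg.add (free_nonassoc V) f g) = alg.add model (eval_model f) (eval_model g)"
  proof
    fix b
    let ?T = "{t. f t \<noteq> 0} \<union> {t. g t \<noteq> 0}"
    have fin: "finite ?T"
      using f g by (auto simp: free_nonassoc_carrier)
    have "eval_model (\<lambda>t. f t + g t) b = (\<Sum>t\<in>?T. (f t + g t) * monomial_value t b)"
      using fin by (intro eval_model_superset) auto
    moreover have "eval_model f b = (\<Sum>t\<in>?T. f t * monomial_value t b)"
        "eval_model g b = (\<Sum>t\<in>?T. g t * monomial_value t b)"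
      using fin by (intro eval_model_superset; auto)+
    ultimately show "eval_model (alg.add (free_nonassoc V) f g) b
        = alg.add model (eval_model f) (eval_model g) b"
      by (simp add: sum.distrib distrib_right)
  qed
qed (auto simp: eval_model_def)

text \<open>Give the index \<open>(v, l)\<close> the multidegree \<open>e\<^sub>v + (l - 1) e\<^sub>s\<close> with \<open>s = succ v\<close>. The bracket of \<open>model\<close>
  adds multidegrees, so evaluation preserves them.\<close>

lemma monomial_value_graded:
  "monomial_value t (v, l) \<noteq> (0::'k::field) \<Longrightarrow> multidegree t = add_mset v (replicate_mset (l - 1) (succ v))"
proof (induction t arbitrary: v l)
  case (Gen u)
  then show ?case by (auto simp: unit_def split: if_splits)
next
  case (Br s t)
  let ?x = "monomial_value s :: _ \<Rightarrow> 'k" and ?y = "monomial_value t :: _ \<Rightarrow> 'k"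
  have l: "2 \<le> l" and ne: "?x (v, l - 1) * ?y (succ v, 1) - ?y (v, l - 1) * ?x (succ v, 1) \<noteq> 0"
    using Br.prems by (auto simp: model_bracket split: if_splits)
  have "l - Suc 0 = Suc (l - Suc (Suc 0))"
    using l by linarith
  then have rep: "add_mset (succ v) (replicate_mset (l - Suc (Suc 0)) (succ v)) = replicate_mset (l
      - Suc 0) (succ v)"
    by (simp only: replicate_mset_Suc)
  consider "?x (v, l - 1) \<noteq> 0" "?y (succ v, 1) \<noteq> 0" | "?y (v, l - 1) \<noteq> 0" "?x (succ v, 1) \<noteq> 0"
    using ne by fastforce
  then show ?case
  proof cases
    case 1
    then show ?thesis
      using Br.IH(1)[of v "l - 1"] Br.IH(2)[of "succ v" 1] by (simp add: rep)
  next
    case 2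
    then show ?thesis
      using Br.IH(2)[of v "l - 1"] Br.IH(1)[of "succ v" 1] by (simp add: rep)
  qed
qed

lemma monomial_value_chain:
  assumes v: "v \<in> V" and b: "(v, Suc m) \<in> indices"
  shows "monomial_value (chain_monomial v (succ v) m) = (unit (v, Suc m) :: _ \<Rightarrow> 'k::field)"
  using b
proof (induction m)
  case (Suc m)
  then have IH: "monomial_value (chain_monomial v (succ v) m) = (unit (v, Suc m) :: _ \<Rightarrow> 'k)"
    by (auto simp: indices_def)
  have "bracket model (unit (v, Suc m)) (unit (succ v, 1)) (u, l)
      = (unit (v, Suc (Suc m)) (u, l) :: 'k)" for u l
  proof (cases "(u, l) \<in> indices \<and> 2 \<le> l")
    case True
    then have u: "u \<in> V" by (simp add: indices_def)
    \<comment> \<open>The other term of the bracket could only contribute along a 2-cycle.\<close>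
    have "\<not> (u = succ v \<and> succ u = v)"
      using v succ_succ_neq by auto
    then show ?thesis
      using True by (auto simp: model_bracket unit_def)
  next
    case False
    then show ?thesis
      using Suc.prems by (auto simp: model_bracket unit_def)
  qed
  then have "bracket model (unit (v, Suc m)) (unit (succ v, 1)) = (unit (v, Suc (Suc m)) :: _ \<Rightarrow> 'k)"
    by (simp add: fun_eq_iff)
  then show ?case
    using IH by simp
qed simp

text \<open>Every bracket raises the level \<open>l\<close> of a chain by one. As no chain is longer than \<open>k\<close>, the model
  is nilpotent of class at most \<open>k\<close>.\<close>

lemma lower_central_model:
  "x \<in> lower_central model r \<Longrightarrow> x (v, l) \<noteq> (0::'k::field) \<Longrightarrow> r < l"
proof (induction r arbitrary: x v l)
  case 0
  then show ?case by (auto simp: model_carrier indices_def)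
next
  case (Suc r)
  interpret lie_algebra "model :: ('k, _) alg" by (rule model_lie_algebra)
  let ?W = "{x \<in> carrier model. \<forall>v l. x (v, l) \<noteq> (0::'k) \<longrightarrow> Suc r < l}"
  have "lin_subspace model ?W"
    unfolding lin_subspace_def
  proof (intro conjI ballI allI)
    show "alg.add model f g \<in> ?W" if "f \<in> ?W" "g \<in> ?W" for f g
    proof -
      have "Suc r < l" if "f (v, l) + g (v, l) \<noteq> 0" for v l
        using that \<open>f \<in> ?W\<close> \<open>g \<in> ?W\<close> by (cases "f (v, l) = 0") auto
      then show ?thesis
        using that add_closed[of f g] by simp
    qed
    show "alg.smult model c f \<in> ?W" if "f \<in> ?W" for c f
      using that smult_closed[of f c] by auto
    show "zero model \<in> ?W"
      using zero_closed by simp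
  qed auto
  moreover have "bracket model x y \<in> ?W" if x: "x \<in> carrier model" and y: "y
      \<in> lower_central model r" for x y
  proof -
    have "Suc r < l" if ne: "bracket model x y (v, l) \<noteq> 0" for v l
    proof -
      have l: "2 \<le> l" "x (v, l - 1) * y (succ v, 1) - y (v, l - 1) * x (succ v, 1) \<noteq> 0"
        using ne by (auto simp: model_bracket split: if_splits)
      then consider "y (succ v, 1) \<noteq> 0" | "y (v, l - 1) \<noteq> 0"
        by fastforce
      then show ?thesis
        using Suc.IH[OF y] l(1) by cases fastforce+
    qed
    then show ?thesis
      using x y bracket_closed lower_central_carrier by blast
  qed
  ultimately have "lower_central model (Suc r) \<subseteq> ?W"
    unfolding lower_central.simps by (intro lin_span_least) auto
  then show ?case
    using Suc.prems by blast
qed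

lemma lower_central_model_zero: "lower_central model k \<subseteq> {zero (model :: ('k::field, _) alg)}"
proof
  interpret lie_algebra "model :: ('k, _) alg" by (rule model_lie_algebra)
  fix x :: "'v \<times> nat \<Rightarrow> 'k" assume x: "x \<in> lower_central model k"
  then have "(v, l) \<in> indices" if "x (v, l) \<noteq> 0" for v l
    using that lower_central_carrier model_carrier by blast
  then have "x (v, l) = 0" for v l
    using lower_central_model[OF x, of v l] len_le_k unfolding indices_def by fastforce
  then show "x \<in> {zero model}"
    by (auto simp: fun_eq_iff)
qed

lemma bracket_unit_non_arc:
  assumes "(i, j) \<notin> parcs G" "(j, i) \<notin> parcs G"
  shows "bracket model (unit (i, 1)) (unit (j, 1)) = (zero model :: _ \<Rightarrow> 'k::field)"
proof -
  have "bracket model (unit (i, 1)) (unit (j, 1)) (v, l) = (0 :: 'k)" for v l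
    using assms by (auto simp: model_bracket unit_def indices_def parcs_iff)
  then show ?thesis by (auto simp: fun_eq_iff)
qed

section \<open>The chain ideal as a kernel\<close>

definition basis_monomial :: "'v \<times> nat \<Rightarrow> 'v monomial" where
  "basis_monomial b = chain_monomial (fst b) (succ (fst b)) (snd b - 1)"

text \<open>A linear section of evaluation: it sends a coordinate vector to the combination of left-normed
  monomials with these coefficients.\<close>

definition chain_part :: "('v \<times> nat \<Rightarrow> 'k::field) \<Rightarrow> 'v monomial \<Rightarrow> 'k" where
  "chain_part h t = (\<Sum>b\<in>indices. h b * monomial_elem (basis_monomial b) t)"

lemma letters_basis_monomial: "b \<in> indices \<Longrightarrow> letters (basis_monomial b) \<subseteq> V"
  using letters_chain_monomial[of "fst b" "succ (fst b)" "snd b - 1"] succ_in[of "fst b"]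
  by (auto simp: indices_def basis_monomial_def)

lemma chain_part_unit:
  assumes "b \<in> indices"
  shows "chain_part (\<lambda>b'. c * unit b b') = (\<lambda>t. c * monomial_elem (basis_monomial b) t)"
proof
  fix t
  have "chain_part (\<lambda>b'. c * unit b b') t = (\<Sum>b'\<in>{b}. c * unit b b' * monomial_elem (basis_monomial b') t)"
    unfolding chain_part_def using assms finite_indices
    by (intro sum.mono_neutral_right) (auto simp: unit_def)
  then show "chain_part (\<lambda>b'. c * unit b b') t = c * monomial_elem (basis_monomial b) t"
    by (simp add: unit_def)
qed

lemma chain_part_carrier: "(chain_part h :: _ \<Rightarrow> 'k::field) \<in> carrier (free_nonassoc V)"
proof -
  have "\<exists>b\<in>indices. t = basis_monomial b" if ne: "chain_part h t \<noteq> 0" for t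
  proof -
    obtain b where "b \<in> indices" "h b * monomial_elem (basis_monomial b) t \<noteq> 0"
      using ne unfolding chain_part_def
      by (rule sum.not_neutral_contains_not_neutral)
    then show ?thesis
      by (auto simp: monomial_elem_def split: if_splits)
  qed
  then have sub: "{t. chain_part h t \<noteq> 0} \<subseteq> basis_monomial ` indices"
    by auto
  then have "letters t \<subseteq> V" if "chain_part h t \<noteq> 0" for t
    using that letters_basis_monomial by blast
  then show ?thesis
    using finite_subset[OF sub] finite_indices by (auto simp: free_nonassoc_carrier)
qed

lemma eval_model_chain_part:
  assumes "h \<in> carrier model"
  shows "eval_model (chain_part h) = (h :: _ \<Rightarrow> 'k::field)"
proof
  fix c
  let ?m = basis_monomial
  let ?T = "?m ` indices"
  have "eval_model (chain_part h) c = (\<Sum>t\<in>?T. chain_part h t * monomial_value t c)"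
  proof (rule eval_model_superset)
    show "{t. chain_part h t \<noteq> 0} \<subseteq> ?T"
    proof
      fix t assume "t \<in> {t. chain_part h t \<noteq> 0}"
      then obtain b where "b \<in> indices" "h b * monomial_elem (?m b) t \<noteq> 0"
        unfolding chain_part_def mem_Collect_eq
        by (rule sum.not_neutral_contains_not_neutral)
      then show "t \<in> ?T"
        by (auto simp: monomial_elem_def split: if_splits)
    qed
  qed (simp add: finite_indices)
  also have "\<dots> = (\<Sum>b\<in>indices. h b * (\<Sum>t\<in>?T. monomial_elem (?m b) t * monomial_value t c))"
    unfolding chain_part_def sum_distrib_right sum_distrib_left
    by (subst sum.swap) (simp add: mult.assoc)
  also have "\<dots> = (\<Sum>b\<in>indices. h b * unit b c)"
  proof (intro sum.cong refl arg_cong2[of _ _ _ _ times])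
    fix b assume b: "b \<in> indices"
    have "(\<Sum>t\<in>?T. monomial_elem (?m b) t * monomial_value t c :: 'k)
        = (\<Sum>t\<in>{?m b}. monomial_elem (?m b) t * monomial_value t c)"
      using b finite_indices by (intro sum.mono_neutral_right) (auto simp: monomial_elem_def)
    also have "\<dots> = unit b c"
      using b monomial_value_chain[of "fst b" "snd b - 1", where 'k = 'k]
      by (cases b) (auto simp: monomial_elem_def indices_def basis_monomial_def)
    finally show "(\<Sum>t\<in>?T. monomial_elem (?m b) t * monomial_value t c) = (unit b c :: 'k)" .
  qed
  also have "\<dots> = (if c \<in> indices then h c else 0)"
  proof -
    have "(\<Sum>b\<in>indices. h b * unit b c) = (\<Sum>b\<in>indices. if c = b then h b else 0)"
      by (intro sum.cong) (auto simp: unit_def)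
    then show ?thesis
      using finite_indices by (simp add: sum.delta)
  qed
  finally show "eval_model (chain_part h) c = h c"
    using assms by (cases c) (auto simp: model_carrier)
qed

lemma component_carrier: "component G k d \<subseteq> carrier (graph_lie G k)"
  unfolding component_def graph_lie_proj_surj by auto

lemma chain_ideal_subspace: "lin_subspace (graph_lie G k) (chain_ideal G \<kappa> :: ('v, 'k::field) chain_elem)"
proof -
  interpret g: lie_algebra "graph_lie G k :: ('k, _) alg" by (rule graph_lie_algebra)
  have arc: "lin_subspace (graph_lie G k :: ('k, _) alg) (arc_ideal G k c e)" for c e
    unfolding arc_ideal_def case_prod_unfold using component_carrier
        by (intro g.lin_subspace_lin_span) blast
  have deg: "lin_subspace (graph_lie G k :: ('k, _) alg) (lin_span (graph_lie G k) (\<Union>d\<in>{d. 3 \<le> size d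
      \<and> size d \<le> k}. component G k d))"
    using component_carrier by (intro g.lin_subspace_lin_span) blast
  show ?thesis
    unfolding chain_ideal_def Let_def by (rule lin_subspace_INT_Int[OF arc deg])
qed

lemma graph_lie_model:
  "\<exists>\<Phi>. alg_hom (graph_lie G k) model (\<Phi> :: _ \<Rightarrow> _ \<Rightarrow> 'k::field)
    \<and> (\<forall>f\<in>carrier (free_nonassoc V). \<Phi> (graph_lie_proj G k f) = eval_model f)"
proof -
  have "bracket model (eval_model (gen i)) (eval_model (gen j)) = zero (model :: ('k, _) alg)"
    if "(i, j) \<notin> parcs G" "(j, i) \<notin> parcs G" for i j
    using bracket_unit_non_arc[OF that] by (simp add: gen_eq_monomial_elem eval_model_monomial)
  then show ?thesis
    using graph_lie_lift[OF model_lie_algebra eval_model_hom lower_central_model_zero] by metis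
qed

text \<open>The monomial vanishes by nilpotency if it is longer than \<open>k\<close>, and by the missing edges if it is the
  bracket of two vertices; single vertices and edges are excluded by the assumption on multidegrees.
  In the remaining degrees the chain ideal contains the component by definition.\<close>

lemma monomial_in_chain_ideal:
  assumes t: "letters t \<subseteq> V"
    and deg: "\<And>v l. (v, l) \<in> indices \<Longrightarrow> multidegree t \<noteq> add_mset v (replicate_mset (l - 1) (succ v))"
  shows "graph_lie_proj G k (monomial_elem t :: _ \<Rightarrow> 'k::field) \<in> chain_ideal G \<kappa>"
proof -
  let ?p = "graph_lie_proj G k :: (_ \<Rightarrow> 'k) \<Rightarrow> _"
  have zero: "zero (graph_lie G k) \<in> (chain_ideal G \<kappa> :: ('v monomial \<Rightarrow> 'k) set set set set)"
    using chain_ideal_subspace[where 'k = 'k] by (simp add: lin_subspace_def)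
  have first: "(v, 1) \<in> indices" "(v, 2) \<in> indices" if "v \<in> V" for v
    using that len_ge_2[of v] by (auto simp: indices_def)
  consider "k < size (multidegree t)" | "size (multidegree t) = 1" | "size (multidegree t) = 2"
    | "3 \<le> size (multidegree t)" "size (multidegree t) \<le> k"
    using size_multidegree_pos[of t] by linarith
  then show ?thesis
  proof cases
    case 1
    then show ?thesis
      using zero graph_lie_proj_zero[OF free_nilpotent_proj_long_monomial[OF t 1, where 'k = 'k]] by simp
  next
    case 2
    then obtain v where "t = Gen v"
      using size_multidegree_1 by blast
    then show ?thesis
      using t deg[OF first(1), of v] by simp
  next
    case 3
    then obtain a b where ab: "t = Br a b"
      by (cases t) auto
    then have "size (multidegree a) = 1" "size (multidegree b) = 1"
      using 3 size_multidegree_pos[of a] size_multidegree_pos[of b] by auto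
    then obtain i j where "a = Gen i" "b = Gen j"
      using size_multidegree_1 by metis
    then have ij: "t = Br (Gen i) (Gen j)" "i \<in> V" "j \<in> V"
      using ab t by auto
    then have "j \<noteq> succ i" "i \<noteq> succ j"
      using deg[OF first(2), of i] deg[OF first(2), of j] by (auto simp: add_mset_commute)
    then show ?thesis
      using graph_lie_proj_non_arc[of i G j, where 'k = 'k] ij zero by (simp add: parcs_iff)
  next
    case 4
    have "\<forall>u. monomial_elem t u \<noteq> (0 :: 'k) \<longrightarrow> multidegree u = multidegree t"
      by (simp add: monomial_elem_def)
    then have mem: "?p (monomial_elem t) \<in> component G k (multidegree t)"
      unfolding component_def using t by (intro imageI CollectI conjI) simp_all
    have "?p (monomial_elem t) \<in> arc_ideal G k (\<kappa> e) e" if "e \<in> parcs G" for e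
    proof -
      obtain v where e: "e = (v, succ v)" and v: "v \<in> V"
        using \<open>e \<in> parcs G\<close> parcs_iff by (cases e) auto
      have "multidegree t \<noteq> {#succ v#}"
        using 4 by auto
      moreover have "multidegree t \<noteq> add_mset v (replicate_mset (l - 1) (succ v))"
          if "1 \<le> l" "l \<le> \<kappa> e" for l
        using that v by (intro deg) (simp add: indices_def e len_def)
      ultimately have "multidegree t \<in> - ({{#succ v#}} \<union> {add_mset v (replicate_mset (l
          - 1) (succ v)) | l. 1 \<le> l \<and> l \<le> \<kappa> e})"
        by auto
      then show ?thesis
        unfolding arc_ideal_def e prod.case using mem
            by (intro subsetD[OF lin_span_superset]) (auto simp: e)
    qed
    moreover have "?p (monomial_elem t) \<in> lin_span (graph_lie G k) (\<Union>d\<in>{d. 3 \<le> size d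
        \<and> size d \<le> k}. component G k d)"
      using mem 4 by (intro subsetD[OF lin_span_superset]) auto
    ultimately show ?thesis
      unfolding chain_ideal_def Let_def by blast
  qed
qed

text \<open>Elements of the chain ideal have value zero because evaluation preserves multidegrees, and each
  index \<open>(v, l)\<close> has a multidegree that the arc ideal of \<open>(v, succ v)\<close> omits. Conversely, modulo the
  chain ideal a monomial is either zero or a multiple of the basis monomial of its multidegree; so an
  element is determined by its value.\<close>

lemma chain_ideal_kernel:
  assumes \<Phi>: "alg_hom (graph_lie G k) model (\<Phi> :: _ \<Rightarrow> _ \<Rightarrow> 'k::field)"
    and \<Phi>_proj: "\<And>f. f \<in> carrier (free_nonassoc V) \<Longrightarrow> \<Phi> (graph_lie_proj G k f) = eval_model f"
  shows "chain_ideal G \<kappa> = {x \<in> carrier (graph_lie G k). \<Phi> x = zero model}"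
proof
  let ?g = "graph_lie G k :: ('k, _) alg" and ?F = "free_nonassoc V :: ('k, _) alg"
  interpret g: lie_algebra ?g by (rule graph_lie_algebra)
  interpret F: nonassoc_algebra ?F by (rule free_nonassoc_algebra)
  note hom = alg_homD[OF \<Phi>]
  show "chain_ideal G \<kappa> \<subseteq> {x \<in> carrier ?g. \<Phi> x = zero model}"
  proof
    fix x :: "('v monomial \<Rightarrow> 'k) set set set" assume x: "x \<in> chain_ideal G \<kappa>"
    then have xc: "x \<in> carrier ?g"
      using chain_ideal_subspace[where 'k = 'k] by (auto simp: lin_subspace_def)
    have "\<Phi> x (v, l) = 0" for v l
    proof (cases "(v, l) \<in> indices")
      case True
      then have v: "v \<in> V" and l: "1 \<le> l" "l \<le> len v"
        by (auto simp: indices_def)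
      let ?D = "- ({{#succ v#}} \<union> {add_mset v (replicate_mset (l - 1) (succ v)) | l. 1 \<le> l
          \<and> l \<le> \<kappa> (v, succ v)})"
      let ?W = "{y \<in> carrier ?g. \<Phi> y (v, l) = 0}"
      have "x \<in> arc_ideal G k (\<kappa> (v, succ v)) (v, succ v)"
        using x v unfolding chain_ideal_def Let_def by (auto simp: parcs_iff)
      then have span: "x \<in> lin_span ?g (\<Union>d\<in>?D. component G k d)"
        unfolding arc_ideal_def by simp
      have sub: "lin_subspace ?g ?W"
        by (auto simp: lin_subspace_def hom g.add_closed g.zero_closed g.smult_closed)
      have "\<Phi> y (v, l) = 0" if d: "d \<in> ?D" and y: "y \<in> component G k d" for d y
      proof -
        obtain f where f: "f \<in> carrier ?F" "\<And>t. f t \<noteq> 0 \<Longrightarrow> multidegree t = d" "y = graph_lie_proj G k f"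
          using y unfolding component_def by blast
        have "d \<noteq> add_mset v (replicate_mset (l - 1) (succ v))"
          using d l unfolding len_def by blast
        then have "f t * monomial_value t (v, l) = 0" for t
          using f(2) monomial_value_graded[of t v l, where 'k = 'k] by fastforce
        then show ?thesis
          using f by (simp add: \<Phi>_proj eval_model_def del: mult_eq_0_iff)
      qed
      then have "(\<Union>d\<in>?D. component G k d) \<subseteq> ?W"
        using component_carrier by blast
      then show ?thesis
        using span lin_span_least[OF sub] by blast
    next
      case False
      then show ?thesis
        using hom(1)[OF xc] by (auto simp: model_carrier)
    qed
    then show "x \<in> {x \<in> carrier ?g. \<Phi> x = zero model}"
      using xc by (auto simp: fun_eq_iff)
  qed
  let ?p = "graph_lie_proj G k :: (_ \<Rightarrow> 'k) \<Rightarrow> _"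
  define W where "W = {f \<in> carrier ?F. ?p f \<in> chain_ideal G \<kappa>}"
  have W: "lin_subspace ?F W"
    unfolding W_def by (rule preimage_lin_subspace[OF F.nonassoc_algebra_axioms graph_lie_proj_hom
        chain_ideal_subspace])
  have W_closed: "(\<lambda>_. 0) \<in> W" "f \<in> W \<Longrightarrow> g \<in> W \<Longrightarrow> (\<lambda>t. f t + g t) \<in> W" "f \<in> W \<Longrightarrow> (\<lambda>t. c * f t) \<in> W" for f g c
    using W by (auto simp: lin_subspace_def)
  have relations: "f \<in> W" if "f \<in> free_lie_ideal V" for f
    using that ideal_carrier[OF free_lie_ideal_ideal] chain_ideal_subspace[where 'k = 'k]
      graph_lie_proj_zero[OF free_nilpotent_proj_relation[OF that]]
    by (auto simp: W_def lin_subspace_def)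
  \<comment> \<open>Modulo the preimage of the chain ideal, each element is the combination of chain monomials
    that has its coordinates.\<close>
  define X where "X = {f \<in> carrier ?F. (\<lambda>t. f t - chain_part (eval_model f) t) \<in> W}"
  have ev: "eval_model (\<lambda>t. f t + g t) = (\<lambda>b. eval_model f b + eval_model g b)"
    "eval_model (\<lambda>t. c * f t) = (\<lambda>b. c * eval_model f b)"
    if "f \<in> carrier ?F" "g \<in> carrier ?F" for f g c
    using alg_homD(3,4)[OF eval_model_hom] that by auto
  have ev0: "eval_model (\<lambda>_. 0) = (\<lambda>_. 0 :: 'k)"
    by (simp add: eval_model_def fun_eq_iff)
  have cp: "chain_part (\<lambda>b. x b + y b) t = chain_part x t + chain_part y t"
    "chain_part (\<lambda>b. c * x b) t = c * chain_part x t" "chain_part (\<lambda>_. 0) t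
        = 0" for x y c and t :: "'v monomial"
    by (simp_all add: chain_part_def distrib_right sum.distrib sum_distrib_left mult.assoc)
  have "lin_subspace ?F X"
    unfolding lin_subspace_def
  proof (intro conjI ballI allI)
    show "zero ?F \<in> X"
      using F.zero_closed W_closed(1) by (simp add: X_def ev0 cp)
    show "alg.add ?F f g \<in> X" if "f \<in> X" "g \<in> X" for f g
    proof -
      have "(\<lambda>t. (f t - chain_part (eval_model f) t) + (g t - chain_part (eval_model g) t)) \<in> W"
        using that by (intro W_closed(2)) (auto simp: X_def)
      then show ?thesis
        using that F.add_closed[of f g] by (simp add: X_def ev cp algebra_simps)
    qed
    show "alg.smult ?F c f \<in> X" if "f \<in> X" for c f
    proof -
      have "(\<lambda>t. c * (f t - chain_part (eval_model f) t)) \<in> W"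
        using that by (intro W_closed(3)) (auto simp: X_def)
      then show ?thesis
        using that F.smult_closed[of f c] by (simp add: X_def ev cp algebra_simps)
    qed
  qed (auto simp: X_def)
  moreover have "monomial_elem t \<in> X" if t: "letters t \<subseteq> V" for t
  proof (cases "\<exists>(v, l)\<in>indices. multidegree t = add_mset v (replicate_mset (l - 1) (succ v))")
    case True
    then obtain v l where vl: "(v, l) \<in> indices" "multidegree t = add_mset v (replicate_mset (l
        - 1) (succ v))"
      by auto
    then have v: "v \<in> V" "1 \<le> l"
      by (auto simp: indices_def)
    let ?w = "monomial_elem (chain_monomial v (succ v) (l - 1)) :: _ \<Rightarrow> 'k"
    obtain c where c: "(\<lambda>u. monomial_elem t u - c * ?w u) \<in> free_lie_ideal V"
      using chain_monomial_mod_free_lie_ideal[OF vl(2) v(1) succ_in[OF v(1)], where 'k = 'k] by blast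
    have w: "?w \<in> carrier ?F"
      using letters_chain_monomial[of v "succ v" "l - 1"] v succ_in by auto
    have val: "eval_model (monomial_elem t) = (\<lambda>b. c * unit (v, l) b :: 'k)"
    proof -
      have "eval_model (\<lambda>u. monomial_elem t u - c * ?w u) = \<Phi> (?p (\<lambda>u. monomial_elem t u - c * ?w u))"
        using relations[OF c] by (simp add: W_def \<Phi>_proj)
      also have "\<dots> = (\<lambda>_. 0)"
        unfolding free_nilpotent_proj_relation[OF c, THEN graph_lie_proj_zero] by (simp add: hom(2))
      finally have "eval_model (\<lambda>u. monomial_elem t u - c * ?w u) = (\<lambda>_. 0)" .
      moreover have "eval_model (\<lambda>u. monomial_elem t u + - c * ?w u)
          = (\<lambda>b. eval_model (monomial_elem t) b + - c * eval_model ?w b)"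
        using t w F.smult_closed[OF w, of "- c"] ev(1)[of "monomial_elem t" "\<lambda>u. - c
            * ?w u"] ev(2)[OF w w, of "- c"] by simp
      ultimately have "eval_model (monomial_elem t) = (\<lambda>b. c * eval_model ?w b)"
        by (auto simp: fun_eq_iff)
      then show ?thesis
        using monomial_value_chain[of v "l - 1", where 'k = 'k] v vl(1) by (simp add: eval_model_monomial)
    qed
    show ?thesis
      using t relations[OF c] by (simp add: X_def val chain_part_unit[OF vl(1)] basis_monomial_def)
  next
    case False
    have "monomial_value t = (\<lambda>_. 0 :: 'k)"
    proof
      fix b :: "'v \<times> nat"
      obtain v l where b: "b = (v, l)" by (cases b)
      show "monomial_value t b = (0 :: 'k)"
        using False monomial_value_graded[of t v l, where 'k = 'k] monomial_value_carrier[OF t, where 'k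
            = 'k]
        unfolding b model_carrier by blast
    qed
    moreover have "monomial_elem t \<in> W"
      unfolding W_def using t False by (auto intro!: monomial_in_chain_ideal)
    ultimately show ?thesis
      using t by (simp add: X_def eval_model_monomial cp)
  qed
  ultimately have X: "carrier ?F \<subseteq> X"
    by (rule free_nonassoc_subset)
  show "{x \<in> carrier ?g. \<Phi> x = zero model} \<subseteq> chain_ideal G \<kappa>"
  proof
    fix x assume x: "x \<in> {x \<in> carrier ?g. \<Phi> x = zero model}"
    then obtain f where f: "f \<in> carrier ?F" "x = ?p f"
      unfolding graph_lie_proj_surj by blast
    then have "eval_model f = (\<lambda>_. 0)"
      using x \<Phi>_proj by simp
    then have "f \<in> W"
      using X f(1) by (auto simp: X_def cp)
    then show "x \<in> chain_ideal G \<kappa>"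
      using f(2) by (simp add: W_def)
  qed
qed

lemma chain_ideal_ideal: "is_ideal (graph_lie G k) (chain_ideal G \<kappa> :: ('v, 'k::field) chain_elem)"
proof -
  let ?g = "graph_lie G k :: ('k, _) alg"
  interpret g: lie_algebra ?g by (rule graph_lie_algebra)
  interpret M: lie_algebra "model :: ('k, _) alg" by (rule model_lie_algebra)
  obtain \<Phi> where \<Phi>: "alg_hom ?g model (\<Phi> :: _ \<Rightarrow> _ \<Rightarrow> 'k)"
    and \<Phi>_proj: "\<And>f. f \<in> carrier (free_nonassoc V) \<Longrightarrow> \<Phi> (graph_lie_proj G k f) = eval_model f"
    using graph_lie_model by blast
  have "chain_ideal G \<kappa> = {x \<in> carrier ?g. \<Phi> x = zero model}"
    by (rule chain_ideal_kernel[OF \<Phi>]) (rule \<Phi>_proj)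
  then show ?thesis
    using kernel_ideal[OF g.nonassoc_algebra_axioms M.nonassoc_algebra_axioms \<Phi>] by simp
qed

lemma chain_lie_hom:
  "alg_hom (graph_lie G k) (chain_lie G \<kappa>) (coset (graph_lie G k) (chain_ideal G \<kappa> :: ('v, 'k::field)
      chain_elem))"
proof -
  interpret lie_algebra "graph_lie G k :: ('k, _) alg" by (rule graph_lie_algebra)
  show ?thesis
    using coset_hom[OF chain_ideal_ideal] by (simp add: chain_lie_def)
qed

lemma chain_lie_carrier:
  "carrier (chain_lie G \<kappa>) = coset (graph_lie G k) (chain_ideal G \<kappa> :: ('v, 'k::field) chain_elem) `
      carrier (graph_lie G k)"
  by (simp add: chain_lie_def quot_carrier)

lemma chain_lie_algebra: "lie_algebra (chain_lie G \<kappa>)"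
  by (rule lie_algebra_image[OF graph_lie_algebra chain_lie_hom]) (simp add: chain_lie_carrier)

lemma chain_lie_coordinates: "\<exists>\<Theta>. alg_hom (chain_lie G \<kappa>) model (\<Theta> :: _ \<Rightarrow> _ \<Rightarrow> 'k::field)
    \<and> bij_betw \<Theta> (carrier (chain_lie G \<kappa>)) (carrier model)
    \<and> (\<forall>(v, l)\<in>indices. chain_vec G \<kappa> (v, succ v) l \<in> carrier (chain_lie G \<kappa> :: ('k, _) alg)
        \<and> \<Theta> (chain_vec G \<kappa> (v, succ v) l) = unit (v, l))"
proof -
  let ?g = "graph_lie G k :: ('k, _) alg" and ?J = "chain_ideal G \<kappa> :: ('v, 'k) chain_elem"
  let ?C = "chain_lie G \<kappa> :: ('k, _) alg"
  interpret g: lie_algebra ?g by (rule graph_lie_algebra)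
  interpret M: lie_algebra "model :: ('k, _) alg" by (rule model_lie_algebra)
  interpret C: lie_algebra ?C by (rule chain_lie_algebra)
  obtain \<Phi> where \<Phi>: "alg_hom ?g model (\<Phi> :: _ \<Rightarrow> _ \<Rightarrow> 'k)"
    and \<Phi>_proj: "\<And>f. f \<in> carrier (free_nonassoc V) \<Longrightarrow> \<Phi> (graph_lie_proj G k f) = eval_model f"
    using graph_lie_model by blast
  have ker: "?J = {x \<in> carrier ?g. \<Phi> x = zero model}"
    by (rule chain_ideal_kernel[OF \<Phi>]) (rule \<Phi>_proj)
  note J = chain_ideal_ideal[where 'k = 'k] and q = chain_lie_hom[where 'k = 'k]
    and qs = chain_lie_carrier[where 'k = 'k]
  have C: "?C = quot ?g ?J"
    by (simp add: chain_lie_def)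
  obtain \<Theta> where \<Theta>: "alg_hom ?C model \<Theta>" and \<Theta>_coset: "\<And>x. x \<in> carrier ?g \<Longrightarrow> \<Theta> (coset ?g ?J x) = \<Phi> x"
    using quot_lift[OF g.nonassoc_algebra_axioms M.nonassoc_algebra_axioms \<Phi> J] ker unfolding C by blast
  have "inj_on \<Theta> (carrier ?C)"
  proof (rule inj_onI)
    fix x y assume "x \<in> carrier ?C" "y \<in> carrier ?C" and eq: "\<Theta> x = \<Theta> y"
    then obtain x' y' where xy: "x' \<in> carrier ?g" "x = coset ?g ?J x'" "y' \<in> carrier ?g" "y
        = coset ?g ?J y'"
      unfolding qs by blast
    then have "\<Phi> x' = \<Phi> y'"
      using eq \<Theta>_coset by simp
    then have "add ?g x' (smult ?g (- 1) y') \<in> ?J"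
      unfolding ker using xy by (simp add: g.add_closed g.smult_closed alg_homD[OF \<Phi>])
    then show "x = y"
      using g.coset_eq_iff[OF ideal_lin_subspace[OF J] xy(1,3)] xy by simp
  qed
  moreover have "carrier model \<subseteq> \<Theta> ` carrier ?C"
  proof
    fix h :: "'v \<times> nat \<Rightarrow> 'k" assume h: "h \<in> carrier model"
    have "\<Theta> (coset ?g ?J (graph_lie_proj G k (chain_part h))) = h"
      using alg_homD(1)[OF graph_lie_proj_hom chain_part_carrier[where 'k = 'k]]
      by (simp add: \<Theta>_coset \<Phi>_proj chain_part_carrier eval_model_chain_part[OF h])
    then show "h \<in> \<Theta> ` carrier ?C"
      using alg_homD(1)[OF graph_lie_proj_hom chain_part_carrier[where 'k = 'k]] unfolding qs
          by (metis image_eqI)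
  qed
  moreover have "\<Theta> ` carrier ?C \<subseteq> carrier model"
    using alg_homD(1)[OF \<Theta>] by blast
  ultimately have bij: "bij_betw \<Theta> (carrier ?C) (carrier model)"
    by (auto simp: bij_betw_def)
  have vertex: "vertex_elem G \<kappa> v \<in> carrier ?C" "\<Theta> (vertex_elem G \<kappa> v) = unit (v, 1)" if "v \<in> V" for v
  proof -
    have gc: "(gen v :: _ \<Rightarrow> 'k) \<in> carrier (free_nonassoc V)"
      using that by (simp add: gen_eq_monomial_elem)
    from alg_homD(1)[OF graph_lie_proj_hom this]
    have pc: "graph_lie_proj G k (gen v :: _ \<Rightarrow> 'k) \<in> carrier ?g" .
    show "vertex_elem G \<kappa> v \<in> carrier ?C"
      unfolding vertex_elem_def using alg_homD(1)[OF q pc] .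
    show "\<Theta> (vertex_elem G \<kappa> v) = unit (v, 1)"
      unfolding vertex_elem_def using pc gc by (simp add: \<Theta>_coset \<Phi>_proj) (simp add:
          gen_eq_monomial_elem eval_model_monomial)
  qed
  have chain_vec: "chain_vec G \<kappa> (v, succ v) (Suc m) \<in> carrier ?C
      \<and> \<Theta> (chain_vec G \<kappa> (v, succ v) (Suc m)) = unit (v, Suc m)" if "(v, Suc m) \<in> indices" for v m
    using that
  proof (induction m)
    case 0
    then show ?case
      using vertex[of v] by (simp add: chain_vec_def indices_def)
  next
    case (Suc m)
    then have v: "v \<in> V" and b: "(v, Suc m) \<in> indices"
      by (auto simp: indices_def)
    have "bracket model (unit (v, Suc m)) (unit (succ v, 1)) = (unit (v, Suc (Suc m)) :: _ \<Rightarrow> 'k)"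
      using monomial_value_chain[OF v Suc.prems, where 'k = 'k] monomial_value_chain[OF v b, where 'k
          = 'k] by simp
    moreover have "chain_vec G \<kappa> (v, succ v) (Suc (Suc m))
        = bracket ?C (chain_vec G \<kappa> (v, succ v) (Suc m)) (vertex_elem G \<kappa> (succ v))"
      by (simp add: chain_vec_def)
    ultimately show ?case
      using Suc.IH[OF b] vertex[OF succ_in[OF v]] by (simp add: C.bracket_closed alg_homD(5)[OF \<Theta>])
  qed
  have "\<forall>(v, l)\<in>indices. chain_vec G \<kappa> (v, succ v) l \<in> carrier ?C \<and> \<Theta> (chain_vec G \<kappa> (v, succ v) l)
      = unit (v, l)"
  proof (intro ballI, clarify)
    fix v l assume "(v, l) \<in> indices"
    moreover from this have "l = Suc (l - 1)"
      by (simp add: indices_def)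
    ultimately show "chain_vec G \<kappa> (v, succ v) l \<in> carrier ?C \<and> \<Theta> (chain_vec G \<kappa> (v, succ v) l)
        = unit (v, l)"
      using chain_vec[of v "l - 1"] by simp
  qed
  with \<Theta> bij show ?thesis
    by (intro exI[of _ \<Theta>] conjI)
qed

end

section \<open>Coordinates, bases and dual bases\<close>

locale coordinates = vec_space L for L :: "('k::field, 'a) alg" (structure) +
  fixes \<Theta> :: "'a \<Rightarrow> 'i \<Rightarrow> 'k" and B :: "'i set" and b :: "'i \<Rightarrow> 'a"
  assumes finite_B: "finite B"
    and inj: "inj_on \<Theta> (carrier L)"
    and supp: "\<lbrakk>x \<in> carrier L; \<Theta> x i \<noteq> 0\<rbrakk> \<Longrightarrow> i \<in> B"
    and \<Theta>_add: "\<lbrakk>x \<in> carrier L; y \<in> carrier L\<rbrakk> \<Longrightarrow> \<Theta> (x \<boxplus> y) i = \<Theta> x i + \<Theta> y i"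
    and \<Theta>_smult: "x \<in> carrier L \<Longrightarrow> \<Theta> (c \<odot> x) i = c * \<Theta> x i"
    and b_carrier: "i \<in> B \<Longrightarrow> b i \<in> carrier L"
    and \<Theta>_b: "i \<in> B \<Longrightarrow> \<Theta> (b i) j = (if j = i then 1 else 0)"
begin

lemma \<Theta>_zero: "\<Theta> \<zero> i = 0"
  using \<Theta>_smult[OF zero_closed, of 0 i] by (simp add: smult_zero_left zero_closed)

text \<open>Induction on the support of the coordinate vector, clearing one coordinate at a time.\<close>

lemma subspace_contains_all:
  assumes W: "lin_subspace L W" and b: "b ` B \<subseteq> W"
  shows "carrier L \<subseteq> W"
proof -
  have "x \<in> W" if "finite S" "S \<subseteq> B" "x \<in> carrier L" "\<And>i. \<Theta> x i \<noteq> 0 \<Longrightarrow> i \<in> S" for S x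
    using that
  proof (induction S arbitrary: x rule: finite_induct)
    case empty
    then have "\<Theta> x = \<Theta> \<zero>"
      by (intro ext) (metis \<Theta>_zero emptyE)
    then have "x = \<zero>"
      using inj empty zero_closed by (auto dest: inj_onD)
    then show ?case
      using W by (simp add: lin_subspace_def)
  next
    case (insert a S)
    have a: "b a \<in> carrier L" "b a \<in> W"
      using insert.prems(1) b b_carrier by auto
    define y where "y = x \<boxplus> (- \<Theta> x a) \<odot> b a"
    have y: "y \<in> carrier L" "\<Theta> y i = (if i = a then 0 else \<Theta> x i)" for i
      using a insert.prems by (auto simp: y_def add_closed smult_closed \<Theta>_add \<Theta>_smult \<Theta>_b)
    then have "y \<in> W"
      using insert by (intro insert.IH) (auto split: if_splits)
    then have "y \<boxplus> \<Theta> x a \<odot> b a \<in> W"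
      using W a(2) by (simp add: lin_subspace_def)
    also have "y \<boxplus> \<Theta> x a \<odot> b a = x"
      unfolding y_def using a(1) insert.prems(2)
      by (simp add: add_assoc smult_closed smult_zero_left add_zero flip: smult_add_left)
    finally show ?case .
  qed
  then show ?thesis
    using finite_B supp by blast
qed

lemma basis: "is_basis L (b ` B)"
  unfolding is_basis_def
proof (intro conjI ballI)
  show bC: "b ` B \<subseteq> carrier L"
    using b_carrier by auto
  show "lin_span L (b ` B) = carrier L"
    using subspace_contains_all[OF lin_subspace_lin_span[OF bC] lin_span_superset]
      lin_span_least[OF lin_subspace_carrier bC] by blast
  fix x assume "x \<in> b ` B"
  then obtain i where i: "i \<in> B" "x = b i" by blast
  let ?W = "{y \<in> carrier L. \<Theta> y i = 0}"
  have "lin_subspace L ?W"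
    by (auto simp: lin_subspace_def add_closed smult_closed zero_closed \<Theta>_add \<Theta>_smult \<Theta>_zero)
  moreover have "b ` B - {x} \<subseteq> ?W"
    using i b_carrier by (auto simp: \<Theta>_b)
  ultimately have "lin_span L (b ` B - {x}) \<subseteq> ?W"
    by (rule lin_span_least)
  then show "x \<notin> lin_span L (b ` B - {x})"
    using i by (auto simp: \<Theta>_b)
qed

lemma inj_on_b: "inj_on b B"
proof (rule inj_onI)
  fix i j assume ij: "i \<in> B" "j \<in> B" "b i = b j"
  then have "\<Theta> (b i) j = 1"
    by (simp add: \<Theta>_b)
  then show "i = j"
    using ij(1) by (simp add: \<Theta>_b split: if_splits)
qed

lemma dim: "has_dim L (card B)"
  unfolding has_dim_def using basis finite_B card_image[OF inj_on_b] by blast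

lemma form_1_add:
  assumes "\<phi> \<in> forms L 1" "x \<in> carrier L" "y \<in> carrier L"
  shows "\<phi> [x \<boxplus> y] = \<phi> [x] + \<phi> [y]"
proof -
  have "\<forall>xs i x y. length xs = 1 \<and> set xs \<subseteq> carrier L \<and> i < 1 \<and> x \<in> carrier L \<and> y \<in> carrier L
      \<longrightarrow> \<phi> (xs[i := x \<boxplus> y]) = \<phi> (xs[i := x]) + \<phi> (xs[i := y])"
    using assms(1) unfolding forms_def by blast
  from this[rule_format, of "[x]" 0 x y] show ?thesis
    using assms by simp
qed

lemma form_1_smult:
  assumes "\<phi> \<in> forms L 1" "x \<in> carrier L"
  shows "\<phi> [c \<odot> x] = c * \<phi> [x]"
proof -
  have "\<forall>xs i x c. length xs = 1 \<and> set xs \<subseteq> carrier L \<and> i < 1 \<and> x \<in> carrier L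
      \<longrightarrow> \<phi> (xs[i := c \<odot> x]) = c * \<phi> (xs[i := x])"
    using assms(1) unfolding forms_def by blast
  from this[rule_format, of "[x]" 0 x c] show ?thesis
    using assms by simp
qed

lemma form_1_outside:
  assumes "\<phi> \<in> forms L 1" "\<not> (length xs = 1 \<and> set xs \<subseteq> carrier L)"
  shows "\<phi> xs = 0"
proof -
  have "\<forall>xs. \<not> (length xs = 1 \<and> set xs \<subseteq> carrier L) \<longrightarrow> \<phi> xs = 0"
    using assms(1) unfolding forms_def by blast
  then show ?thesis using assms(2) by blast
qed

text \<open>The coordinate at \<open>i\<close> is a 1-form with the defining values of the dual element, and a 1-form is
  determined by its values on a spanning set.\<close>

lemma dual_elem_coordinate:
  assumes i: "i \<in> B"
  shows "dual_elem L (b ` B) (b i) = (\<lambda>xs. if length xs = 1 \<and> set xs \<subseteq> carrier L then \<Theta> (xs ! 0) i else 0)"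
    (is "_ = ?\<psi>")
  unfolding dual_elem_def
proof (rule the_equality)
  have "?\<psi> \<in> forms L 1"
    unfolding forms_def
    by (auto simp: length_Suc_conv add_closed smult_closed \<Theta>_add \<Theta>_smult)
  moreover have "?\<psi> [b'] = (if b' = b i then 1 else 0)" if "b' \<in> b ` B" for b'
    using that i inj_on_b b_carrier by (auto simp: \<Theta>_b dest: inj_onD)
  ultimately show "?\<psi> \<in> forms L 1 \<and> (\<forall>b'\<in>b ` B. ?\<psi> [b'] = (if b' = b i then 1 else 0))"
    by blast
  then have \<psi>: "?\<psi> \<in> forms L 1" "\<And>b'. b' \<in> b ` B \<Longrightarrow> ?\<psi> [b'] = (if b' = b i then 1 else 0)"
    by blast+
  fix \<phi> assume "\<phi> \<in> forms L 1 \<and> (\<forall>b'\<in>b ` B. \<phi> [b'] = (if b' = b i then 1 else 0))"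
  then have \<phi>: "\<phi> \<in> forms L 1" "\<And>b'. b' \<in> b ` B \<Longrightarrow> \<phi> [b'] = (if b' = b i then 1 else 0)"
    by blast+
  define \<chi> where "\<chi> = ?\<psi>"
  have \<chi>: "\<chi> \<in> forms L 1" "\<And>b'. b' \<in> b ` B \<Longrightarrow> \<chi> [b'] = (if b' = b i then 1 else 0)"
    unfolding \<chi>_def by (fact \<psi>(1), rule \<psi>(2))
  let ?W = "{x \<in> carrier L. \<phi> [x] = \<chi> [x]}"
  have zero: "\<eta> [\<zero>] = 0" if "\<eta> \<in> forms L 1" for \<eta>
    using form_1_smult[OF that zero_closed, of 0] by (simp add: smult_zero_left zero_closed)
  have "lin_subspace L ?W"
    unfolding lin_subspace_def using \<phi>(1) \<chi>(1)
    by (auto simp: add_closed smult_closed zero_closed form_1_add form_1_smult zero)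
  moreover have "b ` B \<subseteq> ?W"
    using \<phi>(2) \<chi>(2) b_carrier by auto
  ultimately have eq: "\<phi> [x] = \<chi> [x]" if "x \<in> carrier L" for x
    using that subspace_contains_all by blast
  show "\<phi> = ?\<psi>"
    unfolding \<chi>_def[symmetric]
  proof
    fix xs show "\<phi> xs = \<chi> xs"
    proof (cases "length xs = 1 \<and> set xs \<subseteq> carrier L")
      case True
      then show ?thesis using eq by (auto simp: length_Suc_conv)
    next
      case False
      then show ?thesis using form_1_outside \<phi>(1) \<chi>(1) by metis
    qed
  qed
qed

end

section \<open>Top exterior powers of 2-forms\<close>

text \<open>For an alternating matrix this is \<open>2\<^sup>m m!\<close> times its Pfaffian.\<close>

definition pfaffian_sum :: "nat \<Rightarrow> (nat \<Rightarrow> nat \<Rightarrow> 'k::comm_ring_1) \<Rightarrow> 'k" where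
  "pfaffian_sum m A = (\<Sum>\<pi> | \<pi> permutes {..<2 * m}.
     of_int (sign \<pi>) * (\<Prod>i<m. A (\<pi> (2 * i)) (\<pi> (2 * i + 1))))"

lemma pfaffian_sum_cong:
  assumes "\<And>a b. \<lbrakk>a < 2 * m; b < 2 * m\<rbrakk> \<Longrightarrow> A a b = B a b"
  shows "pfaffian_sum m A = pfaffian_sum m B"
proof -
  have "\<pi> i < 2 * m" if "\<pi> permutes {..<2 * m}" "i < 2 * m" for \<pi> i
    using permutes_in_image[OF that(1)] that(2) by blast
  then show ?thesis
    unfolding pfaffian_sum_def by (intro sum.cong refl arg_cong2[of _ _ _ _ times] prod.cong assms) auto
qed

lemma sign_map_permutation:
  assumes "inj f" "finite S" "\<pi> permutes S"
  shows "sign (map_permutation S f \<pi>) = sign \<pi>"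
  using assms(3,2)
proof (induction rule: permutes_induct)
  case id
  show ?case
    using map_permutation_id'[of f S] assms(1) inj_on_subset[of f UNIV S] by (metis sign_id top_greatest)
next
  case (swap a b p)
  have f: "inj_on f S"
    using assms(1) by (rule inj_on_subset) simp
  have perm: "map_permutation S f p permutes f ` S"
    using swap f by (intro map_permutation_permutes) (auto simp: bij_betw_def)
  have "map_permutation S f (transpose a b \<circ> p)
      = transpose (f a) (f b) \<circ> map_permutation S f p"
    using swap f by (simp add: map_permutation_compose' map_permutation_transpose)
  moreover have "permutation p" "permutation (map_permutation S f p)"
    using swap perm assms(2) by (auto simp: permutation_permutes)
  ultimately show ?case
    using swap assms(1) by (simp only: sign_compose permutation_swap_id sign_swap_id inj_eq)
qed

text \<open>The recursion for the power puts \<open>\<omega>\<close> in the first two slots and antisymmetrises the last \<open>2 m\<close>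
  slots, which are already antisymmetrised by the induction hypothesis. The repeated
  antisymmetrisation only contributes the factor \<open>(2 m)!\<close>, which the normalisation of the wedge cancels.\<close>

lemma wedge_power2_pfaffian_sum:
  fixes \<omega> :: "'a list \<Rightarrow> 'k::field_char_0"
  assumes "length xs = 2 * m"
  shows "wedge_power2 \<omega> m xs = pfaffian_sum m (\<lambda>a b. \<omega> [xs ! a, xs ! b]) / 2 ^ m"
  using assms
proof (induction m arbitrary: xs)
  case 0
  then show ?case by (simp add: pfaffian_sum_def)
next
  case (Suc m)
  define A where "A a b = \<omega> [xs ! a, xs ! b]" for a b
  let ?S = "{..<2 + 2 * m}"
  let ?F = "\<lambda>\<rho>. of_int (sign \<rho>) * (\<Prod>i<Suc m. A (\<rho> (2 * i)) (\<rho> (2 * i + 1)))"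
  have P: "pfaffian_sum (Suc m) A = (\<Sum>\<rho> | \<rho> permutes ?S. ?F \<rho>)"
    by (simp add: pfaffian_sum_def)
  have IH: "wedge_power2 \<omega> m (map (\<lambda>i. xs ! \<pi> i) [2..<2 + 2 * m])
      = pfaffian_sum m (\<lambda>a b. A (\<pi> (2 + a)) (\<pi> (2 + b))) / 2 ^ m" for \<pi>
  proof -
    have "wedge_power2 \<omega> m (map (\<lambda>i. xs ! \<pi> i) [2..<2 + 2 * m])
      = pfaffian_sum m (\<lambda>a b. \<omega> [map (\<lambda>i. xs ! \<pi> i) [2..<2 + 2 * m] ! a,
          map (\<lambda>i. xs ! \<pi> i) [2..<2 + 2 * m] ! b]) / 2 ^ m"
      by (rule Suc.IH) (simp del: upt_Suc)
    also have "pfaffian_sum m (\<lambda>a b. \<omega> [map (\<lambda>i. xs ! \<pi> i) [2..<2 + 2 * m] ! a,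
          map (\<lambda>i. xs ! \<pi> i) [2..<2 + 2 * m] ! b])
        = pfaffian_sum m (\<lambda>a b. A (\<pi> (2 + a)) (\<pi> (2 + b)))"
      by (rule pfaffian_sum_cong) (simp add: A_def del: upt_Suc)
    finally show ?thesis .
  qed
  \<comment> \<open>Shifting a permutation \<open>\<tau>\<close> of the last \<open>2 m\<close> slots into \<open>?S\<close> and absorbing it in the outer
    permutation makes the inner sum independent of \<open>\<tau>\<close>.\<close>
  have inner: "(\<Sum>\<pi> | \<pi> permutes ?S. of_int (sign \<pi>) * A (\<pi> 0) (\<pi> 1) *
      (of_int (sign \<tau>) * (\<Prod>i<m. A (\<pi> (2 + \<tau> (2 * i))) (\<pi> (2 + \<tau> (2 * i + 1))))))
      = pfaffian_sum (Suc m) A" if \<tau>: "\<tau> permutes {..<2 * m}" for \<tau>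
  proof -
    define \<tau>' where "\<tau>' = map_permutation {..<2 * m} ((+) 2) \<tau>"
    have im: "(+) 2 ` {..<2 * m} = {2..<2 + 2 * m}"
      using image_add_atLeastLessThan[of 2 0 "2 * m"] by (simp add: lessThan_atLeast0 numeral_2_eq_2)
    have p1: "\<tau>' permutes {2..<2 + 2 * m}"
      unfolding \<tau>'_def using \<tau>
      by (intro map_permutation_permutes) (simp_all only: bij_betw_def im inj_on_add simp_thms)
    have p2: "\<tau>' permutes ?S"
      by (rule permutes_subset[OF p1]) auto
    have fix01: "\<tau>' 0 = 0" "\<tau>' (Suc 0) = Suc 0"
      using p1 by (auto simp: permutes_def)
    have app: "\<tau>' (2 + i) = 2 + \<tau> i" if "i < 2 * m" for i
      unfolding \<tau>'_def using that by (intro map_permutation_apply) auto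
    have sgn: "sign \<tau>' = sign \<tau>"
      unfolding \<tau>'_def using \<tau> by (intro sign_map_permutation) auto
    have "pfaffian_sum (Suc m) A = (\<Sum>\<pi> | \<pi> permutes ?S. ?F (\<pi> \<circ> \<tau>'))"
      unfolding P by (rule sum_permutations_compose_right[OF p2])
    also have "\<dots> = (\<Sum>\<pi> | \<pi> permutes ?S. of_int (sign \<pi>) * A (\<pi> 0) (\<pi> 1) *
      (of_int (sign \<tau>) * (\<Prod>i<m. A (\<pi> (2 + \<tau> (2 * i))) (\<pi> (2 + \<tau> (2 * i + 1))))))"
    proof (rule sum.cong[OF refl])
      fix \<pi> assume "\<pi> \<in> {\<pi>. \<pi> permutes ?S}"
      then have "permutation \<pi>" "permutation \<tau>'"
        using p2 by (auto simp: permutation_permutes)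
      then have s: "sign (\<pi> \<circ> \<tau>') = sign \<pi> * sign \<tau>"
        by (simp add: sign_compose sgn)
      have "\<tau>' (2 * Suc i) = 2 + \<tau> (2 * i)" "\<tau>' (2 * Suc i + 1) = 2 + \<tau> (2 * i + 1)" if "i < m" for i
        using that app[of "2 * i"] app[of "2 * i + 1"] by simp_all
      then have "(\<Prod>i<m. A ((\<pi> \<circ> \<tau>') (2 * Suc i)) ((\<pi> \<circ> \<tau>') (2 * Suc i + 1)))
          = (\<Prod>i<m. A (\<pi> (2 + \<tau> (2 * i))) (\<pi> (2 + \<tau> (2 * i + 1))))"
        by (intro prod.cong) (simp_all only: o_apply lessThan_iff)
      then show "?F (\<pi> \<circ> \<tau>') = of_int (sign \<pi>) * A (\<pi> 0) (\<pi> 1) *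
          (of_int (sign \<tau>) * (\<Prod>i<m. A (\<pi> (2 + \<tau> (2 * i))) (\<pi> (2 + \<tau> (2 * i + 1)))))"
        unfolding prod.lessThan_Suc_shift s by (simp add: fix01 mult_ac)
    qed
    finally show ?thesis ..
  qed
  have len: "length xs = 2 + 2 * m" and e: "[0..<2] = [0, 1::nat]"
    using Suc.prems by (simp_all add: upt_rec)
  have "wedge_power2 \<omega> (Suc m) xs = (\<Sum>\<pi> | \<pi> permutes ?S. of_int (sign \<pi>) * A (\<pi> 0) (\<pi> 1) *
      (pfaffian_sum m (\<lambda>a b. A (\<pi> (2 + a)) (\<pi> (2 + b))) / 2 ^ m)) / (fact 2 * fact (2 * m))"
    unfolding wedge_power2.simps wedge_def IH e using len by (simp add: A_def)
  also have "(\<Sum>\<pi> | \<pi> permutes ?S. of_int (sign \<pi>) * A (\<pi> 0) (\<pi> 1) *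
      (pfaffian_sum m (\<lambda>a b. A (\<pi> (2 + a)) (\<pi> (2 + b))) / 2 ^ m))
      = (\<Sum>\<pi> | \<pi> permutes ?S. \<Sum>\<tau> | \<tau> permutes {..<2 * m}. of_int (sign \<pi>) * A (\<pi> 0) (\<pi> 1) *
      (of_int (sign \<tau>) * (\<Prod>i<m. A (\<pi> (2 + \<tau> (2 * i))) (\<pi> (2 + \<tau> (2 * i + 1)))))) / 2 ^ m"
    unfolding pfaffian_sum_def sum_divide_distrib[symmetric] times_divide_eq_right sum_distrib_left ..
  also have "(\<Sum>\<pi> | \<pi> permutes ?S. \<Sum>\<tau> | \<tau> permutes {..<2 * m}. of_int (sign \<pi>) * A (\<pi> 0) (\<pi> 1) *
      (of_int (sign \<tau>) * (\<Prod>i<m. A (\<pi> (2 + \<tau> (2 * i))) (\<pi> (2 + \<tau> (2 * i + 1))))))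
      = (\<Sum>\<tau> | \<tau> permutes {..<2 * m}. pfaffian_sum (Suc m) A)"
    by (subst sum.swap, intro sum.cong refl inner) simp
  also have "\<dots> = fact (2 * m) * pfaffian_sum (Suc m) A"
    by (simp add: card_permutations)
  finally show ?case
    by (simp add: A_def[abs_def] fact_numeral)
qed

text \<open>The Gram matrix of a symplectic basis listed pair by pair, with pairing values \<open>\<epsilon>\<close>.\<close>

definition paired_matrix :: "(nat \<Rightarrow> 'k::comm_ring_1) \<Rightarrow> nat \<Rightarrow> nat \<Rightarrow> 'k" where
  "paired_matrix \<epsilon> a b = (if even a \<and> b = a + 1 then \<epsilon> (a div 2)
     else if odd a \<and> a = b + 1 then - \<epsilon> (b div 2) else 0)"

lemma paired_matrix_simps [simp]:
  "paired_matrix \<epsilon> (2 * i) b = (if b = Suc (2 * i) then \<epsilon> i else 0)"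
  "paired_matrix \<epsilon> (Suc (2 * i)) b = (if b = 2 * i then - \<epsilon> i else 0)"
  by (auto simp: paired_matrix_def)

text \<open>Expansion along the last two slots. A permutation contributes only if it fills them with a pair
  \<open>{b', b}\<close>. There are \<open>2 (m + 1)\<close> choices of the last entry \<open>b\<close>, and each leaves the sum of a paired
  matrix of size \<open>2 m\<close>: if the pair is not the last one, the indices of the last pair take its place,
  with the opposite orientation if \<open>b\<close> is even. The signs cancel, so all choices contribute equally.\<close>

lemma pfaffian_sum_paired_matrix:
  "pfaffian_sum m (paired_matrix \<epsilon>) = 2 ^ m * fact m * (\<Prod>j<m. \<epsilon> j)"
proof (induction m arbitrary: \<epsilon>)
  case 0
  then show ?case by (simp add: pfaffian_sum_def)
next
  case (Suc m)
  let ?A = "paired_matrix \<epsilon>"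
  let ?p = "2 * m" and ?q = "2 * m + 1"
  let ?K = "2 ^ m * fact m * (\<Prod>j<Suc m. \<epsilon> j)"
  let ?f = "\<lambda>\<pi>. of_int (sign \<pi>) * (\<Prod>i<Suc m. ?A (\<pi> (2 * i)) (\<pi> (2 * i + 1)))"
  have split: "{..<2 * Suc m} = insert ?q (insert ?p {..<2 * m})"
    by auto
  have "pfaffian_sum (Suc m) ?A = (\<Sum>b\<in>insert ?q (insert ?p {..<2 * m}).
      \<Sum>c\<in>insert ?p {..<2 * m}. \<Sum>\<tau> | \<tau> permutes {..<2 * m}. ?f (transpose ?q b \<circ> (transpose ?p c \<circ> \<tau>)))"
    unfolding pfaffian_sum_def split
    by (subst sum_over_permutations_insert, simp, simp)+ (rule refl)
  \<comment> \<open>The permutation sends the last slot to \<open>b\<close>; only one \<open>c\<close> sends the slot before it to the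
    partner \<open>b'\<close> of \<open>b\<close>.\<close>
  also have "\<dots> = (\<Sum>b\<in>insert ?q (insert ?p {..<2 * m}). ?K)"
  proof (rule sum.cong[OF refl])
    fix b assume b: "b \<in> insert ?q (insert ?p {..<2 * m})"
    define b' where "b' = (if even b then b + 1 else b - 1)"
    define c where "c = transpose ?q b b'"
    define \<rho> where "\<rho> = transpose ?q b \<circ> transpose ?p c"
    have b': "b' \<in> insert ?q (insert ?p {..<2 * m})" "b' \<noteq> b"
      using b by (auto simp: b'_def elim!: oddE evenE)
    have A0: "?A x b = 0" if "x \<noteq> b'" for x
      using that by (auto simp: paired_matrix_def b'_def split: if_splits)
    have c_in: "c \<in> insert ?p {..<2 * m}"
      using b b' by (auto simp: c_def transpose_def)
    have last: "(transpose ?q b \<circ> (transpose ?p x \<circ> \<tau>)) ?q = b"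
        "(transpose ?q b \<circ> (transpose ?p x \<circ> \<tau>)) ?p = transpose ?q b x"
      if "\<tau> permutes {..<2 * m}" "x \<in> insert ?p {..<2 * m}" for x \<tau>
    proof -
      have "\<tau> ?q = ?q" "\<tau> ?p = ?p"
        using that(1) by (auto simp: permutes_def)
      then show "(transpose ?q b \<circ> (transpose ?p x \<circ> \<tau>)) ?q = b"
        "(transpose ?q b \<circ> (transpose ?p x \<circ> \<tau>)) ?p = transpose ?q b x"
        using that(2) by (auto simp: transpose_def)
    qed
    have "?f (transpose ?q b \<circ> (transpose ?p x \<circ> \<tau>)) = 0"
      if "\<tau> permutes {..<2 * m}" "x \<in> insert ?p {..<2 * m}" "x \<noteq> c" for x \<tau>
    proof -
      have "transpose ?q b x \<noteq> b'"
        using that(3) by (auto simp: c_def)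
      then show ?thesis
        using last[OF that(1,2)] A0 by simp
    qed
    then have "(\<Sum>x\<in>insert ?p {..<2 * m}. \<Sum>\<tau> | \<tau> permutes {..<2
        * m}. ?f (transpose ?q b \<circ> (transpose ?p x \<circ> \<tau>)))
        = (\<Sum>x\<in>{c}. \<Sum>\<tau> | \<tau> permutes {..<2 * m}. ?f (transpose ?q b \<circ> (transpose ?p x \<circ> \<tau>)))"
      using c_in by (intro sum.mono_neutral_right ballI sum.neutral) auto
    also have "\<dots> = (\<Sum>\<tau> | \<tau> permutes {..<2 * m}. of_int (sign \<rho>) * ?A b' b
        * (of_int (sign \<tau>) * (\<Prod>i<m. ?A (\<rho> (\<tau> (2 * i))) (\<rho> (\<tau> (2 * i + 1))))))"
    proof -
      have "?f (transpose ?q b \<circ> (transpose ?p c \<circ> \<tau>)) = of_int (sign \<rho>) * ?A b' b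
        * (of_int (sign \<tau>) * (\<Prod>i<m. ?A (\<rho> (\<tau> (2 * i))) (\<rho> (\<tau> (2 * i + 1)))))"
        if \<tau>: "\<tau> permutes {..<2 * m}" for \<tau>
      proof -
        have "permutation \<tau>"
          using \<tau> by (auto simp: permutation_permutes)
        then have s: "sign (transpose ?q b \<circ> (transpose ?p c \<circ> \<tau>)) = sign \<rho> * sign \<tau>"
          unfolding \<rho>_def o_assoc[symmetric]
          by (simp add: sign_compose permutation_swap_id permutation_compose)
        have l: "(transpose ?q b \<circ> (transpose ?p c \<circ> \<tau>)) ?q = b"
            "(transpose ?q b \<circ> (transpose ?p c \<circ> \<tau>)) ?p = b'"
          using last[OF \<tau> c_in] by (simp_all add: c_def)
        show ?thesis
          unfolding prod.lessThan_Suc s l by (simp add: \<rho>_def mult_ac)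
      qed
      then show ?thesis by simp
    qed
    also have "\<dots> = of_int (sign \<rho>) * ?A b' b * pfaffian_sum m (\<lambda>x y. ?A (\<rho> x) (\<rho> y))"
      by (simp add: pfaffian_sum_def sum_distrib_left)
    also have "\<dots> = ?K"
    proof (cases "b < 2 * m")
      case False
      then have "\<rho> x = x" if "x < 2 * m" for x
        using b that by (auto simp: \<rho>_def c_def b'_def transpose_def)
      then have "pfaffian_sum m (\<lambda>x y. ?A (\<rho> x) (\<rho> y)) = pfaffian_sum m ?A"
        by (intro pfaffian_sum_cong) simp
      moreover have "of_int (sign \<rho>) * ?A b' b = \<epsilon> m"
        using False b by (auto simp: \<rho>_def c_def b'_def sign_compose permutation_swap_id sign_swap_id
            paired_matrix_def transpose_def) (cases m; simp)
      ultimately show ?thesis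
        by (simp add: Suc.IH mult_ac)
    next
      case True
      define j where "j = b div 2"
      have j: "j < m" "b = 2 * j \<or> b = 2 * j + 1"
        using True by (auto simp: j_def)
      define \<eta> where "\<eta> = (if even b then - \<epsilon> m else \<epsilon> m)"
      have c: "c = b'"
        using j by (auto simp: c_def b'_def transpose_def) presburger
      have \<rho>: "\<rho> x = (if x = b then ?q else if x = b' then ?p else x)" if "x < 2 * m" for x
        using that True b' j c by (auto simp: \<rho>_def transpose_def b'_def)
      have "sign \<rho> = 1"
        using True j c by (auto simp: \<rho>_def b'_def sign_compose permutation_swap_id sign_swap_id)
          presburger
      then have 1: "of_int (sign \<rho>) * ?A b' b = (if even b then - \<epsilon> j else \<epsilon> j)"
        using j(2) by (auto simp: b'_def paired_matrix_def)
      have "?A (\<rho> x) (\<rho> y) = paired_matrix (\<epsilon>(j := \<eta>)) x y" if "x < 2 * m" "y < 2 * m" for x y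
      proof -
        have partner: "b' = (if b = 2 * j then Suc (2 * j) else 2 * j)"
          using j(2) by (auto simp: b'_def)
        obtain i where "x = 2 * i \<or> x = Suc (2 * i)"
          by (metis evenE oddE Suc_eq_plus1)
        then show ?thesis
          using that j by (elim disjE) (simp_all add: \<rho> partner \<eta>_def)
      qed
      then have "pfaffian_sum m (\<lambda>x y. ?A (\<rho> x) (\<rho> y)) = pfaffian_sum m (paired_matrix (\<epsilon>(j := \<eta>)))"
        by (intro pfaffian_sum_cong)
      also have "\<dots> = 2 ^ m * fact m * (\<eta> * (\<Prod>i\<in>{..<m} - {j}. \<epsilon> i))"
        using j(1) by (subst Suc.IH, subst prod.remove[of _ j]) auto
      finally have 2: "pfaffian_sum m (\<lambda>x y. ?A (\<rho> x) (\<rho> y))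
          = 2 ^ m * fact m * (\<eta> * (\<Prod>i\<in>{..<m} - {j}. \<epsilon> i))" .
      have 3: "(\<Prod>i<Suc m. \<epsilon> i) = \<epsilon> m * (\<epsilon> j * (\<Prod>i\<in>{..<m} - {j}. \<epsilon> i))"
        using j(1) by (simp add: prod.remove[of _ j] mult_ac)
      show ?thesis
        unfolding 1 2 3 by (simp add: \<eta>_def mult_ac)
    qed
    finally show "(\<Sum>c\<in>insert ?p {..<2 * m}. \<Sum>\<tau> | \<tau> permutes {..<2 * m}.
        ?f (transpose ?q b \<circ> (transpose ?p c \<circ> \<tau>))) = ?K" .
  qed
  also have "\<dots> = of_nat (2 * Suc m) * ?K"
    by (simp flip: split)
  finally show ?case
    by (simp add: algebra_simps)
qed

section \<open>The symplectic form in coordinates\<close>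

locale even_functional_chain_digraph = functional_chain_digraph G \<kappa> succ
  for G :: "'v pair_pre_digraph" and \<kappa> succ +
  assumes even_len: "v \<in> pverts G \<Longrightarrow> even (len v)"
begin

text \<open>The form \<open>\<sigma>\<close> in coordinates. The sum that defines it runs over the lower half of each chain
  only; as the lengths are even, the skew terms are the summands of this sum with \<open>l\<close> in the upper half.\<close>

definition pairing :: "('v \<times> nat \<Rightarrow> 'k::field) \<Rightarrow> ('v \<times> nat \<Rightarrow> 'k) \<Rightarrow> 'k" where
  "pairing X Y = (\<Sum>v\<in>V. \<Sum>l = 1..len v. (-1) ^ (l + 1) * (X (v, l) * Y (v, len v + 1 - l)))"

lemma alternating_sum_fold:
  fixes X Y :: "nat \<Rightarrow> 'k::field"
  assumes "even n"
  shows "(\<Sum>l = 1..n. (-1) ^ (l + 1) * (X l * Y (n + 1 - l)))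
    = (\<Sum>l = 1..n div 2. (-1) ^ (l + 1) * (X l * Y (n + 1 - l) - Y l * X (n + 1 - l)))"
proof -
  let ?g = "\<lambda>l. (-1) ^ (l + 1) * (X l * Y (n + 1 - l))"
  have "{1..n} = {1..n div 2} \<union> {n div 2 + 1..n}"
    by auto
  then have "sum ?g {1..n} = sum ?g ({1..n div 2} \<union> {n div 2 + 1..n})"
    by (rule arg_cong)
  also have "\<dots> = sum ?g {1..n div 2} + sum ?g {n div 2 + 1..n}"
    by (rule sum.union_disjoint) auto
  also have "sum ?g {n div 2 + 1..n} = (\<Sum>l = 1..n div 2. - ((-1) ^ (l + 1) * (Y l * X (n + 1 - l))))"
  proof (rule sum.reindex_bij_witness[of _ "\<lambda>l. n + 1 - l" "\<lambda>l. n + 1 - l"])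
    fix l assume l: "l \<in> {n div 2 + 1..n}"
    have "(-1 :: 'k) ^ (n + 1 - l + 1) = - ((-1) ^ (l + 1))"
      using assms l by (cases "even l") (auto simp: minus_one_power_iff)
    then show "- ((-1) ^ (n + 1 - l + 1) * (Y (n + 1 - l) * X (n + 1 - (n + 1 - l)))) = ?g l"
      using l by simp
  qed (use assms in \<open>auto elim!: evenE\<close>)
  finally show ?thesis
    by (simp add: sum_negf sum_subtractf right_diff_distrib)
qed

lemma pairing_fold: "pairing X Y = (\<Sum>v\<in>V. \<Sum>l = 1..len v div 2.
    (-1) ^ (l + 1) * (X (v, l) * Y (v, len v + 1 - l) - Y (v, l) * X (v, len v + 1 - l)))"
  unfolding pairing_def by (intro sum.cong refl alternating_sum_fold even_len)

lemma pairing_self: "pairing X X = 0"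
  unfolding pairing_fold by simp

lemma pairing_linear:
  "pairing (\<lambda>b. X b + Y b) Z = pairing X Z + pairing Y Z"
  "pairing Z (\<lambda>b. X b + Y b) = pairing Z X + pairing Z Y"
  "pairing (\<lambda>b. c * X b) Z = c * pairing X Z"
  "pairing Z (\<lambda>b. c * X b) = c * pairing Z X"
  by (simp_all only: pairing_def distrib_left distrib_right sum.distrib sum_distrib_left mult_ac)

text \<open>Apply the bracket formula chain by chain and shift the summation index: the coordinate at \<open>succ v\<close>
  factors out of a bilinear form \<open>T\<close>, which the reversal \<open>l \<mapsto> len v - l\<close> shows to be symmetric because
  \<open>len v\<close> is even. In the cyclic sum each \<open>T\<close> occurs twice with opposite signs.\<close>

lemma pairing_closed:
  fixes X Y Z :: "'v \<times> nat \<Rightarrow> 'k::field"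
  shows "pairing (bracket model X Y) Z + pairing (bracket model Y Z) X + pairing (bracket model Z X) Y = 0"
proof -
  define T where "T v P Q = (\<Sum>l = 1..len v - 1. (-1) ^ l * (P (v, l) * Q (v, len v - l)))"
    for v and P Q :: "'v \<times> nat \<Rightarrow> 'k"
  have T_sym: "T v P Q = T v Q P" if "v \<in> V" for v P Q
    unfolding T_def
  proof (rule sum.reindex_bij_witness[of _ "\<lambda>l. len v - l" "\<lambda>l. len v - l"])
    fix l assume l: "l \<in> {1..len v - 1}"
    have "len v - (len v - l) = l"
      using l by auto
    moreover have "(-1 :: 'k) ^ (len v - l) = (-1) ^ l"
      using l even_len[OF that] by (cases "even l") (auto simp: minus_one_power_iff)
    ultimately show "(- 1) ^ (len v - l) * (Q (v, len v - l) * P (v, len v - (len v - l))) = (- 1) ^ l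
        * (P (v, l) * Q (v, len v - l))"
      by (simp only: mult_ac)
  qed auto
  have "(\<Sum>l = 1..len v. (-1) ^ (l + 1) * (bracket model P Q (v, l) * R (v, len v + 1 - l)))
      = Q (succ v, 1) * T v P R - P (succ v, 1) * T v Q R" if v: "v \<in> V" for v P Q R
  proof -
    obtain n where n: "len v = Suc n"
      using len_ge_2[OF v] by (cases "len v") auto
    have shift: "(\<Sum>l = 1..Suc n. f l) = f 1 + (\<Sum>l = 1..n. f (Suc l))" for f :: "nat \<Rightarrow> 'k"
      by (induction n) (simp_all add: add.assoc)
    have "(\<Sum>l = 1..len v. (-1) ^ (l + 1) * (bracket model P Q (v, l) * R (v, len v + 1 - l)))
      = (\<Sum>l = 1..n. (-1) ^ (Suc l + 1) * (bracket model P Q (v, Suc l) * R (v, len v + 1 - Suc l)))"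
      unfolding n shift by (simp add: model_bracket)
    also have "\<dots> = (\<Sum>l = 1..n. (-1) ^ l * ((P (v, l) * Q (succ v, 1) - Q (v, l) * P (succ v, 1))
        * R (v, len v - l)))"
      using v by (intro sum.cong refl) (auto simp: model_bracket indices_def n)
    also have "\<dots> = Q (succ v, 1) * T v P R - P (succ v, 1) * T v Q R"
      by (simp add: T_def n sum_distrib_left sum_subtractf[symmetric] algebra_simps)
    finally show ?thesis .
  qed
  then have "pairing (bracket model P Q) R = (\<Sum>v\<in>V. Q (succ v, 1) * T v P R - P (succ v, 1)
      * T v Q R)" for P Q R
    unfolding pairing_def by (intro sum.cong refl)
  then show ?thesis
    using T_sym by (simp add: sum.distrib[symmetric])
qed

text \<open>The index that \<open>\<sigma>\<close> pairs with a given one.\<close>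

definition partner :: "'v \<times> nat \<Rightarrow> 'v \<times> nat" where
  "partner = (\<lambda>(v, l). (v, len v + 1 - l))"

definition lower_half :: "('v \<times> nat) set" where
  "lower_half = {(v, l). v \<in> V \<and> 1 \<le> l \<and> l \<le> len v div 2}"

lemma lower_half_indices: "lower_half \<subseteq> indices"
  by (auto simp: lower_half_def indices_def)

lemma partner_indices: "p \<in> indices \<Longrightarrow> partner p \<in> indices"
  by (auto simp: partner_def indices_def)

lemma partner_partner: "p \<in> indices \<Longrightarrow> partner (partner p) = p"
  by (auto simp: partner_def indices_def)

lemma partner_lower_half: "p \<in> lower_half \<Longrightarrow> partner p \<notin> lower_half"
  by (auto simp: partner_def lower_half_def)

lemma card_indices: "card indices = 2 * card lower_half"
proof -
  have "indices = lower_half \<union> partner ` lower_half"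
  proof
    show "indices \<subseteq> lower_half \<union> partner ` lower_half"
    proof
      fix p assume p: "p \<in> indices"
      show "p \<in> lower_half \<union> partner ` lower_half"
      proof (cases "p \<in> lower_half")
        case False
        obtain v l where vl: "p = (v, l)" "v \<in> V" "1 \<le> l" "l \<le> len v"
          using p by (auto simp: indices_def)
        then have "partner p \<in> lower_half"
          using False even_len[OF vl(2)] by (auto simp: lower_half_def partner_def elim!: evenE)
        then show ?thesis
          using partner_partner[OF p] by (metis UnI2 image_eqI)
      qed blast
    qed
  qed (use lower_half_indices partner_indices in auto)
  moreover have "inj_on partner lower_half"
    using lower_half_indices partner_partner by (metis inj_on_def subsetD)
  moreover have "finite lower_half"
    using finite_subset[OF lower_half_indices finite_indices] .
  ultimately show ?thesis
    using partner_lower_half by (subst \<open>indices = _\<close>, subst card_Un_disjoint) (auto simp: card_image)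
qed

lemma pairing_unit:
  assumes "p \<in> indices"
  shows "pairing (unit p) (unit q) = (if q = partner p then (-1) ^ (snd p + 1) else (0 :: 'k::field))"
proof -
  obtain w m where p: "p = (w, m)" "w \<in> V" "1 \<le> m" "m \<le> len w"
    using assms by (auto simp: indices_def)
  have "pairing (unit p) (unit q) = (\<Sum>v\<in>{w}. \<Sum>l = 1..len v. (-1) ^ (l + 1) * (unit p (v, l)
      * unit q (v, len v + 1 - l) :: 'k))"
    unfolding pairing_def using p finite_verts
    by (intro sum.mono_neutral_right) (auto intro!: sum.neutral simp: unit_def)
  also have "\<dots> = (\<Sum>l = 1..len w. (-1) ^ (l + 1) * (unit p (w, l) * unit q (w, len w + 1 - l)))"
    by simp
  also have "\<dots> = (\<Sum>l = 1..len w. if l = m then (-1) ^ (l + 1) * unit q (w, len w + 1 - l) else 0)"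
    by (intro sum.cong refl) (simp add: unit_def p(1))
  also have "\<dots> = (-1) ^ (m + 1) * unit q (w, len w + 1 - m)"
    using p by (simp add: sum.delta)
  finally show ?thesis
    by (auto simp: p(1) partner_def unit_def)
qed

text \<open>The Gram matrix of the list \<open>p\<^sub>0, p'\<^sub>0, p\<^sub>1, p'\<^sub>1, \<dots>\<close>, where the \<open>p\<^sub>i\<close> run through the lower halves
  of the chains and \<open>p'\<^sub>i\<close> is the partner of \<open>p\<^sub>i\<close>. The sign changes between \<open>l\<close> and \<open>len v + 1 - l\<close>,
  since these have opposite parities.\<close>

lemma pairing_lower_half:
  fixes e :: "nat \<Rightarrow> 'v \<times> nat"
  defines "x a \<equiv> if even a then e (a div 2) else partner (e (a div 2))"
  assumes e: "bij_betw e {..<n} lower_half" and a: "a < 2 * n" and b: "b < 2 * n"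
  shows "pairing (unit (x a)) (unit (x b)) = paired_matrix (\<lambda>j. (-1 :: 'k::field) ^ (snd (e j) + 1)) a b"
proof -
  have low: "e i \<in> lower_half" if "i < n" for i
    using e that by (auto simp: bij_betw_def)
  then have ind: "e i \<in> indices" if "i < n" for i
    using that lower_half_indices by blast
  have e_eq: "e i = e j \<longleftrightarrow> i = j" if "i < n" "j < n" for i j
    using e that by (auto simp: bij_betw_def inj_on_def)
  have not_partner: "e i \<noteq> partner (e j)" if "i < n" "j < n" for i j
    using low[OF that(1)] partner_lower_half[OF low[OF that(2)]] by auto
  have p_eq: "partner (e i) = partner (e j) \<longleftrightarrow> i = j" if "i < n" "j < n" for i j
    using that partner_partner[OF ind] e_eq by metis
  have sign: "(-1 :: 'k) ^ Suc (snd (partner (e i))) = - ((-1) ^ Suc (snd (e i)))" if i: "i < n" for i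
  proof -
    obtain v l where vl: "e i = (v, l)" "v \<in> V" "l \<le> len v"
      using ind[OF i] by (cases "e i") (auto simp: indices_def)
    then show ?thesis
      using even_len[OF vl(2)] by (cases "even l") (auto simp: partner_def minus_one_power_iff)
  qed
  obtain i j where ij: "a = 2 * i \<or> a = Suc (2 * i)" "b = 2 * j \<or> b = Suc (2 * j)"
    by (metis evenE oddE Suc_eq_plus1)
  then have n: "i < n" "j < n"
    using a b by auto
  have parity: "2 * i' \<noteq> Suc (2 * j')" "Suc (2 * j') \<noteq> 2 * i'" for i' j' :: nat
    by presburger+
  from ij show ?thesis
    using n ind partner_indices
    by (elim disjE) (auto simp: x_def pairing_unit e_eq not_partner not_partner[symmetric] p_eq
        partner_partner sign parity
        simp del: power_Suc)
qed

lemma sigma_symplectic: "symplectic_form (chain_lie G \<kappa> :: ('k::field_char_0, ('v, 'k) chain_elem) alg)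
    (sigma G \<kappa>)"
proof -
  let ?C = "chain_lie G \<kappa> :: ('k, ('v, 'k) chain_elem) alg"
  interpret C: lie_algebra ?C
    by (rule chain_lie_algebra)
  obtain \<Theta> where \<Theta>: "alg_hom ?C model (\<Theta> :: _ \<Rightarrow> _ \<Rightarrow> 'k)"
    and bij: "bij_betw \<Theta> (carrier ?C) (carrier model)"
    and vec: "\<And>v l. (v, l) \<in> indices \<Longrightarrow> chain_vec G \<kappa> (v, succ v) l \<in> carrier ?C
        \<and> \<Theta> (chain_vec G \<kappa> (v, succ v) l) = unit (v, l)"
    using chain_lie_coordinates[where 'k = 'k] by auto
  note hom = alg_homD[OF \<Theta>]
  define b where "b = (\<lambda>(v, l). chain_vec G \<kappa> (v, succ v) l :: ('v, 'k) chain_elem)"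
  have b: "b p \<in> carrier ?C" "\<Theta> (b p) = unit p" if "p \<in> indices" for p
    using vec[of "fst p" "snd p"] that by (auto simp: b_def case_prod_unfold)
  interpret coordinates ?C \<Theta> indices b
  proof
    show "inj_on \<Theta> (carrier ?C)"
      using bij by (simp add: bij_betw_def)
    show "\<lbrakk>x \<in> carrier ?C; \<Theta> x i \<noteq> 0\<rbrakk> \<Longrightarrow> i \<in> indices" for x i
      using hom(1)[of x] by (cases i) (auto simp: model_carrier)
  qed (simp_all add: finite_indices hom b unit_def)
  have std: "standard_basis G \<kappa> = b ` indices"
  proof -
    have first: "chain_vec G \<kappa> (v, succ v) 1 = (vertex_elem G \<kappa> v :: ('v, 'k) chain_elem)" for v
      by (simp add: chain_vec_def)
    show ?thesis
    proof
      show "standard_basis G \<kappa> \<subseteq> b ` indices"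
      proof
        fix x assume "x \<in> (standard_basis G \<kappa> :: ('v, 'k) chain_elem set)"
        then consider v where "v \<in> V" "x = vertex_elem G \<kappa> v"
          | v l where "v \<in> V" "2 \<le> l" "l \<le> len v" "x = chain_vec G \<kappa> (v, succ v) l"
          unfolding standard_basis_def len_def using parcs_iff by auto
        then show "x \<in> b ` indices"
        proof cases
          case 1
          then show ?thesis
            using first[of v] len_ge_2[of v] by (intro image_eqI[of _ _ "(v, 1)"]) (auto simp: b_def
                indices_def)
        next
          case 2
          then show ?thesis
            by (intro image_eqI[of _ _ "(v, l)"]) (auto simp: b_def indices_def)
        qed
      qed
      show "b ` indices \<subseteq> standard_basis G \<kappa>"
      proof clarify
        fix v l assume vl: "(v, l) \<in> indices"
        show "b (v, l) \<in> standard_basis G \<kappa>"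
        proof (cases "l = 1")
          case True
          then show ?thesis
            using vl first[of v] by (auto simp: b_def indices_def standard_basis_def)
        next
          case False
          then have "(v, succ v) \<in> parcs G \<and> 2 \<le> l \<and> l \<le> \<kappa> (v, succ v)"
            using vl by (auto simp: indices_def parcs_iff len_def)
          then show ?thesis
            unfolding b_def standard_basis_def prod.case by blast
        qed
      qed
    qed
  qed
  have dual: "chain_dual G \<kappa> (v, succ v) l [x] = (if x \<in> carrier ?C then \<Theta> x (v, l) else 0)"
    if "(v, l) \<in> indices" for v l x
    using dual_elem_coordinate[OF that] by (simp add: chain_dual_def std b_def)
  have arcs: "parcs G = (\<lambda>v. (v, succ v)) ` V"
    using parcs_iff by auto
  have sigma_val: "sigma G \<kappa> xs = (if length xs = 2 \<and> set xs \<subseteq> carrier ?C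
      then pairing (\<Theta> (xs ! 0)) (\<Theta> (xs ! 1)) else 0)" for xs
  proof (cases "length xs = 2")
    case False
    then show ?thesis
      by (simp add: sigma_def sigma_arc_def wedge_def)
  next
    case True
    then obtain x y where xs: "xs = [x, y]"
      by (auto simp: numeral_2_eq_2 length_Suc_conv)
    have wedge_val: "wedge 1 1 (chain_dual G \<kappa> (v, succ v) l) (chain_dual G \<kappa> (v, succ v) (len v + 1
        - l)) [x, y]
        = (if x \<in> carrier ?C \<and> y \<in> carrier ?C
           then \<Theta> x (v, l) * \<Theta> y (v, len v + 1 - l) - \<Theta> y (v, l) * \<Theta> x (v, len v + 1 - l) else 0)"
      if "v \<in> V" "l \<in> {1..len v div 2}" for v l
    proof -
      have "(v, l) \<in> indices" "(v, len v + 1 - l) \<in> indices"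
        using that by (auto simp: indices_def)
      then show ?thesis
        unfolding wedge_1_1 by (simp add: dual)
    qed
    have "sigma G \<kappa> xs = (\<Sum>v\<in>V. \<Sum>l = 1..len v div 2. (-1) ^ (l + 1) *
        wedge 1 1 (chain_dual G \<kappa> (v, succ v) l) (chain_dual G \<kappa> (v, succ v) (len v + 1 - l)) [x, y])"
      unfolding sigma_def arcs sigma_arc_def xs len_def by (subst sum.reindex) (auto simp: inj_on_def)
    also have "\<dots> = (\<Sum>v\<in>V. \<Sum>l = 1..len v div 2. (-1) ^ (l + 1) * (if x \<in> carrier ?C \<and> y \<in> carrier ?C
           then \<Theta> x (v, l) * \<Theta> y (v, len v + 1 - l) - \<Theta> y (v, l) * \<Theta> x (v, len v + 1 - l) else 0))"
      by (intro sum.cong refl arg_cong2[of _ _ _ _ times] wedge_val)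
    also have "\<dots> = (if x \<in> carrier ?C \<and> y \<in> carrier ?C then pairing (\<Theta> x) (\<Theta> y) else 0)"
      unfolding pairing_fold by (cases "x \<in> carrier ?C \<and> y \<in> carrier ?C")
        (simp_all only: if_True if_False mult_zero_right sum.neutral_const simp_thms)
    finally show ?thesis
      by (simp add: xs)
  qed
  have "sigma G \<kappa> \<in> forms ?C 2"
    unfolding forms_def
  proof (intro CollectI conjI allI impI)
    fix xs :: "('v, 'k) chain_elem list" and i :: nat and x y
    assume *: "length xs = 2 \<and> set xs \<subseteq> carrier ?C \<and> i < 2 \<and> x \<in> carrier ?C \<and> y \<in> carrier ?C"
    then obtain u w where xs: "xs = [u, w]"
      by (auto simp: numeral_2_eq_2 length_Suc_conv)
    have "\<Theta> (alg.add ?C x y) = (\<lambda>b. \<Theta> x b + \<Theta> y b)"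
      using * hom(3)[of x y] by simp
    moreover have "i = 0 \<or> i = 1" using * by auto
    ultimately show "sigma G \<kappa> (xs[i := alg.add ?C x y]) = sigma G \<kappa> (xs[i := x]) + sigma G \<kappa> (xs[i := y])"
      using * by (auto simp: xs sigma_val C.add_closed pairing_linear)
  next
    fix xs :: "('v, 'k) chain_elem list" and i :: nat and x c
    assume *: "length xs = 2 \<and> set xs \<subseteq> carrier ?C \<and> i < 2 \<and> x \<in> carrier ?C"
    then obtain u w where xs: "xs = [u, w]"
      by (auto simp: numeral_2_eq_2 length_Suc_conv)
    have "\<Theta> (alg.smult ?C c x) = (\<lambda>b. c * \<Theta> x b)"
      using * hom(4)[of x c] by simp
    moreover have "i = 0 \<or> i = 1" using * by auto
    ultimately show "sigma G \<kappa> (xs[i := alg.smult ?C c x]) = c * sigma G \<kappa> (xs[i := x])"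
      using * by (auto simp: xs sigma_val C.smult_closed pairing_linear)
  next
    fix xs :: "('v, 'k) chain_elem list"
    assume "\<not> distinct xs"
    then show "sigma G \<kappa> xs = 0"
      by (cases "length xs = 2") (auto simp: sigma_val numeral_2_eq_2 length_Suc_conv pairing_self)
  qed (auto simp: sigma_val)
  moreover have "d2 ?C (sigma G \<kappa>) = (\<lambda>_. 0)"
  proof
    fix xs :: "('v, 'k) chain_elem list"
    show "d2 ?C (sigma G \<kappa>) xs = 0"
    proof (cases "length xs = 3 \<and> set xs \<subseteq> carrier ?C")
      case True
      then obtain x y z where xs: "xs = [x, y, z]" "x \<in> carrier ?C" "y \<in> carrier ?C" "z \<in> carrier ?C"
        by (auto simp: numeral_3_eq_3 length_Suc_conv)
      then show ?thesis
        using pairing_closed[of "\<Theta> x" "\<Theta> y" "\<Theta> z"]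
        by (simp add: d2_def sigma_val C.bracket_closed hom(5))
    qed (auto simp: d2_def)
  qed
  moreover have "\<exists>n. has_dim ?C (2 * n) \<and> wedge_power2 (sigma G \<kappa>) n \<noteq> (\<lambda>_. 0 :: 'k)"
  proof (intro exI conjI)
    let ?n = "card lower_half"
    show "has_dim ?C (2 * ?n)"
      using dim by (simp add: card_indices)
    obtain e where e: "bij_betw e {..<?n} lower_half"
      using ex_bij_betw_nat_finite[OF finite_subset[OF lower_half_indices finite_indices]]
      by (auto simp: lessThan_atLeast0)
    define x where "x a = (if even a then e (a div 2) else partner (e (a div 2)))" for a
    define xs where "xs = map (\<lambda>a. b (x a)) [0..<2 * ?n]"
    let ?\<epsilon> = "\<lambda>j. (-1 :: 'k) ^ (snd (e j) + 1)"
    have x: "x a \<in> indices" if "a < 2 * ?n" for a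
    proof -
      have "e (a div 2) \<in> indices"
        using e that lower_half_indices by (auto simp: bij_betw_def)
      then show ?thesis
        using partner_indices by (simp add: x_def)
    qed
    have "wedge_power2 (sigma G \<kappa>) ?n xs = pfaffian_sum ?n (\<lambda>a c. sigma G \<kappa> [xs ! a, xs ! c]) / 2 ^ ?n"
      by (rule wedge_power2_pfaffian_sum) (simp add: xs_def)
    also have "pfaffian_sum ?n (\<lambda>a c. sigma G \<kappa> [xs ! a, xs ! c]) = pfaffian_sum ?n (paired_matrix ?\<epsilon>)"
    proof (rule pfaffian_sum_cong)
      fix a c assume ac: "a < 2 * ?n" "c < 2 * ?n"
      then have "sigma G \<kappa> [xs ! a, xs ! c] = pairing (unit (x a)) (unit (x c) :: _ \<Rightarrow> 'k)"
        using x by (simp add: sigma_val xs_def b)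
      also have "\<dots> = paired_matrix ?\<epsilon> a c"
        unfolding x_def using e ac by (rule pairing_lower_half)
      finally show "sigma G \<kappa> [xs ! a, xs ! c] = paired_matrix ?\<epsilon> a c" .
    qed
    finally have "wedge_power2 (sigma G \<kappa>) ?n xs \<noteq> (0 :: 'k)"
      by (simp add: pfaffian_sum_paired_matrix)
    then show "wedge_power2 (sigma G \<kappa>) ?n \<noteq> (\<lambda>_. 0 :: 'k)"
      by metis
  qed
  ultimately show ?thesis
    unfolding symplectic_form_def using C.lie_algebra_axioms by blast
qed

end

section \<open>Out-degrees in centripetal unicyclic graphs\<close>

lemma parcs_symmetric: "parcs (mk_symmetric (with_proj G)) = parcs G \<union> (parcs G)\<inverse>"
  by (auto simp: mk_symmetric_def)

lemma rtrancl_on_iff: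
  assumes "r \<subseteq> A \<times> A"
  shows "(u, v) \<in> rtrancl_on A r \<longleftrightarrow> u \<in> A \<and> (u, v) \<in> r\<^sup>*"
proof
  assume "u \<in> A \<and> (u, v) \<in> r\<^sup>*"
  then have "(u, v) \<in> r\<^sup>*" "u \<in> A" by auto
  then show "(u, v) \<in> rtrancl_on A r"
    by (induction rule: rtrancl_induct) (use assms in \<open>auto intro: rtrancl_on_into_rtrancl_on\<close>)
qed (auto dest: rtrancl_on_rtranclI in_rtrancl_on_in_F)

lemma reachable_iff:
  assumes "pair_wf_digraph H"
  shows "u \<rightarrow>\<^sup>*\<^bsub>with_proj H\<^esub> v \<longleftrightarrow> u \<in> pverts H \<and> (u, v) \<in> (parcs H)\<^sup>*"
proof -
  interpret pair_wf_digraph H by fact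
  show ?thesis
    unfolding reachable_def with_proj_simps by (rule rtrancl_on_iff) (auto dest: wellformed')
qed

lemma reachable_symmetric_iff:
  assumes "pair_wf_digraph H"
  shows "u \<rightarrow>\<^sup>*\<^bsub>with_proj (mk_symmetric (with_proj H))\<^esub> v
    \<longleftrightarrow> u \<in> pverts H \<and> (u, v) \<in> (parcs H \<union> (parcs H)\<inverse>)\<^sup>*"
proof -
  interpret pair_wf_digraph H by fact
  show ?thesis
    using reachable_iff[OF wellformed_mk_symmetric] by (simp add: parcs_symmetric)
qed

text \<open>Stop the walk at its first visit of \<open>v\<close>.\<close>

lemma rtrancl_avoid_out_arc:
  "(a, v) \<in> R\<^sup>* \<Longrightarrow> (a, v) \<in> (R - {(v, x)})\<^sup>*"
proof (induction rule: converse_rtrancl_induct)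
  case (step y z)
  then show ?case
    by (cases "y = v") (auto intro: converse_rtrancl_into_rtrancl)
qed simp

text \<open>A walk from \<open>a\<close> cannot use an arc out of a vertex that is unreachable from \<open>a\<close>.\<close>

lemma rtrancl_avoid_vertex:
  "\<lbrakk>(a, r) \<in> R\<^sup>*; (a, v) \<notin> R\<^sup>*\<rbrakk> \<Longrightarrow> (a, r) \<in> (R - {(v, x)})\<^sup>*"
proof (induction rule: converse_rtrancl_induct)
  case (step y z)
  then have "(z, v) \<notin> R\<^sup>*" "y \<noteq> v"
    by (auto intro: converse_rtrancl_into_rtrancl)
  then show ?case
    using step by (auto intro: converse_rtrancl_into_rtrancl)
qed simp

lemma closed_walk_arcs:
  assumes "pcas u p u" "distinct (tl (pawalk_verts u p))" "p \<noteq> []"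
  shows "snd ` set p \<subseteq> fst ` set p" and "inj_on fst (set p)"
proof -
  have 1: "snd ` set q \<subseteq> insert y (fst ` set q)" if "pcas x q y" for q and x y :: 'a
    using that by (induction x q y rule: pcas.induct) (force simp: image_iff elim: pcas.elims)+
  have 2: "pawalk_verts x q = map fst q @ [y]" if "pcas x q y" for q and x y :: 'a
    using that by (induction x q y rule: pcas.induct) auto
  obtain e q where p: "p = e # q" "fst e = u"
    using assms by (cases p) auto
  then show "snd ` set p \<subseteq> fst ` set p"
    using 1[OF assms(1)] by auto
  have "distinct (map fst p)"
    using assms(2) 2[OF assms(1)] p by auto
  then show "inj_on fst (set p)"
    by (simp add: distinct_map)
qed

locale oriented_graph = pair_fin_digraph +
  assumes asym: "(u, v) \<in> parcs G \<Longrightarrow> (v, u) \<notin> parcs G"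
begin

lemma wf_symmetric: "pair_wf_digraph (mk_symmetric (with_proj G))"
  by (rule wellformed_mk_symmetric)

lemma directed_cycle_undirected:
  assumes "cycle p"
  shows "undirected_cycle G p"
proof -
  interpret S: pair_wf_digraph "mk_symmetric (with_proj G)"
    by (rule wf_symmetric)
  obtain u where u: "awalk u p u" "distinct (tl (pawalk_verts u p))" "p \<noteq> []"
    using assms by (auto simp: cycle_def)
  then have sub: "set p \<subseteq> parcs G" and cas: "pcas u p u"
    by (auto simp: awalk_def)
  have "length p \<noteq> 1"
    using sub cas asym by (cases p) (auto, blast)
  moreover have "length p \<noteq> 2"
  proof
    assume "length p = 2"
    then obtain e f where "p = [e, f]"
      by (auto simp: numeral_2_eq_2 length_Suc_conv)
    then show False
      using sub cas asym by (cases e, cases f) auto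
  qed
  ultimately have "3 \<le> length p"
    using u(3) by (cases p; cases "tl p"; cases "tl (tl p)") auto
  moreover have "S.cycle p"
    using u by (auto simp: S.cycle_def S.awalk_def awalk_def parcs_symmetric)
  ultimately show ?thesis
    by (simp add: undirected_cycle_def)
qed

text \<open>A simple path from \<open>a\<close> to \<open>v\<close> without the edge between them closes up to a cycle. Its length is at
  least 3, because the only walk of length 1 from \<open>a\<close> to \<open>v\<close> is that edge.\<close>

lemma undirected_cycle_through_arc:
  assumes arc: "(v, a) \<in> parcs G"
    and path: "(a, v) \<in> (parcs G \<union> (parcs G)\<inverse> - {(v, a), (a, v)})\<^sup>*"
  shows "\<exists>p. undirected_cycle G p \<and> (v, a) \<in> set p"
proof -
  interpret S: pair_wf_digraph "mk_symmetric (with_proj G)"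
    by (rule wf_symmetric)
  define K where "K = \<lparr>pverts = pverts G, parcs = parcs G \<union> (parcs G)\<inverse> - {(v, a), (a, v)}\<rparr>"
  interpret K: pair_wf_digraph K
    by unfold_locales (auto simp: K_def dest: wellformed')
  have "a \<rightarrow>\<^sup>*\<^bsub>with_proj K\<^esub> v"
    unfolding reachable_iff[OF K.pair_wf_digraph_axioms]
    using path arc wellformed' by (auto simp: K_def)
  then obtain q where q: "K.apath a q v"
    using K.reachable_apath by blast
  then have sub: "set q \<subseteq> parcs K" and cas: "pcas a q v" and dist: "distinct (pawalk_verts a q)"
    by (auto simp: K.apath_def K.awalk_def)
  have ne: "a \<noteq> v"
    using arc asym by blast
  have "2 \<le> length q"
  proof (rule ccontr)
    assume "\<not> 2 \<le> length q"
    then consider "q = []" | e where "q = [e]"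
      by (cases q; cases "tl q") auto
    then show False
      by cases (use sub cas ne in \<open>auto simp: K_def\<close>)
  qed
  moreover have "S.cycle ((v, a) # q)"
  proof -
    have "S.awalk v ((v, a) # q) v"
      using sub cas arc wellformed' by (auto simp: S.awalk_def parcs_symmetric K_def)
    then show ?thesis
      using dist by (auto simp: S.cycle_def)
  qed
  ultimately have "undirected_cycle G ((v, a) # q)"
    by (simp add: undirected_cycle_def)
  then show ?thesis
    by (metis list.set_intros(1))
qed

text \<open>Let \<open>R\<close> be the set of the arcs off the directed cycle \<open>p\<close>, that is, of the arcs of the attached
  trees. Every vertex is joined to the cycle by edges from \<open>R\<close>, hence flows to the cycle along arcs of
  \<open>R\<close>; this yields an out-arc off the cycle, and on it \<open>p\<close> supplies one. Let \<open>v\<close> have two out-arcs. If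
      \<open>v\<close> is on the cycle, one of them is in
  \<open>R\<close>, and its head flows back to \<open>v\<close>. If \<open>v\<close> is off the cycle, the heads of both flow to the same root
  without passing \<open>v\<close>. In either case an arc in \<open>R\<close> lies on an undirected cycle, which differs from
  \<open>p\<close>.\<close>

lemma unique_out_arc:
  assumes uni: "unicyclic G" and cen: "centripetal G" and v: "v \<in> pverts G"
  shows "\<exists>!a. (v, a) \<in> parcs G"
proof -
  obtain p where p: "cycle p" and flow: "\<And>r u. \<lbrakk>r \<in> fst ` set p;
      u \<rightarrow>\<^sup>*\<^bsub>with_proj (mk_symmetric (with_proj (G\<lparr>parcs := parcs G - set p\<rparr>)))\<^esub> r\<rbrakk>
      \<Longrightarrow> u \<rightarrow>\<^sup>*\<^bsub>with_proj (G\<lparr>parcs := parcs G - set p\<rparr>)\<^esub> r"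
    using cen unfolding centripetal_def Let_def by blast
  define R where "R = parcs G - set p"
  define H where "H = G\<lparr>parcs := R\<rparr>"
  interpret H: pair_wf_digraph H
    by unfold_locales (auto simp: H_def R_def dest: wellformed')
  have flow: "(u, r) \<in> R\<^sup>*" if "r \<in> fst ` set p" "u \<in> pverts G" "(u, r) \<in> (R \<union> R\<inverse>)\<^sup>*" for r u
  proof -
    have "u \<rightarrow>\<^sup>*\<^bsub>with_proj (mk_symmetric (with_proj H))\<^esub> r"
      using that unfolding reachable_symmetric_iff[OF H.pair_wf_digraph_axioms] by (simp add: H_def)
    then have "u \<rightarrow>\<^sup>*\<^bsub>with_proj H\<^esub> r"
      using flow[of r u] that(1) by (simp add: H_def R_def)
    then show ?thesis
      unfolding reachable_iff[OF H.pair_wf_digraph_axioms] by (simp add: H_def)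
  qed
  obtain x where x: "awalk x p x" "distinct (tl (pawalk_verts x p))" "p \<noteq> []"
    using p by (auto simp: cycle_def)
  then have p_sub: "set p \<subseteq> parcs G" and "pcas x p x"
    by (auto simp: awalk_def)
  then have p_closed: "snd ` set p \<subseteq> fst ` set p" and p_inj: "inj_on fst (set p)"
    using closed_walk_arcs[of x p] x by auto
  \<comment> \<open>An arc off the cycle whose ends are joined without it would lie on a second cycle.\<close>
  have bridge: "(a, u) \<notin> (parcs G \<union> (parcs G)\<inverse> - {(u, a), (a, u)})\<^sup>*" if a: "(u, a) \<in> R" for u a
  proof
    assume "(a, u) \<in> (parcs G \<union> (parcs G)\<inverse> - {(u, a), (a, u)})\<^sup>*"
    then obtain p' where p': "undirected_cycle G p'" "(u, a) \<in> set p'"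
      using undirected_cycle_through_arc[of u a] a by (auto simp: R_def)
    obtain C where C: "\<And>q. undirected_cycle G q \<Longrightarrow> (\<lambda>(u, v). {u, v}) ` set q = C"
      using uni unfolding unicyclic_def by (elim conjE ex1E) metis
    have "(\<lambda>(u, v). {u, v}) ` set p' = (\<lambda>(u, v). {u, v}) ` set p"
      unfolding C[OF p'(1)] C[OF directed_cycle_undirected[OF p]] ..
    then obtain y z where "(y, z) \<in> set p" "{u, a} = {y, z}"
      using p'(2) imageI[of "(u, a)" "set p'" "\<lambda>(u, v). {u, v}"]
          by (metis (no_types, lifting) imageE old.prod.case prod.collapse)
    then show False
      using a p_sub asym by (auto simp: R_def doubleton_eq_iff)
  qed
  have no_return: "(a, u) \<notin> R\<^sup>*" if "(u, a) \<in> R" for u a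
  proof
    assume "(a, u) \<in> R\<^sup>*"
    then have "(a, u) \<in> (R - {(u, a)})\<^sup>*"
      by (rule rtrancl_avoid_out_arc)
    moreover have "R - {(u, a)} \<subseteq> parcs G \<union> (parcs G)\<inverse> - {(u, a), (a, u)}"
      using that asym by (auto simp: R_def)
    ultimately show False
      using bridge[OF that] rtrancl_mono by blast
  qed
  have to_cycle: "\<exists>r\<in>fst ` set p. (u, r) \<in> (R \<union> R\<inverse>)\<^sup>*" if u: "u \<in> pverts G" for u
  proof -
    obtain r0 where r0: "r0 \<in> fst ` set p"
      using x(3) by (cases p) auto
    then have "r0 \<in> pverts G"
      using p_sub wellformed' by auto
    then have "u \<rightarrow>\<^sup>*\<^bsub>with_proj (mk_symmetric (with_proj G))\<^esub> r0"
      using uni u by (auto simp: unicyclic_def connected_def strongly_connected_def)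
    then have "(u, r0) \<in> (parcs G \<union> (parcs G)\<inverse>)\<^sup>*"
      by (simp add: reachable_symmetric_iff[OF pair_wf_digraph_axioms])
    then show ?thesis
    proof (induction rule: converse_rtrancl_induct)
      case base
      then show ?case using r0 by blast
    next
      case (step y z)
      show ?case
      proof (cases "y \<in> fst ` set p")
        case False
        then have "(y, z) \<notin> set p" "(z, y) \<notin> set p"
          using p_closed by force+
        then have "(y, z) \<in> R \<union> R\<inverse>"
          using step by (auto simp: R_def)
        then show ?thesis
          using step by (meson converse_rtrancl_into_rtrancl)
      qed blast
    qed
  qed
  have "\<exists>a. (v, a) \<in> parcs G"
  proof (cases "v \<in> fst ` set p")
    case True
    then show ?thesis using p_sub by auto
  next
    case False
    obtain r where "r \<in> fst ` set p" "(v, r) \<in> R\<^sup>*"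
      using to_cycle[OF v] flow v by blast
    then show ?thesis
      using False by (metis DiffD1 R_def converse_rtranclE)
  qed
  moreover have "a = b" if ab: "(v, a) \<in> parcs G" "(v, b) \<in> parcs G" for a b
  proof (cases "v \<in> fst ` set p")
    case True
    have "(v, c) \<in> set p" if "(v, c) \<in> parcs G" for c
    proof (rule ccontr)
      assume "(v, c) \<notin> set p"
      then have c: "(v, c) \<in> R"
        using that by (simp add: R_def)
      then have "(c, v) \<in> R\<^sup>*"
        using flow[OF True, of c] that wellformed' by blast
      then show False
        using no_return[OF c] by blast
    qed
    then show ?thesis
      using inj_onD[OF p_inj, of "(v, a)" "(v, b)"] ab by simp
  next
    case False
    then have R: "(v, a) \<in> R" "(v, b) \<in> R"
      using ab by (force simp: R_def)+
    obtain r where r: "r \<in> fst ` set p" "(v, r) \<in> (R \<union> R\<inverse>)\<^sup>*"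
      using to_cycle[OF v] by blast
    have r_path: "(c, r) \<in> (R - {(v, a)})\<^sup>*" if c: "(v, c) \<in> R" for c
    proof (rule rtrancl_avoid_vertex)
      have "(c, r) \<in> (R \<union> R\<inverse>)\<^sup>*"
        using c r(2) by (auto intro: converse_rtrancl_into_rtrancl)
      then show "(c, r) \<in> R\<^sup>*"
        using flow[OF r(1)] c wellformed' by (auto simp: R_def)
    qed (rule no_return[OF c])
    show ?thesis
    proof (rule ccontr)
      assume "a \<noteq> b"
      let ?T = "parcs G \<union> (parcs G)\<inverse> - {(v, a), (a, v)}"
      have T: "R - {(v, a)} \<subseteq> ?T" "(R - {(v, a)})\<inverse> \<subseteq> ?T"
        using asym ab by (auto simp: R_def)
      have "(a, r) \<in> ?T\<^sup>*"
        using r_path[OF R(1)] rtrancl_mono[OF T(1)] by blast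
      moreover have "(r, b) \<in> ?T\<^sup>*"
        using r_path[OF R(2)] rtrancl_mono[OF T(2)] by (auto dest: rtrancl_converseI)
      moreover have "(b, v) \<in> ?T"
        using ab \<open>a \<noteq> b\<close> asym by auto
      ultimately have "(a, v) \<in> ?T\<^sup>*"
        by (meson rtrancl.rtrancl_into_rtrancl rtrancl_trans)
      then show False
        using bridge[OF R(1)] by blast
    qed
  qed
  ultimately show ?thesis
    by blast
qed

end

theorem theorem4p8:
  fixes G :: "'v pair_pre_digraph" and \<kappa> :: "'v \<times> 'v \<Rightarrow> nat"
  assumes "family_F2 G \<kappa>"
  shows "symplectic (chain_lie G \<kappa> :: ('k::field_char_0, ('v, 'k) chain_elem) alg)
    \<and> symplectic_form (chain_lie G \<kappa> :: ('k, ('v, 'k) chain_elem) alg) (sigma G \<kappa>)"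
proof -
  have F2: "chain_digraph G \<kappa>" "unicyclic G" "centripetal G" "\<And>e. e \<in> parcs G \<Longrightarrow> even (\<kappa> e)"
    using assms by (auto simp: family_F2_def)
  interpret oriented_graph G
    using F2(1) by (auto simp: chain_digraph_def oriented_graph_def oriented_graph_axioms_def)
  define succ where "succ v = (THE a. (v, a) \<in> parcs G)" for v
  have succ: "(v, a) \<in> parcs G \<longleftrightarrow> a = succ v" if "v \<in> pverts G" for v a
    using unique_out_arc[OF F2(2,3) that] theI'[OF unique_out_arc[OF F2(2,3) that]]
    unfolding succ_def by blast
  interpret functional_chain_digraph G \<kappa> succ
    by unfold_locales (use F2(1) succ in auto)
  interpret even_functional_chain_digraph G \<kappa> succ
    by unfold_locales (use F2(4) succ in \<open>auto simp: len_def\<close>)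
  show ?thesis
    using sigma_symplectic unfolding symplectic_def by blast
qed

end
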